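(* Let $n\ge 2$, $0\le m\le n$ and let $p_{jk}$ ($1\le j,k\le n$) be real constants. Let $a=\mathrm{diag}(a_1,\dots,a_n)$ and let $b=(b_{jk})$ be an $(n\times n)$-matrix, where $a_j, b_{jk}\in BC^1(\Pi)$ for all $j,k\le n$. Suppose that for some $\Lambda_0>0$ $$\inf_{(x,t)\in\overline\Pi}a_j\ge\Lambda_0\ \text{ for all } j\le m,\qquad \sup_{(x,t)\in\overline\Pi}a_j\le-\Lambda_0\ \text{ for all } j>m .$$ Assume that there is $k\in\mathbb N$ such that $(CP)^ku\equiv0$ for all $u\in C(\overline\Pi)^n$, where the operators $C$ and $P$ (built from $a_j$, $b_{jj}$, $p_{jk}$) are defined in the context. Moreover, assume that for all $1\le j\ne k\le n$ there exists $\beta_{jk}\in BC^1(\Pi)$ such that $b_{jk}=\beta_{jk}(a_k-a_j)$. Then the evolution family $\{U(t,\tau)\}_{t\ge\tau}$ on $L^2(0,1)^n$ generated by the problem $$\partial_t u+a(x,t)\partial_x u+b(x,t)u=0,\quad (x,t)\in\Pi,$$ $$u_j(0,t)=\sum_{k=1}^m p_{jk}u_k(1,t)+\sum_{k=m+1}^n p_{jk}u_k(0,t),\quad 1\le j\le m,$$ $$u_j(1,t)=\sum_{k=1}^m p_{jk}u_k(1,t)+\sum_{k=m+1}^n p_{jk}u_k(0,t),\quad m<j\le n,$$ is smoothing from $L^2(0,1)^n$ to $C^1([0,1])^n$.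
   Context: $\Pi=\{(x,t):0<x<1,\ t\in\mathbb R\}$ and, for $\tau\in\mathbb R$, $\Pi_\tau=\{(x,t):0<x<1,\ t>\tau\}$. $BC(\Pi)$ is the space of bounded continuous functions $u:\overline\Pi\to\mathbb R$ with sup norm $\|\cdot\|_\infty$; $BC^1(\Pi)$ is the space of $u\in BC(\Pi)$ with $\partial_xu,\partial_tu\in BC(\Pi)$, with norm $\|u\|_1=\|u\|_\infty+\|\partial_xu\|_\infty+\|\partial_tu\|_\infty$. $X^n$ carries the norm $\max_{i\le n}\|u_i\|_X$. $\mathcal L(X,Y)$ is the space of bounded linear operators from $X$ to $Y$, $\mathcal L(X)=\mathcal L(X,X)$. Operators $C$ and $P$. For $j\le n$, $x\in[0,1]$, $t\in\mathbb R$, let $\xi\in[0,1]\mapsto\omega_j(\xi,x,t)$ be the solution of $\partial_\xi\omega_j(\xi,x,t)=1/a_j(\xi,\omega_j(\xi,x,t))$, $\omega_j(x,x,t)=t$. Put $c_j(\xi,x,t)=\exp\int_x^\xi\left(\frac{b_{jj}}{a_j}\right)(\eta,\omega_j(\eta,x,t))\,d\eta$, and $x_j=0$ for $1\le j\le m$, $x_j=1$ for $m<j\le n$. For $u\in C(\overline\Pi)^n$ and $v\in C(\mathbb R)^n$ let $$(Pu)_j(t)=\sum_{k=1}^m p_{jk}u_k(1,t)+\sum_{k=m+1}^n p_{jk}u_k(0,t),\qquad (Cv)_j(x,t)=c_j(x_j,x,t)\,v_j(\omega_j(x_j,x,t)),\quad j\le n.$$ Evolution family. A family $\{U(t,\tau)\}_{t\ge\tau}$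 of bounded linear operators on a Banach space $X$ is an evolution family if $U(\tau,\tau)=I$, $U(t,s)U(s,\tau)=U(t,\tau)$ for $t\ge s\ge\tau$, and $(t,\tau)\mapsto U(t,\tau)$ is strongly continuous on $\{t\ge\tau\}$. For every $\tau\in\mathbb R$ and $\varphi\in C_0^\infty([0,1])^n$ (smooth, compactly supported in $(0,1)$) there is a unique classical solution $u\in C^1(\overline\Pi_\tau)^n$ of the system in $\Pi_\tau$ with the boundary conditions and $u(x,\tau)=\varphi(x)$. The evolution family generated by the problem on $L^2(0,1)^n$ is the one for which $U(t,\tau)\varphi=u(\cdot,t)$ for these $\varphi$; for general $\varphi\in L^2(0,1)^n$, $U(t,\tau)\varphi$ is the $L^2$-limit, uniform in $t$ on compact subintervals of $[\tau,\infty)$, of classical solutions with initial data $\varphi^l\in C_0^\infty([0,1])^n$, $\varphi^l\to\varphi$ in $L^2(0,1)^n$. Smoothing. Let $Y\hookrightarrow Z$ be continuously embedded Banach spaces and $V(t,\tau)\in\mathcal L(Z)$ for all $t\ge\tau$. The family $\{V(t,\tau)\}_{t\ge\tau}$ is smoothing from $Z$ to $Y$ if there is $T>0$ such that $V(t,\tau)\in\mathcal L(Z,Y)$ for all $t\ge\tau+T$ ($T$ independent of $\tau$ and $t$). *)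

theory Defs
  imports "HOL-Analysis.Analysis"
begin

text \<open>
  Components are indexed by the natural numbers \<open>j \<in> {1..n}\<close>; an \<open>n\<close>-tuple of functions is a
  function of the index whose values outside \<open>{1..n}\<close> are irrelevant. Functions on the closed
  strips are total functions on \<open>real \<times> real\<close> (arguments \<open>(x, t)\<close>) whose values off
  the strip are irrelevant.
\<close>

type_synonym vfun = "nat \<Rightarrow> real \<Rightarrow> real"
type_synonym vfield = "nat \<Rightarrow> real \<times> real \<Rightarrow> real"

definition strip :: "(real \<times> real) set"
  where "strip = {0..1} \<times> UNIV"

definition strip_from :: "real \<Rightarrow> (real \<times> real) set"
  where "strip_from \<tau> = {0..1} \<times> {\<tau>..}"


subsection \<open>Continuously differentiable functions\<close>

text \<open>
  On the boundary of \<open>D\<close> the derivatives are one-sided. For the closed strips this is the same as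
  requiring that the interior derivatives extend continuously to the closure.
\<close>

definition dx :: "(real \<times> real) set \<Rightarrow> (real \<times> real \<Rightarrow> real) \<Rightarrow> real \<times> real \<Rightarrow> real"
  where "dx D u = (\<lambda>(x, t). vector_derivative (\<lambda>\<xi>. u (\<xi>, t)) (at x within {\<xi>. (\<xi>, t) \<in> D}))"

definition dt :: "(real \<times> real) set \<Rightarrow> (real \<times> real \<Rightarrow> real) \<Rightarrow> real \<times> real \<Rightarrow> real"
  where "dt D u = (\<lambda>(x, t). vector_derivative (\<lambda>s. u (x, s)) (at t within {s. (x, s) \<in> D}))"

definition C1_on :: "(real \<times> real) set \<Rightarrow> (real \<times> real \<Rightarrow> real) set"
  where "C1_on D = {u. continuous_on D u
    \<and> (\<forall>(x, t)\<in>D. (\<lambda>\<xi>. u (\<xi>, t)) differentiable (at x within {\<xi>. (\<xi>, t) \<in> D})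
               \<and> (\<lambda>s. u (x, s)) differentiable (at t within {s. (x, s) \<in> D}))
    \<and> continuous_on D (dx D u) \<and> continuous_on D (dt D u)}"

definition BC1 :: "(real \<times> real \<Rightarrow> real) set"
  where "BC1 = {u \<in> C1_on strip.
    bounded (u ` strip) \<and> bounded (dx strip u ` strip) \<and> bounded (dt strip u ` strip)}"


subsection \<open>The operators \<open>C\<close> and \<open>P\<close>\<close>

definition is_characteristic :: "(real \<times> real \<Rightarrow> real) \<Rightarrow> real \<Rightarrow> real \<Rightarrow> (real \<Rightarrow> real) \<Rightarrow> bool"
  where "is_characteristic a x t w \<longleftrightarrow> w x = t \<and>
    (\<forall>\<xi>\<in>{0..1}. (w has_real_derivative 1 / a (\<xi>, w \<xi>)) (at \<xi> within {0..1}))"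

text \<open>
  The description is of the value at \<open>\<xi>\<close>, because a solution \<open>w\<close> is only determined on \<open>[0,1]\<close>.
\<close>

definition omega :: "(real \<times> real \<Rightarrow> real) \<Rightarrow> real \<Rightarrow> real \<Rightarrow> real \<Rightarrow> real"
  where "omega a \<xi> x t = (THE s. \<exists>w. is_characteristic a x t w \<and> s = w \<xi>)"

definition cfac :: "(real \<times> real \<Rightarrow> real) \<Rightarrow> (real \<times> real \<Rightarrow> real) \<Rightarrow> real \<Rightarrow> real \<Rightarrow> real \<Rightarrow> real"
  where "cfac a bd \<xi> x t =
    exp (LBINT \<eta>=x..\<xi>. bd (\<eta>, omega a \<eta> x t) / a (\<eta>, omega a \<eta> x t))"

definition bpt :: "nat \<Rightarrow> nat \<Rightarrow> real"
  where "bpt m j = (if j \<le> m then 0 else 1)"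

definition Pop :: "nat \<Rightarrow> nat \<Rightarrow> (nat \<Rightarrow> nat \<Rightarrow> real) \<Rightarrow> vfield \<Rightarrow> vfun"
  where "Pop m n p u j t = (\<Sum>k=1..m. p j k * u k (1, t)) + (\<Sum>k=m+1..n. p j k * u k (0, t))"

definition Cop :: "nat \<Rightarrow> vfield \<Rightarrow> (nat \<Rightarrow> vfield) \<Rightarrow> vfun \<Rightarrow> vfield"
  where "Cop m a b v j = (\<lambda>(x, t).
    cfac (a j) (b j j) (bpt m j) x t * v j (omega (a j) (bpt m j) x t))"


subsection \<open>Function spaces and operators between them\<close>

text \<open>
  A normed space is given by representatives and a seminorm; \<open>f\<close> and \<open>g\<close> represent the same
  element iff the seminorm of \<open>f - g\<close> vanishes (equality almost everywhere for \<open>L\<^sup>2\<close>).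
\<close>

record nspace =
  pts :: "vfun set"
  nrm :: "vfun \<Rightarrow> real"

definition ndist :: "nspace \<Rightarrow> vfun \<Rightarrow> vfun \<Rightarrow> real"
  where "ndist X f g = nrm X (\<lambda>j x. f j x - g j x)"

definition same :: "nspace \<Rightarrow> vfun \<Rightarrow> vfun \<Rightarrow> bool"
  where "same X f g \<longleftrightarrow> ndist X f g = 0"

definition L2 :: "nat \<Rightarrow> nspace"
  where "L2 n = \<lparr>
    pts = {f. \<forall>j\<in>{1..n}. f j \<in> borel_measurable (lebesgue_on {0<..<1}) \<and>
                integrable (lebesgue_on {0<..<1}) (\<lambda>x. (f j x)\<^sup>2)},
    nrm = (\<lambda>f. Max ((\<lambda>j. sqrt (LINT x|lebesgue_on {0<..<1}. (f j x)\<^sup>2)) ` {1..n}))\<rparr>"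

definition C1 :: "nat \<Rightarrow> nspace"
  where "C1 n = \<lparr>
    pts = {f. \<forall>j\<in>{1..n}. f j differentiable_on {0..1} \<and>
                continuous_on {0..1} (\<lambda>x. vector_derivative (f j) (at x within {0..1}))},
    nrm = (\<lambda>f. Max ((\<lambda>j. (SUP x\<in>{0..1}. \<bar>f j x\<bar>)
                + (SUP x\<in>{0..1}. \<bar>vector_derivative (f j) (at x within {0..1})\<bar>)) ` {1..n}))\<rparr>"

definition bounded_op :: "nspace \<Rightarrow> nspace \<Rightarrow> (vfun \<Rightarrow> vfun) \<Rightarrow> bool"
  where "bounded_op X Y A \<longleftrightarrow>
    (\<forall>f\<in>pts X. A f \<in> pts Y) \<and>
    (\<forall>f\<in>pts X. \<forall>g\<in>pts X. same Y (A (\<lambda>j x. f j x + g j x)) (\<lambda>j x. A f j x + A g j x)) \<and>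
    (\<forall>f\<in>pts X. \<forall>r. same Y (A (\<lambda>j x. r * f j x)) (\<lambda>j x. r * A f j x)) \<and>
    (\<exists>K. \<forall>f\<in>pts X. nrm Y (A f) \<le> K * nrm X f)"

definition embedded :: "nspace \<Rightarrow> nspace \<Rightarrow> bool"
  where "embedded Y Z \<longleftrightarrow> pts Y \<subseteq> pts Z \<and> (\<exists>K. \<forall>f\<in>pts Y. nrm Z f \<le> K * nrm Y f)"

definition evolution_family :: "nspace \<Rightarrow> (real \<Rightarrow> real \<Rightarrow> vfun \<Rightarrow> vfun) \<Rightarrow> bool"
  where "evolution_family X U \<longleftrightarrow>
    (\<forall>\<tau> t. \<tau> \<le> t \<longrightarrow> bounded_op X X (U t \<tau>)) \<and>
    (\<forall>\<tau>. \<forall>f\<in>pts X. same X (U \<tau> \<tau> f) f) \<and>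
    (\<forall>\<tau> s t. \<tau> \<le> s \<longrightarrow> s \<le> t \<longrightarrow> (\<forall>f\<in>pts X. same X (U t s (U s \<tau> f)) (U t \<tau> f))) \<and>
    (\<forall>f\<in>pts X. \<forall>\<tau>\<^sub>0 t\<^sub>0. \<tau>\<^sub>0 \<le> t\<^sub>0 \<longrightarrow>
       ((\<lambda>(t, \<tau>). ndist X (U t \<tau> f) (U t\<^sub>0 \<tau>\<^sub>0 f)) \<longlongrightarrow> 0)
         (at (t\<^sub>0, \<tau>\<^sub>0) within {(t, \<tau>). \<tau> \<le> t}))"

text \<open>
  \<open>V t \<tau> \<in> \<L>(Z,Y)\<close> means that \<open>V t \<tau>\<close> agrees, as a map into \<open>Z\<close>, with a bounded
  linear operator \<open>W\<close> into \<open>Y\<close>; \<open>W\<close> selects the representatives that lie in \<open>Y\<close>.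
\<close>

definition smoothing :: "nspace \<Rightarrow> nspace \<Rightarrow> (real \<Rightarrow> real \<Rightarrow> vfun \<Rightarrow> vfun) \<Rightarrow> bool"
  where "smoothing Z Y V \<longleftrightarrow>
    embedded Y Z \<and> (\<forall>\<tau> t. \<tau> \<le> t \<longrightarrow> bounded_op Z Z (V t \<tau>)) \<and>
    (\<exists>T>0. \<forall>\<tau> t. \<tau> + T \<le> t \<longrightarrow>
       (\<exists>W. bounded_op Z Y W \<and> (\<forall>f\<in>pts Z. same Z (W f) (V t \<tau> f))))"


subsection \<open>The evolution family generated by the boundary value problem\<close>

text \<open>Smooth functions with compact support in \<open>(0,1)\<close>, extended by zero to the real line.\<close>

definition test_fun :: "(real \<Rightarrow> real) \<Rightarrow> bool"
  where "test_fun \<phi> \<longleftrightarrow> (\<forall>k x. (deriv ^^ k) \<phi> field_differentiable (at x)) \<and>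
    (\<exists>c d. 0 < c \<and> d < 1 \<and> (\<forall>x. x \<notin> {c..d} \<longrightarrow> \<phi> x = 0))"

definition classical_solution ::
  "nat \<Rightarrow> nat \<Rightarrow> vfield \<Rightarrow> (nat \<Rightarrow> vfield) \<Rightarrow> (nat \<Rightarrow> nat \<Rightarrow> real) \<Rightarrow> real \<Rightarrow> vfun \<Rightarrow> vfield \<Rightarrow> bool"
  where "classical_solution m n a b p \<tau> \<phi> u \<longleftrightarrow> (\<forall>j\<in>{1..n}.
    u j \<in> C1_on (strip_from \<tau>) \<and>
    (\<forall>x t. 0 < x \<longrightarrow> x < 1 \<longrightarrow> \<tau> < t \<longrightarrow>
       dt (strip_from \<tau>) (u j) (x, t) + a j (x, t) * dx (strip_from \<tau>) (u j) (x, t)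
         + (\<Sum>k=1..n. b j k (x, t) * u k (x, t)) = 0) \<and>
    (\<forall>t\<ge>\<tau>. u j (bpt m j, t) = Pop m n p u j t) \<and>
    (\<forall>x\<in>{0..1}. u j (x, \<tau>) = \<phi> j x))"

definition generated_family ::
  "nat \<Rightarrow> nat \<Rightarrow> vfield \<Rightarrow> (nat \<Rightarrow> vfield) \<Rightarrow> (nat \<Rightarrow> nat \<Rightarrow> real) \<Rightarrow>
   (real \<Rightarrow> real \<Rightarrow> vfun \<Rightarrow> vfun) \<Rightarrow> bool"
  where "generated_family m n a b p U \<longleftrightarrow>
    evolution_family (L2 n) U \<and>
    (\<forall>\<tau> \<phi>. (\<forall>j\<in>{1..n}. test_fun (\<phi> j)) \<longrightarrow>
       (\<exists>u. classical_solution m n a b p \<tau> \<phi> u) \<and>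
       (\<forall>u. classical_solution m n a b p \<tau> \<phi> u \<longrightarrow>
          (\<forall>t\<ge>\<tau>. same (L2 n) (U t \<tau> \<phi>) (\<lambda>j x. u j (x, t))))) \<and>
    (\<forall>\<tau>. \<forall>\<phi>\<in>pts (L2 n). \<exists>\<phi>s us.
       (\<forall>l. (\<forall>j\<in>{1..n}. test_fun (\<phi>s l j)) \<and> classical_solution m n a b p \<tau> (\<phi>s l) (us l)) \<and>
       (\<lambda>l. ndist (L2 n) (\<phi>s l) \<phi>) \<longlonglongrightarrow> 0 \<and>
       (\<forall>t\<^sub>1\<ge>\<tau>. uniform_limit {\<tau>..t\<^sub>1}
          (\<lambda>l t. ndist (L2 n) (\<lambda>j x. us l j (x, t)) (U t \<tau> \<phi>)) (\<lambda>t. 0) sequentially))"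

end

theory Submission
  imports Defs
begin

text \<open>
  Let \<open>Q = CP\<close>. A solution \<open>u\<close> satisfies \<open>u = Q u + w\<close>, where \<open>w\<close> collects the integrals of
  \<open>b\<^sub>j\<^sub>k u\<^sub>k\<close>, \<open>j \<noteq> k\<close>, along the \<open>j\<close>-th characteristics, and \<open>Q\<^sup>N = 0\<close> turns this into
  \<open>u = \<Sum>i<N. Q\<^sup>i w\<close> at times far enough from the initial one. Since
  \<open>b\<^sub>j\<^sub>k = \<beta>\<^sub>j\<^sub>k (a\<^sub>k - a\<^sub>j)\<close>, the \<open>t\<close>-derivative of the integrand of \<open>w\<close> is a derivative along the
  characteristic up to terms of order zero in \<open>u\<close>, so \<open>\<partial>\<^sub>t w\<close>, and with it \<open>\<partial>\<^sub>t u\<close>, is bounded by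
  \<open>u\<close> itself, both in \<open>L\<^sup>1\<close> and in the sup norm in time. Hence
  \<open>L\<^sup>1\<close> bounds on \<open>u\<close> give \<open>L\<^sup>1\<close> bounds on \<open>\<partial>\<^sub>t u\<close>, hence sup bounds on \<open>u\<close>, hence sup bounds on
  \<open>\<partial>\<^sub>t u\<close>, and the system bounds \<open>\<partial>\<^sub>x u\<close>. A weighted energy estimate starts this chain from the
  \<open>L\<^sup>2\<close> norm of the initial data, and density of the classical solutions finishes the proof.
\<close>

section \<open>Calculus on the strip\<close>

text \<open>The energy controls \<open>u\<close> on lines of fixed time, whereas \<open>Q\<close>
  reads traces on lines of fixed \<open>x\<close>, and an L^2 bound on a time slice says nothing
  about traces. The exchange happens in \<open>w\<close>: it is an integral along characteristics,
  and integrating it once more over a time window sweeps out a region of the strip, where Fubini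
  returns to lines of fixed time. \<open>Q\<close> only transports boundary values and improves
  nothing, so without nilpotency a term \<open>Q^N u\<close>, as rough as \<open>u\<close>, would
  survive in the expansion. The derivative of \<open>w\<close> in \<open>t\<close> contains
  derivatives of \<open>u_k\<close>; writing them as a derivative along the \<open>j\<close>-th
  characteristic plus the left side of the \<open>k\<close>-th transport equation is what lowers the
  order. The price is locality in time. With \<open>L\<close> bounding all \<open>1/a_j\<close>, a
  characteristic strays at most \<open>L\<close> from its label, so each application of
  \<open>Q\<close> needs its argument on a window enlarged by \<open>L\<close>, and the system must
  hold there. The number of these losses depends on \<open>N\<close> only, which is why the
  resulting \<open>T\<close> is independent of both times.\<close>

definition has_dx :: "(real \<times> real \<Rightarrow> real) \<Rightarrow> (real \<times> real \<Rightarrow> real) \<Rightarrow> bool"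
  where "has_dx c c' \<longleftrightarrow>
    (\<forall>x\<in>{0..1}. \<forall>t. ((\<lambda>\<xi>. c (\<xi>, t)) has_real_derivative c' (x, t)) (at x within {0..1}))"

definition has_dt :: "(real \<times> real \<Rightarrow> real) \<Rightarrow> (real \<times> real \<Rightarrow> real) \<Rightarrow> bool"
  where "has_dt c c' \<longleftrightarrow>
    (\<forall>x\<in>{0..1}. \<forall>t. ((\<lambda>s. c (x, s)) has_real_derivative c' (x, t)) (at t))"

text \<open>Partial derivatives are carried as explicit functions instead of through
  \<open>dx\<close> and \<open>dt\<close>, so that derivatives of products, quotients and
  compositions with characteristics are given by formulas that can be estimated.\<close>

definition C1_strip ::
    "(real \<times> real \<Rightarrow> real) \<Rightarrow> (real \<times> real \<Rightarrow> real) \<Rightarrow> (real \<times> real \<Rightarrow> real) \<Rightarrow> bool"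
  where "C1_strip c cx ct \<longleftrightarrow> continuous_on strip c \<and> continuous_on strip cx \<and>
    continuous_on strip ct \<and> has_dx c cx \<and> has_dt c ct"

definition bounded_strip :: "(real \<times> real \<Rightarrow> real) \<Rightarrow> bool"
  where "bounded_strip c \<longleftrightarrow> (\<exists>B. \<forall>z\<in>strip. \<bar>c z\<bar> \<le> B)"

definition BC1_strip ::
    "(real \<times> real \<Rightarrow> real) \<Rightarrow> (real \<times> real \<Rightarrow> real) \<Rightarrow> (real \<times> real \<Rightarrow> real) \<Rightarrow> bool"
  where "BC1_strip c cx ct \<longleftrightarrow> C1_strip c cx ct \<and>
    bounded_strip c \<and> bounded_strip cx \<and> bounded_strip ct"

lemma C1_stripD:
  assumes "C1_strip c cx ct"
  shows "continuous_on strip c" "continuous_on strip cx" "continuous_on strip ct"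
    "has_dx c cx" "has_dt c ct"
  using assms by (auto simp: C1_strip_def)

lemma has_dxD:
  "has_dx c c' \<Longrightarrow> x \<in> {0..1} \<Longrightarrow>
    ((\<lambda>\<xi>. c (\<xi>, t)) has_real_derivative c' (x, t)) (at x within {0..1})"
  by (auto simp: has_dx_def)

lemma has_dtD:
  "has_dt c c' \<Longrightarrow> x \<in> {0..1} \<Longrightarrow> ((\<lambda>s. c (x, s)) has_real_derivative c' (x, t)) (at t)"
  by (auto simp: has_dt_def)

lemma in_strip [simp]: "(x, t) \<in> strip \<longleftrightarrow> x \<in> {0..1}"
  by (auto simp: strip_def)

lemma BC1_imp_BC1_strip:
  assumes "c \<in> BC1"
  shows "BC1_strip c (dx strip c) (dt strip c)"
proof -
  have C: "c \<in> C1_on strip" "bounded (c ` strip)" "bounded (dx strip c ` strip)"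
    "bounded (dt strip c ` strip)"
    using assms by (auto simp: BC1_def)
  have b: "bounded_strip g" if "bounded (g ` strip)" for g
    using that by (auto simp: bounded_strip_def bounded_iff)
  have d: "(\<lambda>\<xi>. c (\<xi>, t)) differentiable (at x within {0..1})"
      "(\<lambda>s. c (x, s)) differentiable (at t)" if "x \<in> {0..1}" for x t
  proof -
    have "{\<xi>. (\<xi>, t) \<in> strip} = {0..1}" "{s. (x, s) \<in> strip} = UNIV" using that by auto
    moreover have "(x, t) \<in> strip" using that by simp
    ultimately show "(\<lambda>\<xi>. c (\<xi>, t)) differentiable (at x within {0..1})"
      "(\<lambda>s. c (x, s)) differentiable (at t)"
      using C(1) unfolding C1_on_def by fastforce+
  qed
  have dx: "has_dx c (dx strip c)"
    unfolding has_dx_def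
  proof (intro ballI allI)
    fix x t :: real assume x: "x \<in> {0..1}"
    have "{\<xi>. (\<xi>, t) \<in> strip} = {0..1}" by auto
    thus "((\<lambda>\<xi>. c (\<xi>, t)) has_real_derivative dx strip c (x, t)) (at x within {0..1})"
      using d(1)[OF x, of t]
      by (simp add: dx_def vector_derivative_works has_real_derivative_iff_has_vector_derivative)
  qed
  have dt: "has_dt c (dt strip c)"
    unfolding has_dt_def
  proof (intro ballI allI)
    fix x t :: real assume x: "x \<in> {0..1}"
    hence "{s. (x, s) \<in> strip} = UNIV" by auto
    thus "((\<lambda>s. c (x, s)) has_real_derivative dt strip c (x, t)) (at t)"
      using d(2)[OF x, of t]
      by (simp add: dt_def vector_derivative_works has_real_derivative_iff_has_vector_derivative)
  qed
  show ?thesis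
    using C b dx dt by (auto simp: BC1_strip_def C1_strip_def C1_on_def)
qed

lemma bounded_stripI: "(\<And>z. z \<in> strip \<Longrightarrow> \<bar>c z\<bar> \<le> B) \<Longrightarrow> bounded_strip c"
  unfolding bounded_strip_def by blast

lemma bounded_stripE:
  assumes "bounded_strip c"
  obtains B where "B > 0" "\<And>z. z \<in> strip \<Longrightarrow> \<bar>c z\<bar> \<le> B"
proof -
  obtain B where "\<forall>z\<in>strip. \<bar>c z\<bar> \<le> B" using assms by (auto simp: bounded_strip_def)
  hence "\<And>z. z \<in> strip \<Longrightarrow> \<bar>c z\<bar> \<le> max B 1" by fastforce
  thus ?thesis using that[of "max B 1"] by (metis max.strict_coboundedI2 zero_less_one)
qed

lemma bounded_strip_mult:
  assumes "bounded_strip c" "bounded_strip d"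
  shows "bounded_strip (\<lambda>z. c z * d z)"
proof -
  obtain B where B: "B > 0" "\<And>z. z \<in> strip \<Longrightarrow> \<bar>c z\<bar> \<le> B" using bounded_stripE[OF assms(1)] by blast
  obtain D where D: "D > 0" "\<And>z. z \<in> strip \<Longrightarrow> \<bar>d z\<bar> \<le> D" using bounded_stripE[OF assms(2)] by blast
  have "\<bar>c z * d z\<bar> \<le> B * D" if "z \<in> strip" for z
    unfolding abs_mult using B D that by (intro mult_mono) auto
  thus ?thesis by (rule bounded_stripI)
qed

lemma bounded_strip_add:
  assumes "bounded_strip c" "bounded_strip d"
  shows "bounded_strip (\<lambda>z. c z + d z)"
proof -
  obtain B where B: "B > 0" "\<And>z. z \<in> strip \<Longrightarrow> \<bar>c z\<bar> \<le> B" using bounded_stripE[OF assms(1)] by blast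
  obtain D where D: "D > 0" "\<And>z. z \<in> strip \<Longrightarrow> \<bar>d z\<bar> \<le> D" using bounded_stripE[OF assms(2)] by blast
  have "\<bar>c z + d z\<bar> \<le> B + D" if "z \<in> strip" for z
    using B(2)[OF that] D(2)[OF that] by linarith
  thus ?thesis by (rule bounded_stripI)
qed

lemma bounded_strip_minus: "bounded_strip c \<Longrightarrow> bounded_strip (\<lambda>z. - c z)"
  by (simp add: bounded_strip_def)

lemma BC1_strip_mult:
  assumes "BC1_strip c cx ct" "BC1_strip d dx' dt'"
  shows "BC1_strip (\<lambda>z. c z * d z) (\<lambda>z. cx z * d z + c z * dx' z) (\<lambda>z. ct z * d z + c z * dt' z)"
  using assms
  by (auto simp: BC1_strip_def C1_strip_def has_dx_def has_dt_def
      intro!: continuous_intros bounded_strip_add bounded_strip_mult derivative_eq_intros)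

lemma BC1_strip_inverse:
  assumes c: "BC1_strip c cx ct" and lam: "\<mu> > 0" "\<And>z. z \<in> strip \<Longrightarrow> \<mu> \<le> \<bar>c z\<bar>"
  shows "BC1_strip (\<lambda>z. 1 / c z) (\<lambda>z. - cx z * ((1 / c z) * (1 / c z))) (\<lambda>z. - ct z * ((1 / c z) * (1 / c z)))"
proof -
  have nz: "c z \<noteq> 0" if "z \<in> strip" for z using lam(1) lam(2)[OF that] by auto
  have b: "bounded_strip (\<lambda>z. 1 / c z)"
    unfolding bounded_strip_def
  proof (intro exI ballI)
    fix z assume z: "z \<in> strip"
    show "\<bar>1 / c z\<bar> \<le> 1 / \<mu>"
      using lam(1) lam(2)[OF z] by (simp add: frac_le)
  qed
  have dx: "has_dx (\<lambda>z. 1 / c z) (\<lambda>z. - cx z * ((1 / c z) * (1 / c z)))"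
    unfolding has_dx_def
    using c nz by (auto simp: BC1_strip_def C1_strip_def has_dx_def divide_simps
       intro!: derivative_eq_intros)
  have dt: "has_dt (\<lambda>z. 1 / c z) (\<lambda>z. - ct z * ((1 / c z) * (1 / c z)))"
    unfolding has_dt_def
    using c nz by (auto simp: BC1_strip_def C1_strip_def has_dt_def divide_simps
       intro!: derivative_eq_intros)
  have cc: "continuous_on strip (\<lambda>z. 1 / c z)"
    using c nz by (auto simp: BC1_strip_def C1_strip_def intro!: continuous_intros)
  show ?thesis
    using c b dx dt cc unfolding BC1_strip_def C1_strip_def
    by (auto simp only: minus_mult_left[symmetric]
        intro!: continuous_on_minus continuous_on_mult bounded_strip_mult bounded_strip_minus)
qed

text \<open>Continuity of one partial derivative turns the pair of partial derivatives into a total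
  one. Working within \<open>strip\<close> keeps this valid at \<open>x = 0\<close> and
  \<open>x = 1\<close>, where characteristics start and end.\<close>

lemma C1_strip_has_derivative:
  assumes "C1_strip c cx ct" and x: "x \<in> {0..1}"
  shows "(c has_derivative (\<lambda>(h, k). cx (x, t) * h + ct (x, t) * k)) (at (x, t) within strip)"
proof -
  note c = C1_stripD[OF assms(1)]
  have "((\<lambda>(x, y). c (x, y)) has_derivative
      (\<lambda>(tx, ty). (\<lambda>h. cx (x, t) * h) tx + blinfun_mult_right (ct (x, t)) ty)) (at (x, t) within {0..1} \<times> UNIV)"
  proof (rule has_derivative_partialsI)
    show "((\<lambda>x. c (x, t)) has_derivative (\<lambda>h. cx (x, t) * h)) (at x within {0..1})"
      using has_dxD[OF c(4) x] by (simp add: has_field_derivative_def)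
    show "((\<lambda>y. c (x, y)) has_derivative blinfun_apply (blinfun_mult_right (ct (x, y)))) (at y within UNIV)"
      if "x \<in> {0..1}" for x y
      using has_dtD[OF c(5) that, of y] by (simp add: has_field_derivative_def)
    have "continuous (at (x, t) within strip) ct"
      using c(3) x by (simp add: continuous_on_eq_continuous_within)
    hence "continuous (at (x, t) within strip) (\<lambda>z. blinfun_mult_right (ct z))"
      by (intro bounded_linear.continuous[OF bounded_linear_blinfun_mult_right])
    thus "continuous (at (x, t) within {0..1} \<times> UNIV) (\<lambda>(x, y). blinfun_mult_right (ct (x, y)))"
      by (simp add: strip_def case_prod_unfold)
  qed auto
  thus ?thesis by (simp add: strip_def case_prod_unfold)
qed

text \<open>For a characteristic, \<open>w' = 1 / a\<close>, and the derivative becomes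
  \<open>(ct + a * cx) / a\<close>: the transport operator divided by the speed.\<close>

lemma C1_strip_chain:
  assumes c: "C1_strip c cx ct" and x: "x \<in> {0..1}"
    and w: "(w has_real_derivative w') (at x within {0..1})"
  shows "((\<lambda>\<xi>. c (\<xi>, w \<xi>)) has_real_derivative cx (x, w x) + ct (x, w x) * w') (at x within {0..1})"
proof -
  have w2: "((\<lambda>\<xi>. (\<xi>, w \<xi>)) has_derivative (\<lambda>h. (h, w' * h))) (at x within {0..1})"
    using w by (auto intro!: derivative_eq_intros simp: has_field_derivative_def)
  have "(c has_derivative (\<lambda>(h, k). cx (x, w x) * h + ct (x, w x) * k))
      (at (x, w x) within (\<lambda>\<xi>. (\<xi>, w \<xi>)) ` {0..1})"
    by (rule has_derivative_subset[OF C1_strip_has_derivative[OF c x]]) auto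
  from has_derivative_in_compose[OF w2 this]
  show ?thesis
    by (simp add: has_field_derivative_def case_prod_unfold)
      (erule has_derivative_eq_rhs, simp add: algebra_simps fun_eq_iff)
qed

lemma continuous_on_strip_curve:
  assumes "continuous_on strip c" "continuous_on S f" "continuous_on S g" "f ` S \<subseteq> {0..1}"
  shows "continuous_on S (\<lambda>y. c (f y, g y))"
  by (rule continuous_on_compose2[OF assms(1)]) (use assms in \<open>auto intro!: continuous_intros simp: strip_def\<close>)

text \<open>The square of \<open>\<delta>\<close> is differentiable where the absolute value may not
  be; multiplied by \<open>exp (- 2 * L * \<xi>)\<close> it decreases, and multiplied by
  \<open>exp (2 * L * \<xi>)\<close> it increases. Both signs are required, since \<open>y\<close>
  may lie on either side of \<open>x\<close>.\<close>

lemma gronwall_abs: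
  fixes \<delta> \<delta>' :: "real \<Rightarrow> real"
  assumes d: "\<And>\<xi>. \<xi> \<in> {0..1} \<Longrightarrow> (\<delta> has_real_derivative \<delta>' \<xi>) (at \<xi> within {0..1})"
    and b: "\<And>\<xi>. \<xi> \<in> {0..1} \<Longrightarrow> \<bar>\<delta>' \<xi>\<bar> \<le> L * \<bar>\<delta> \<xi>\<bar>"
    and L: "L \<ge> 0" and xy: "x \<in> {0..1}" "y \<in> {0..1}"
  shows "\<bar>\<delta> y\<bar> \<le> exp L * \<bar>\<delta> x\<bar>"
proof -
  have cont: "continuous_on {0..1} \<delta>"
    using d by (meson DERIV_continuous_on)
  have dat: "(\<delta> has_real_derivative \<delta>' \<xi>) (at \<xi>)" if "0 < \<xi>" "\<xi> < 1" for \<xi>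
    using d[of \<xi>] that at_within_Icc_at[of 0 \<xi> 1] by simp
  have bd: "\<bar>2 * \<delta> \<xi> * \<delta>' \<xi>\<bar> \<le> 2 * L * (\<delta> \<xi>)\<^sup>2" if "\<xi> \<in> {0..1}" for \<xi>
  proof -
    have "\<bar>2 * \<delta> \<xi> * \<delta>' \<xi>\<bar> = 2 * \<bar>\<delta> \<xi>\<bar> * \<bar>\<delta>' \<xi>\<bar>" by (simp add: abs_mult)
    also have "\<dots> \<le> 2 * \<bar>\<delta> \<xi>\<bar> * (L * \<bar>\<delta> \<xi>\<bar>)" by (intro mult_left_mono b that) auto
    also have "\<dots> = 2 * L * \<bar>\<delta> \<xi>\<bar>\<^sup>2" by (simp only: power2_eq_square mult_ac)
    finally show ?thesis by simp
  qed
  have "(\<delta> y)\<^sup>2 \<le> exp (2 * L * \<bar>y - x\<bar>) * (\<delta> x)\<^sup>2"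
  proof (cases "x \<le> y")
    case True
    have "(\<delta> y)\<^sup>2 * exp (- 2 * L * y) \<le> (\<delta> x)\<^sup>2 * exp (- 2 * L * x)"
    proof (rule DERIV_nonpos_imp_decreasing_open[OF True])
      fix \<xi> assume \<xi>: "x < \<xi>" "\<xi> < y"
      hence \<xi>01: "0 < \<xi>" "\<xi> < 1" using xy by auto
      have "((\<lambda>\<xi>. (\<delta> \<xi>)\<^sup>2 * exp (- 2 * L * \<xi>)) has_real_derivative
          (2 * \<delta> \<xi> * \<delta>' \<xi> - 2 * L * (\<delta> \<xi>)\<^sup>2) * exp (- 2 * L * \<xi>)) (at \<xi>)"
        by (rule derivative_eq_intros dat[OF \<xi>01] refl)+ (simp add: algebra_simps)
      moreover have "(2 * \<delta> \<xi> * \<delta>' \<xi> - 2 * L * (\<delta> \<xi>)\<^sup>2) * exp (- 2 * L * \<xi>) \<le> 0"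
        using bd[of \<xi>] \<xi>01 by (intro mult_nonpos_nonneg) auto
      ultimately show "\<exists>y. ((\<lambda>\<xi>. (\<delta> \<xi>)\<^sup>2 * exp (- 2 * L * \<xi>)) has_real_derivative y) (at \<xi>) \<and> y \<le> 0"
        by blast
    qed (use xy in \<open>auto intro!: continuous_intros continuous_on_subset[OF cont]\<close>)
    thus ?thesis using True
      by (simp add: exp_minus field_simps exp_diff right_diff_distrib)
  next
    case False
    have "(\<delta> y)\<^sup>2 * exp (2 * L * y) \<le> (\<delta> x)\<^sup>2 * exp (2 * L * x)"
    proof (rule DERIV_nonneg_imp_increasing_open[of y x])
      fix \<xi> assume \<xi>: "y < \<xi>" "\<xi> < x"
      hence \<xi>01: "0 < \<xi>" "\<xi> < 1" using xy by auto
      have "((\<lambda>\<xi>. (\<delta> \<xi>)\<^sup>2 * exp (2 * L * \<xi>)) has_real_derivative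
          (2 * \<delta> \<xi> * \<delta>' \<xi> + 2 * L * (\<delta> \<xi>)\<^sup>2) * exp (2 * L * \<xi>)) (at \<xi>)"
        by (rule derivative_eq_intros dat[OF \<xi>01] refl)+ (simp add: algebra_simps)
      moreover have "(2 * \<delta> \<xi> * \<delta>' \<xi> + 2 * L * (\<delta> \<xi>)\<^sup>2) * exp (2 * L * \<xi>) \<ge> 0"
        using bd[of \<xi>] \<xi>01 by (intro mult_nonneg_nonneg) (auto simp: abs_if split: if_splits)
      ultimately show "\<exists>y. ((\<lambda>\<xi>. (\<delta> \<xi>)\<^sup>2 * exp (2 * L * \<xi>)) has_real_derivative y) (at \<xi>) \<and> 0 \<le> y"
        by blast
    qed (use xy False in \<open>auto intro!: continuous_intros continuous_on_subset[OF cont]\<close>)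
    thus ?thesis using False
      by (simp add: exp_minus field_simps exp_diff right_diff_distrib)
  qed
  also have "\<dots> \<le> exp (2 * L * 1) * (\<delta> x)\<^sup>2"
    using xy L by (intro mult_right_mono) (auto intro!: mult_left_le)
  also have "\<dots> = (exp L * \<bar>\<delta> x\<bar>)\<^sup>2"
    by (simp add: power_mult_distrib exp_double)
  finally show ?thesis
    by (simp add: abs_le_square_iff [symmetric] abs_mult)
qed

section \<open>Partial primitives\<close>

text \<open>The base point is always 0. An integral between two points is a difference of two values
  of \<open>prim\<close>, which takes care of orientation when a characteristic is followed towards
  \<open>x = 0\<close> or towards \<open>x = 1\<close>.\<close>

definition prim :: "(real \<times> real \<Rightarrow> real) \<Rightarrow> real \<times> real \<Rightarrow> real"
  where "prim k = (\<lambda>(\<xi>, s). integral {0..\<xi>} (\<lambda>\<eta>. k (\<eta>, s)))"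

lemma cont_slice: "continuous_on strip k \<Longrightarrow> continuous_on {0..1} (\<lambda>\<eta>. k (\<eta>, s))"
  by (rule continuous_on_strip_curve) auto

lemma cont_slice_t: "continuous_on strip k \<Longrightarrow> x \<in> {0..1} \<Longrightarrow> continuous_on S (\<lambda>s. k (x, s))"
  by (rule continuous_on_strip_curve) auto

lemma has_dx_prim: "continuous_on strip k \<Longrightarrow> has_dx (prim k) k"
  unfolding has_dx_def prim_def
  using integral_has_real_derivative[OF cont_slice] by auto

lemma has_dt_prim:
  assumes "continuous_on strip k" "continuous_on strip k'" "has_dt k k'"
  shows "has_dt (prim k) (prim k')"
  unfolding has_dt_def
proof (intro ballI allI)
  fix x t :: real assume x: "x \<in> {0..1}"
  have "((\<lambda>s. integral (cbox 0 x) (\<lambda>\<eta>. k (\<eta>, s))) has_field_derivative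
      integral (cbox 0 x) (\<lambda>\<eta>. k' (\<eta>, t))) (at t within UNIV)"
  proof (rule leibniz_rule_field_derivative)
    show "((\<lambda>s. k (\<eta>, s)) has_real_derivative k' (\<eta>, s)) (at s within UNIV)"
      if "\<eta> \<in> cbox 0 x" for s \<eta>
      using has_dtD[OF assms(3), of \<eta> s] that x by auto
    show "(\<lambda>\<eta>. k (\<eta>, s)) integrable_on cbox 0 x" for s
      using continuous_on_subset[OF cont_slice[OF assms(1)], of "{0..x}" s] x
      by (auto intro: integrable_continuous_real)
    show "continuous_on (UNIV \<times> cbox 0 x) (\<lambda>(s, \<eta>). k' (\<eta>, s))"
      unfolding case_prod_unfold
      by (rule continuous_on_strip_curve[OF assms(2)]) (use x in \<open>auto intro!: continuous_intros\<close>)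
  qed auto
  thus "((\<lambda>s. prim k (x, s)) has_real_derivative prim k' (x, t)) (at t)"
    by (simp add: prim_def)
qed

text \<open>The substitution of \<open>\<xi> * r\<close> for the integration variable moves the
  dependence on the upper limit into the integrand, so that continuity of an integral over a fixed
  interval with parameters applies.\<close>

lemma continuous_prim:
  assumes k: "continuous_on strip k"
  shows "continuous_on strip (prim k)"
proof -
  have eq: "prim k (\<xi>, s) = integral (cbox 0 1) (\<lambda>r. \<xi> * k (\<xi> * r, s))" if "\<xi> \<in> {0..1}" for \<xi> s
  proof -
    have "((\<lambda>r. \<xi> *\<^sub>R k (\<xi> * r, s)) has_integral (integral {\<xi> * 0..\<xi> * 1} (\<lambda>\<eta>. k (\<eta>, s)))) {0..1}"
      by (rule has_integral_substitution[where c = 0 and d = 1])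
        (use that in \<open>auto intro!: cont_slice[OF k] derivative_eq_intros mult_le_one\<close>)
    thus ?thesis by (simp add: prim_def integral_unique[symmetric] del: integral_mult_right)
  qed
  have "continuous_on strip (\<lambda>z. integral (cbox 0 1) (\<lambda>r. fst z * k (fst z * r, snd z)))"
    by (rule integral_continuous_on_param)
      (unfold case_prod_unfold, auto intro!: continuous_intros continuous_on_strip_curve[OF k]
        simp: strip_def mult_le_one)
  thus ?thesis
    by (rule continuous_on_eq) (auto simp: eq strip_def)
qed

lemma prim_diff_bound:
  assumes k: "continuous_on strip k" and g: "continuous_on {0..1} g"
    and le: "\<And>\<eta>. \<eta> \<in> {0..1} \<Longrightarrow> \<bar>k (\<eta>, s)\<bar> \<le> g \<eta>"
    and xy: "x \<in> {0..1}" "y \<in> {0..1}"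
  shows "\<bar>prim k (x, s) - prim k (y, s)\<bar> \<le> integral {0..1} g"
proof -
  have *: "\<bar>prim k (x, s) - prim k (y, s)\<bar> \<le> integral {0..1} g"
    if xy: "0 \<le> y" "y \<le> x" "x \<le> 1" for x y
  proof -
    have int: "(\<lambda>\<eta>. k (\<eta>, s)) integrable_on {u..v}" if "0 \<le> u" "v \<le> 1" for u v
      by (rule integrable_continuous_real continuous_on_subset[OF cont_slice[OF k]])+ (use that in auto)
    have g_int: "g integrable_on {u..v}" if "0 \<le> u" "v \<le> 1" for u v
      by (rule integrable_continuous_real continuous_on_subset[OF g])+ (use that in auto)
    have "prim k (x, s) - prim k (y, s) = integral {y..x} (\<lambda>\<eta>. k (\<eta>, s))"
      using Henstock_Kurzweil_Integration.integral_combine[OF xy(1,2) int] xy by (auto simp: prim_def)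
    also have "\<bar>\<dots>\<bar> \<le> integral {y..x} g"
      unfolding real_norm_def[symmetric]
      by (rule integral_norm_bound_integral[OF int g_int]) (use le xy in auto)
    also have "\<dots> \<le> integral {0..1} g"
      by (rule integral_subset_le) (use xy g_int le in \<open>auto intro: order_trans[OF abs_ge_zero le]\<close>)
    finally show ?thesis .
  qed
  show ?thesis
    using *[of y x] *[of x y] xy by (cases "y \<le> x") (auto simp: abs_minus_commute)
qed

lemma prim_diff_bound_const:
  assumes k: "continuous_on strip k"
    and le: "\<And>\<eta>. \<eta> \<in> {0..1} \<Longrightarrow> \<bar>k (\<eta>, s)\<bar> \<le> B"
    and xy: "x \<in> {0..1}" "y \<in> {0..1}"
  shows "\<bar>prim k (x, s) - prim k (y, s)\<bar> \<le> B"
  using prim_diff_bound[OF k continuous_on_const le xy] by auto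

lemma has_dx_zero_const:
  assumes "\<And>\<xi>. \<xi> \<in> {0..1} \<Longrightarrow> (g has_real_derivative 0) (at \<xi> within {0..1})"
    and "x \<in> {0..1}" "y \<in> {0..1}"
  shows "g x = g y"
  using has_field_derivative_zero_constant[of "{0..1}" g] assms by force

lemma prim_diff_eq:
  assumes k: "continuous_on strip k"
    and g: "\<And>\<xi>. \<xi> \<in> {0..1} \<Longrightarrow> (g has_real_derivative k (\<xi>, s)) (at \<xi> within {0..1})"
    and xy: "x \<in> {0..1}" "y \<in> {0..1}"
  shows "prim k (x, s) - prim k (y, s) = g x - g y"
proof -
  have "prim k (x, s) - g x = prim k (y, s) - g y"
    by (rule has_dx_zero_const[OF _ xy])
      (auto intro!: derivative_eq_intros g has_dxD[OF has_dx_prim[OF k]])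
  thus ?thesis by simp
qed

section \<open>Characteristics\<close>

text \<open>
  The Picard map is a contraction for the sup norm with weight \<open>exp (- 2 L \<xi>)\<close>. Starting points other
  than \<open>0\<close> are reached afterwards by the intermediate value theorem.
\<close>
lemma picard_from_0:
  fixes f :: "real \<times> real \<Rightarrow> real"
  assumes cont: "continuous_on strip f"
    and Lip: "\<And>\<xi> s s'. \<xi> \<in> {0..1} \<Longrightarrow> \<bar>f (\<xi>, s) - f (\<xi>, s')\<bar> \<le> L * \<bar>s - s'\<bar>"
    and L: "L > 0" and B: "\<And>z. z \<in> strip \<Longrightarrow> \<bar>f z\<bar> \<le> B"
  shows "\<exists>w. w 0 = t \<and> (\<forall>\<xi>\<in>{0..1}. (w has_real_derivative f (\<xi>, w \<xi>)) (at \<xi> within {0..1}))"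
proof -
  \<comment> \<open>The space of bounded continuous functions used for the fixed point lives on the
    whole line; the clamp \<open>c\<close> extends functions on [0,1] constantly to it.\<close>
  define c where "c = (\<lambda>\<xi>::real. max 0 (min 1 \<xi>))"
  define \<kappa> where "\<kappa> = 2 * L"
  have \<kappa>: "\<kappa> > 0" using L by (simp add: \<kappa>_def)
  have c01: "c \<xi> \<in> {0..1}" for \<xi> by (auto simp: c_def)
  have ccont: "continuous_on UNIV c" unfolding c_def by (intro continuous_intros)
  \<comment> \<open>The unknown is \<open>g = exp (- \<kappa> * \<xi>) * (w - t)\<close>, so that
    the plain sup norm of \<open>g\<close> is the weighted norm of \<open>w - t\<close>. With
    \<open>\<kappa> = 2 * L\<close> the weight integrates to a factor
    \<open>L / \<kappa> = 1/2\<close>.\<close>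
  define F where "F = (\<lambda>(g::real \<Rightarrow> real) \<eta>. f (\<eta>, t + exp (\<kappa> * \<eta>) * g \<eta>))"
  define P where "P = (\<lambda>g \<xi>. exp (- \<kappa> * c \<xi>) * integral {0..c \<xi>} (F g))"
  have Fc: "continuous_on S (F g)" if "continuous_on UNIV g" "S \<subseteq> {0..1}" for g S
    unfolding F_def
    by (rule continuous_on_strip_curve[OF cont])
      (use that in \<open>auto intro!: continuous_intros intro: continuous_on_subset\<close>)
  have Fi: "F g integrable_on {0..c \<xi>}" if "continuous_on UNIV g" for g \<xi>
    using Fc[OF that, of "{0..c \<xi>}"] c01[of \<xi>] by (auto intro: integrable_continuous_real)
  have e1: "exp (- \<kappa> * c \<xi>) \<le> 1" for \<xi> using \<kappa> c01[of \<xi>] by simp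
  have Pb: "P g \<in> bcontfun" if g: "continuous_on UNIV g" for g
  proof -
    have "continuous_on {0..1} (\<lambda>y. integral {0..y} (F g))"
      by (rule indefinite_integral_continuous_1) (use Fc[OF g] in \<open>auto intro: integrable_continuous_real\<close>)
    hence "continuous_on UNIV (\<lambda>\<xi>. integral {0..c \<xi>} (F g))"
      by (rule continuous_on_compose2[OF _ ccont]) (use c01 in auto)
    hence "continuous_on UNIV (P g)"
      unfolding P_def by (intro continuous_intros ccont)
    moreover have "\<bar>P g \<xi>\<bar> \<le> 1 * (B * 1)" for \<xi>
    proof -
      have B0: "B \<ge> 0" using B[of "(0, 0)"] by auto
      have "\<bar>integral {0..c \<xi>} (F g)\<bar> \<le> integral {0..c \<xi>} (\<lambda>_. B)"
        using integral_norm_bound_integral[OF Fi[OF g, of \<xi>], of "\<lambda>_. B"] B c01[of \<xi>] by (auto simp: F_def)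
      also have "\<dots> \<le> B * 1" using c01[of \<xi>] B0 by (auto intro: mult_left_le mult_left_le_one_le simp: mult_ac)
      finally show ?thesis
        unfolding P_def abs_mult using e1[of \<xi>] by (intro mult_mono) auto
    qed
    hence "bounded (range (P g))" by (auto simp: bounded_iff)
    ultimately show ?thesis by (simp add: bcontfun_def)
  qed
  define T where "T = (\<lambda>g::real \<Rightarrow>\<^sub>C real. Bcontfun (P (apply_bcontfun g)))"
  have Tap: "apply_bcontfun (T g) = P (apply_bcontfun g)" for g
    unfolding T_def by (rule Bcontfun_inverse) (intro Pb, auto)
  have "dist (T g) (T h) \<le> 1/2 * dist g h" for g h
  proof (rule dist_bound)
    fix \<xi>
    let ?D = "dist g h"
    have D: "\<bar>g \<eta> - h \<eta>\<bar> \<le> ?D" for \<eta> using dist_bounded[of g \<eta> h] by (simp add: dist_real_def)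
    have hi: "((\<lambda>\<eta>. L * ?D * exp (\<kappa> * \<eta>)) has_integral
        L * ?D * exp (\<kappa> * c \<xi>) / \<kappa> - L * ?D * exp (\<kappa> * 0) / \<kappa>) {0..c \<xi>}"
      by (rule fundamental_theorem_of_calculus)
        (use c01[of \<xi>] \<kappa> in \<open>auto intro!: derivative_eq_intros
          simp: has_real_derivative_iff_has_vector_derivative[symmetric]\<close>)
    have "\<bar>integral {0..c \<xi>} (F g) - integral {0..c \<xi>} (F h)\<bar> = \<bar>integral {0..c \<xi>} (\<lambda>\<eta>. F g \<eta> - F h \<eta>)\<bar>"
      by (subst Henstock_Kurzweil_Integration.integral_diff) (auto intro!: Fi)
    also have "\<dots> \<le> integral {0..c \<xi>} (\<lambda>\<eta>. L * ?D * exp (\<kappa> * \<eta>))"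
    proof (rule integral_norm_bound_integral[of "\<lambda>\<eta>. F g \<eta> - F h \<eta>", unfolded real_norm_def])
      show "(\<lambda>\<eta>. F g \<eta> - F h \<eta>) integrable_on {0..c \<xi>}"
        by (intro Henstock_Kurzweil_Integration.integrable_diff Fi) auto
      show "(\<lambda>\<eta>. L * ?D * exp (\<kappa> * \<eta>)) integrable_on {0..c \<xi>}" using hi by blast
      fix \<eta> assume "\<eta> \<in> {0..c \<xi>}"
      hence \<eta>: "\<eta> \<in> {0..1}" using c01[of \<xi>] by auto
      have "\<bar>F g \<eta> - F h \<eta>\<bar> \<le> L * (exp (\<kappa> * \<eta>) * \<bar>g \<eta> - h \<eta>\<bar>)"
        using Lip[OF \<eta>, of "t + exp (\<kappa> * \<eta>) * g \<eta>" "t + exp (\<kappa> * \<eta>) * h \<eta>"]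
        by (simp add: F_def abs_mult flip: right_diff_distrib)
      also have "\<dots> \<le> L * (exp (\<kappa> * \<eta>) * ?D)"
        using L D by (intro mult_left_mono) auto
      finally show "\<bar>F g \<eta> - F h \<eta>\<bar> \<le> L * ?D * exp (\<kappa> * \<eta>)" by (simp add: mult_ac)
    qed
    also have "\<dots> \<le> L * ?D * exp (\<kappa> * c \<xi>) / \<kappa>"
      unfolding integral_unique[OF hi] using L \<kappa> by simp
    also have "\<dots> = ?D / 2 * exp (\<kappa> * c \<xi>)" using L by (simp add: \<kappa>_def)
    finally have *: "\<bar>integral {0..c \<xi>} (F g) - integral {0..c \<xi>} (F h)\<bar> \<le> ?D / 2 * exp (\<kappa> * c \<xi>)" .
    have "\<bar>P g \<xi> - P h \<xi>\<bar> = exp (- \<kappa> * c \<xi>) * \<bar>integral {0..c \<xi>} (F g) - integral {0..c \<xi>} (F h)\<bar>"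
      by (simp add: P_def abs_mult flip: right_diff_distrib)
    also have "\<dots> \<le> exp (- \<kappa> * c \<xi>) * (?D / 2 * exp (\<kappa> * c \<xi>))"
      by (intro mult_left_mono *) auto
    also have "\<dots> = ?D / 2" by (simp add: exp_minus field_simps)
    finally show "dist (T g \<xi>) (T h \<xi>) \<le> 1/2 * ?D" by (simp add: Tap dist_real_def)
  qed
  hence "\<exists>!g. T g = g"
    by (intro banach_fix_type[of "1/2"]) auto
  then obtain g where "T g = g" by blast
  hence g: "g \<xi> = P g \<xi>" for \<xi> using Tap[of g] by simp
  define w where "w = (\<lambda>\<xi>. t + exp (\<kappa> * \<xi>) * g \<xi>)"
  have Fw: "F g \<eta> = f (\<eta>, w \<eta>)" for \<eta> by (simp add: F_def w_def)
  have weq: "w \<xi> = t + integral {0..\<xi>} (F g)" if "\<xi> \<in> {0..1}" for \<xi>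
  proof -
    have "c \<xi> = \<xi>" using that by (auto simp: c_def)
    thus ?thesis using g[of \<xi>] by (simp add: w_def P_def exp_minus field_simps)
  qed
  have "w 0 = t" using weq[of 0] by simp
  moreover have "(w has_real_derivative f (\<xi>, w \<xi>)) (at \<xi> within {0..1})" if \<xi>: "\<xi> \<in> {0..1}" for \<xi>
  proof -
    have "((\<lambda>\<xi>. t + integral {0..\<xi>} (F g)) has_real_derivative F g \<xi>) (at \<xi> within {0..1})"
      using integral_has_real_derivative[OF Fc \<xi>, of g] by (auto intro!: derivative_eq_intros)
    thus ?thesis unfolding Fw
      by (rule has_field_derivative_transform_within[OF _ zero_less_one \<xi>]) (simp add: weq flip: Fw)
  qed
  ultimately show ?thesis by blast
qed

text \<open>\<open>fx\<close> and \<open>ft\<close> are the partial derivatives of the slope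
  \<open>1 / a\<close>, not of \<open>a\<close>. The bound on \<open>1 / a\<close> limits how far a
  characteristic moves in time; the bound on \<open>ft\<close> limits how fast neighbouring ones
  separate. One constant for both keeps the later window sizes simple.\<close>

locale flow =
  fixes a fx ft :: "real \<times> real \<Rightarrow> real" and L :: real
  assumes C1f: "C1_strip (\<lambda>z. 1 / a z) fx ft"
    and L_pos: "L > 0"
    and f_le: "\<And>z. z \<in> strip \<Longrightarrow> \<bar>1 / a z\<bar> \<le> L"
    and ft_le: "\<And>z. z \<in> strip \<Longrightarrow> \<bar>ft z\<bar> \<le> L"
begin

lemma f_lipschitz:
  assumes "\<xi> \<in> {0..1}"
  shows "\<bar>1 / a (\<xi>, s) - 1 / a (\<xi>, s')\<bar> \<le> L * \<bar>s - s'\<bar>"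
  using field_differentiable_bound[of UNIV "\<lambda>s. 1 / a (\<xi>, s)" "\<lambda>s. ft (\<xi>, s)" L s s']
    has_dtD[OF C1_stripD(5)[OF C1f] assms] ft_le assms by auto

lemma is_characteristicD:
  assumes "is_characteristic a x t w"
  shows "w x = t" "\<xi> \<in> {0..1} \<Longrightarrow> (w has_real_derivative 1 / a (\<xi>, w \<xi>)) (at \<xi> within {0..1})"
  using assms by (auto simp: is_characteristic_def)

text \<open>The two curves solve the same equation and may be labelled at different points. Equality
  at one \<open>z\<close> gives uniqueness; different values at \<open>z\<close> give Lipschitz
  dependence on the data.\<close>

lemma characteristic_gronwall:
  assumes w: "is_characteristic a x t w" and v: "is_characteristic a x' t' v"
    and yz: "y \<in> {0..1}" "z \<in> {0..1}"
  shows "\<bar>w y - v y\<bar> \<le> exp L * \<bar>w z - v z\<bar>"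
  by (rule gronwall_abs[where \<delta>' = "\<lambda>\<xi>. 1 / a (\<xi>, w \<xi>) - 1 / a (\<xi>, v \<xi>)" and x = z])
    (use L_pos yz in \<open>auto intro!: f_lipschitz DERIV_diff is_characteristicD(2)[OF w] is_characteristicD(2)[OF v]\<close>)

lemma characteristic_space_lipschitz:
  assumes w: "is_characteristic a x t w" and yz: "y \<in> {0..1}" "z \<in> {0..1}"
  shows "\<bar>w y - w z\<bar> \<le> L * \<bar>y - z\<bar>"
  using field_differentiable_bound[of "{0..1}" w "\<lambda>\<xi>. 1 / a (\<xi>, w \<xi>)" L y z]
    is_characteristicD(2)[OF w] f_le yz by auto

lemma characteristic_exists:
  assumes x: "x \<in> {0..1}"
  shows "\<exists>w. is_characteristic a x t w"
proof -
  have "\<exists>w. is_characteristic a 0 t w" for t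
    unfolding is_characteristic_def
    by (rule picard_from_0[of "\<lambda>z. 1 / a z" L L])
      (use C1_stripD(1)[OF C1f] L_pos f_le f_lipschitz in auto)
  then obtain W where W: "\<And>t. is_characteristic a 0 t (W t)" by metis
  have W0: "W t 0 = t" for t using is_characteristicD(1)[OF W] .
  \<comment> \<open>A characteristic drifts by at most \<open>L\<close>, so the starting times
    \<open>t - L\<close> and \<open>t + L\<close> at 0 bracket the value \<open>t\<close> at
    \<open>x\<close> for the intermediate value theorem.\<close>
  have near: "\<bar>W t x - t\<bar> \<le> L" for t
  proof -
    have "\<bar>W t x - t\<bar> \<le> L * \<bar>x\<bar>"
      using characteristic_space_lipschitz[OF W, of x 0 t] x W0 by simp
    also have "\<dots> \<le> L" using x L_pos by (simp add: mult_left_le)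
    finally show ?thesis .
  qed
  have "(exp L)-lipschitz_on UNIV (\<lambda>t. W t x)"
    using characteristic_gronwall[OF W W, of x 0] x by (intro lipschitz_onI) (auto simp: dist_real_def W0)
  hence "continuous_on {t - L..t + L} (\<lambda>t. W t x)"
    using lipschitz_on_continuous_on continuous_on_subset by blast
  moreover have "W (t - L) x \<le> t" "t \<le> W (t + L) x" using near[of "t - L"] near[of "t + L"] by auto
  ultimately obtain s where "W s x = t"
    using IVT'[of "\<lambda>t. W t x" "t - L" t "t + L"] L_pos by auto
  thus ?thesis using W[of s] by (auto simp: is_characteristic_def)
qed

lemma is_characteristic_omega:
  assumes x: "x \<in> {0..1}"
  shows "is_characteristic a x t (\<lambda>\<xi>. omega a \<xi> x t)"
proof -
  obtain w where w: "is_characteristic a x t w" using characteristic_exists[OF x] by blast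
  have eq: "omega a \<xi> x t = w \<xi>" if \<xi>: "\<xi> \<in> {0..1}" for \<xi>
    unfolding omega_def
  proof (rule the_equality)
    fix s assume "\<exists>v. is_characteristic a x t v \<and> s = v \<xi>"
    then obtain v where v: "is_characteristic a x t v" "s = v \<xi>" by blast
    show "s = w \<xi>"
      using characteristic_gronwall[OF v(1) w \<xi> x] is_characteristicD(1)[OF v(1)]
        is_characteristicD(1)[OF w] v(2) by simp
  qed (use w in blast)
  have "((\<lambda>\<xi>. omega a \<xi> x t) has_real_derivative 1 / a (\<xi>, omega a \<xi> x t)) (at \<xi> within {0..1})"
    if \<xi>: "\<xi> \<in> {0..1}" for \<xi>
    using is_characteristicD(2)[OF w \<xi>] unfolding eq[OF \<xi>]
    by (rule has_field_derivative_transform_within[OF _ zero_less_one \<xi>]) (simp add: eq)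
  thus ?thesis
    using eq[OF x] is_characteristicD(1)[OF w] by (auto simp: is_characteristic_def)
qed

lemma omega_self: "x \<in> {0..1} \<Longrightarrow> omega a x x t = t"
  using is_characteristicD(1)[OF is_characteristic_omega] .

lemma omega_dist:
  assumes x: "x \<in> {0..1}" and \<xi>: "\<xi> \<in> {0..1}"
  shows "\<bar>omega a \<xi> x t - t\<bar> \<le> L"
proof -
  have "\<bar>omega a \<xi> x t - t\<bar> \<le> L * \<bar>\<xi> - x\<bar>"
    using characteristic_space_lipschitz[OF is_characteristic_omega[OF x] \<xi> x] by (simp add: omega_self[OF x])
  also have "\<dots> \<le> L * 1" using x \<xi> L_pos by (intro mult_left_mono) auto
  finally show ?thesis by simp
qed

lemma omega_lipschitz_t:
  assumes x: "x \<in> {0..1}" and \<xi>: "\<xi> \<in> {0..1}"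
  shows "\<bar>omega a \<xi> x s - omega a \<xi> x s'\<bar> \<le> exp L * \<bar>s - s'\<bar>"
  using characteristic_gronwall[OF is_characteristic_omega[OF x] is_characteristic_omega[OF x] \<xi> x]
  by (simp add: omega_self[OF x])

text \<open>Coordinates that straighten the characteristics: \<open>snd z\<close> labels a
  characteristic by its time at \<open>x\<close>, and varying \<open>fst z\<close> runs along it.
  Derivatives along the characteristic become partial derivatives in the first variable.\<close>

definition Psi :: "real \<Rightarrow> real \<times> real \<Rightarrow> real \<times> real"
  where "Psi x z = (fst z, omega a (fst z) x (snd z))"

lemma Psi_in_strip [simp]: "Psi x z \<in> strip \<longleftrightarrow> z \<in> strip"
  by (auto simp: Psi_def strip_def mem_Times_iff)

lemma Psi_self: "x \<in> {0..1} \<Longrightarrow> Psi x (x, s) = (x, s)"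
  by (simp add: Psi_def omega_self)

lemma continuous_omega:
  assumes x: "x \<in> {0..1}"
  shows "continuous_on strip (\<lambda>z. omega a (fst z) x (snd z))"
proof -
  have "(L + exp L)-lipschitz_on strip (\<lambda>z. omega a (fst z) x (snd z))"
  proof (rule lipschitz_onI)
    fix z z' :: "real \<times> real" assume z: "z \<in> strip" "z' \<in> strip"
    hence z01: "fst z \<in> {0..1}" "fst z' \<in> {0..1}" by (auto simp: strip_def)
    have "\<bar>omega a (fst z) x (snd z) - omega a (fst z') x (snd z)\<bar> \<le> L * \<bar>fst z - fst z'\<bar>"
      by (rule characteristic_space_lipschitz[OF is_characteristic_omega[OF x] z01])
    moreover have "\<bar>omega a (fst z') x (snd z) - omega a (fst z') x (snd z')\<bar> \<le> exp L * \<bar>snd z - snd z'\<bar>"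
      by (rule omega_lipschitz_t[OF x z01(2)])
    moreover have "L * \<bar>fst z - fst z'\<bar> \<le> L * dist z z'"
      using L_pos dist_fst_le[of z z'] by (intro mult_left_mono) (auto simp: dist_real_def)
    moreover have "exp L * \<bar>snd z - snd z'\<bar> \<le> exp L * dist z z'"
      using dist_snd_le[of z z'] by (intro mult_left_mono) (auto simp: dist_real_def)
    ultimately show "dist (omega a (fst z) x (snd z)) (omega a (fst z') x (snd z')) \<le> (L + exp L) * dist z z'"
      unfolding dist_real_def distrib_right by linarith
  qed (use L_pos in \<open>auto simp: add_nonneg_nonneg\<close>)
  thus ?thesis by (rule lipschitz_on_continuous_on)
qed

lemma continuous_Psi:
  assumes "x \<in> {0..1}" "continuous_on strip q"
  shows "continuous_on strip (\<lambda>z. q (Psi x z))"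
  unfolding Psi_def
  by (rule continuous_on_strip_curve[OF assms(2) _ continuous_omega[OF assms(1)]])
    (auto intro!: continuous_intros simp: strip_def)

text \<open>
  For \<open>q = b\<^sub>j\<^sub>j / a\<^sub>j\<close> this is the factor \<open>c\<^sub>j\<close>, and for \<open>q = \<partial>\<^sub>t (1 / a\<^sub>j)\<close> it is \<open>\<partial>\<^sub>t \<omega>\<^sub>j\<close>.
\<close>
definition wexp :: "real \<Rightarrow> (real \<times> real \<Rightarrow> real) \<Rightarrow> real \<times> real \<Rightarrow> real"
  where "wexp x q = (\<lambda>z. exp (prim (\<lambda>z. q (Psi x z)) z - prim (\<lambda>z. q (Psi x z)) (x, snd z)))"

lemma continuous_prim_at:
  assumes "continuous_on strip k" "x \<in> {0..1}"
  shows "continuous_on S (\<lambda>z. prim k (x, snd z))"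
  by (rule continuous_on_strip_curve[OF continuous_prim[OF assms(1)]])
    (use assms in \<open>auto intro!: continuous_intros\<close>)

lemma continuous_wexp:
  assumes "x \<in> {0..1}" "continuous_on strip q"
  shows "continuous_on strip (wexp x q)"
  unfolding wexp_def
  by (intro continuous_intros continuous_prim continuous_Psi assms continuous_prim_at)

lemma has_dx_wexp:
  assumes "x \<in> {0..1}" "continuous_on strip q"
  shows "has_dx (wexp x q) (\<lambda>z. q (Psi x z) * wexp x q z)"
  unfolding has_dx_def wexp_def
  by (auto intro!: derivative_eq_intros has_dxD[OF has_dx_prim] continuous_Psi assms)

lemma wexp_self: "wexp x q (x, s) = 1"
  by (simp add: wexp_def)

lemma wexp_bounds:
  assumes x: "x \<in> {0..1}" and q: "continuous_on strip q"
    and B: "\<And>z. z \<in> strip \<Longrightarrow> \<bar>q z\<bar> \<le> B" and z: "z \<in> strip"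
  shows "exp (- B) \<le> wexp x q z" "wexp x q z \<le> exp B" "\<bar>wexp x q z\<bar> \<le> exp B"
proof -
  obtain \<xi> s where zz: "z = (\<xi>, s)" "\<xi> \<in> {0..1}" using z by (auto simp: strip_def)
  have "\<bar>prim (\<lambda>z. q (Psi x z)) (\<xi>, s) - prim (\<lambda>z. q (Psi x z)) (x, s)\<bar> \<le> B"
    by (rule prim_diff_bound_const) (use x zz B in \<open>auto intro!: continuous_Psi q\<close>)
  thus "exp (- B) \<le> wexp x q z" "wexp x q z \<le> exp B" "\<bar>wexp x q z\<bar> \<le> exp B"
    by (auto simp: wexp_def zz)
qed

abbreviation stretch :: "real \<Rightarrow> real \<times> real \<Rightarrow> real"
  where "stretch x \<equiv> wexp x ft"

lemmas ft_cont = C1_stripD(3)[OF C1f]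

text \<open>\<open>stretch\<close> solves the equation linearised along the characteristic. The
  difference \<open>\<delta>\<close> of two neighbouring characteristics solves it up to a Taylor
  error, so \<open>\<delta>\<close> divided by \<open>stretch\<close> is nearly constant in the
  space variable. Its value at \<open>x\<close> is exactly \<open>h\<close>, which yields the
  difference quotient.\<close>

lemma has_dt_omega:
  assumes x: "x \<in> {0..1}" and \<xi>: "\<xi> \<in> {0..1}"
  shows "((\<lambda>s. omega a \<xi> x s) has_real_derivative stretch x (\<xi>, s)) (at s)"
proof -
  define C where "C = exp L"
  have C1: "C \<ge> 1" using L_pos by (simp add: C_def)
  let ?E = "\<lambda>\<eta>. stretch x (\<eta>, s)"
  let ?Y = "\<lambda>s \<eta>. omega a \<eta> x s"
  have E: "exp (- L) \<le> ?E \<eta>" "?E \<eta> \<le> C" if "\<eta> \<in> {0..1}" for \<eta>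
    using wexp_bounds[OF x ft_cont ft_le] that by (auto simp: C_def)
  have Ed: "(?E has_real_derivative ft (\<eta>, ?Y s \<eta>) * ?E \<eta>) (at \<eta> within {0..1})"
    if "\<eta> \<in> {0..1}" for \<eta>
    using has_dxD[OF has_dx_wexp[OF x ft_cont] that, of s] by (simp add: Psi_def)
  have Epos: "?E \<eta> > 0" for \<eta> by (simp add: wexp_def)
  have Yd: "(?Y s has_real_derivative 1 / a (\<eta>, ?Y s \<eta>)) (at \<eta> within {0..1})" if "\<eta> \<in> {0..1}" for \<eta> s
    using is_characteristicD(2)[OF is_characteristic_omega[OF x] that] .
  have "\<exists>d>0. \<forall>h. h \<noteq> 0 \<and> norm (h - 0) < d \<longrightarrow>
      norm ((?Y (s + h) \<xi> - ?Y s \<xi>) / h - ?E \<xi>) < r" if r: "r > 0" for r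
  proof -
    \<comment> \<open>The three factors \<open>C\<close> come from the Lipschitz bound on
      \<open>\<delta>\<close>, from dividing by \<open>?E\<close>, and from multiplying by
      \<open>?E\<close> again at the end; what remains is \<open>r / 2\<close>.\<close>
    define \<epsilon> where "\<epsilon> = r / (2 * C ^ 3)"
    have \<epsilon>: "\<epsilon> > 0" using r C1 by (simp add: \<epsilon>_def)
    \<comment> \<open>The characteristic through \<open>(x, s)\<close> stays within \<open>L\<close>
      of \<open>s\<close>, and for \<open>\<bar>h\<bar> \<le> 1\<close> its neighbour stays within
      \<open>C\<close> of it. Uniform continuity of \<open>ft\<close> is therefore needed on this
      compact set only.\<close>
    define K where "K = {0..1::real} \<times> {s - L - C..s + L + C}"
    have "uniformly_continuous_on K ft"
      by (rule compact_uniformly_continuous[OF continuous_on_subset[OF ft_cont]])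
        (auto simp: K_def strip_def intro: compact_Times)
    then obtain d where d: "d > 0" "\<And>z z'. z \<in> K \<Longrightarrow> z' \<in> K \<Longrightarrow> dist z' z < d \<Longrightarrow> dist (ft z') (ft z) < \<epsilon>"
      using \<epsilon> unfolding uniformly_continuous_on_def by meson
    define d' where "d' = min 1 (d / C)"
    have d': "d' > 0" using d C1 by (simp add: d'_def)
    have "norm ((?Y (s + h) \<xi> - ?Y s \<xi>) / h - ?E \<xi>) < r" if h: "h \<noteq> 0" "\<bar>h\<bar> < d'" for h
    proof -
      define \<delta> where "\<delta> = (\<lambda>\<eta>. ?Y (s + h) \<eta> - ?Y s \<eta>)"
      have Ch: "C * \<bar>h\<bar> < d" "C * \<bar>h\<bar> \<le> C"
        using h C1 by (auto simp: d'_def field_simps mult_left_le)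
      have \<delta>le: "\<bar>\<delta> \<eta>\<bar> \<le> C * \<bar>h\<bar>" if "\<eta> \<in> {0..1}" for \<eta>
        using omega_lipschitz_t[OF x that, of "s + h" s] by (simp add: \<delta>_def C_def)
      have err: "\<bar>1 / a (\<eta>, ?Y (s + h) \<eta>) - 1 / a (\<eta>, ?Y s \<eta>) - ft (\<eta>, ?Y s \<eta>) * \<delta> \<eta>\<bar> \<le> \<epsilon> * \<bar>\<delta> \<eta>\<bar>"
        if \<eta>: "\<eta> \<in> {0..1}" for \<eta>
      proof -
        \<comment> \<open>Subtracting the linear part leaves a function of \<open>y\<close> whose
          derivative is an increment of \<open>ft\<close>, hence at most \<open>\<epsilon>\<close>;
          the mean value inequality then gives the Taylor error.\<close>
        let ?g = "\<lambda>y. 1 / a (\<eta>, y) - ft (\<eta>, ?Y s \<eta>) * y"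
        let ?S = "closed_segment (?Y s \<eta>) (?Y (s + h) \<eta>)"
        have "norm (?g (?Y (s + h) \<eta>) - ?g (?Y s \<eta>)) \<le> \<epsilon> * norm (?Y (s + h) \<eta> - ?Y s \<eta>)"
        proof (rule field_differentiable_bound[where S = ?S and f' = "\<lambda>y. ft (\<eta>, y) - ft (\<eta>, ?Y s \<eta>)"])
          fix y assume y: "y \<in> ?S"
          have "((\<lambda>y. 1 / a (\<eta>, y)) has_real_derivative ft (\<eta>, y)) (at y within ?S)"
            using has_dtD[OF C1_stripD(5)[OF C1f] \<eta>] by (auto intro: has_field_derivative_at_within)
          thus "(?g has_real_derivative ft (\<eta>, y) - ft (\<eta>, ?Y s \<eta>)) (at y within ?S)"
            by (auto intro!: DERIV_cong[OF DERIV_diff[OF _ DERIV_cmult[OF DERIV_ident]]])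
          have yd: "\<bar>y - ?Y s \<eta>\<bar> \<le> \<bar>\<delta> \<eta>\<bar>"
            using y by (auto simp: closed_segment_eq_real_ivl \<delta>_def split: if_splits)
          have s1: "\<bar>?Y s \<eta> - s\<bar> \<le> L" by (rule omega_dist[OF x \<eta>])
          have "\<bar>y - s\<bar> \<le> L + C" using s1 yd \<delta>le[OF \<eta>] Ch(2) by linarith
          hence "(\<eta>, y) \<in> K" "(\<eta>, ?Y s \<eta>) \<in> K"
            using s1 C1 \<eta> unfolding K_def by (auto simp: abs_le_iff)
          moreover have "dist (\<eta>, y) (\<eta>, ?Y s \<eta>) < d"
            using yd \<delta>le[OF \<eta>] Ch by (simp add: dist_Pair_Pair dist_real_def)
          ultimately show "norm (ft (\<eta>, y) - ft (\<eta>, ?Y s \<eta>)) \<le> \<epsilon>"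
            using d(2) by (force simp: dist_real_def)
        qed auto
        thus ?thesis by (simp add: \<delta>_def algebra_simps)
      qed
      have "norm (\<delta> \<xi> / ?E \<xi> - \<delta> x / ?E x) \<le> (\<epsilon> * C\<^sup>2 * \<bar>h\<bar>) * norm (\<xi> - x)"
      proof (rule field_differentiable_bound[where S = "{0..1}" and f' = "\<lambda>\<eta>.
            (1 / a (\<eta>, ?Y (s + h) \<eta>) - 1 / a (\<eta>, ?Y s \<eta>) - ft (\<eta>, ?Y s \<eta>) * \<delta> \<eta>) / ?E \<eta>"])
        fix \<eta> :: real assume \<eta>: "\<eta> \<in> {0..1}"
        have nz: "?E \<eta> \<noteq> 0" using Epos[of \<eta>] by linarith
        have d1: "(\<delta> has_real_derivative (1 / a (\<eta>, ?Y (s + h) \<eta>) - 1 / a (\<eta>, ?Y s \<eta>))) (at \<eta> within {0..1})"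
          unfolding \<delta>_def by (intro DERIV_diff Yd \<eta>)
        show "((\<lambda>\<eta>. \<delta> \<eta> / ?E \<eta>) has_real_derivative
            (1 / a (\<eta>, ?Y (s + h) \<eta>) - 1 / a (\<eta>, ?Y s \<eta>) - ft (\<eta>, ?Y s \<eta>) * \<delta> \<eta>) / ?E \<eta>) (at \<eta> within {0..1})"
          by (rule DERIV_cong[OF DERIV_divide[OF d1 Ed[OF \<eta>] nz]])
            (use nz in \<open>simp add: field_simps\<close>)
        have invE: "1 / ?E \<eta> \<le> C"
          using E(1)[OF \<eta>] Epos[of \<eta>] by (simp add: C_def field_simps exp_minus)
        have "\<bar>(1 / a (\<eta>, ?Y (s + h) \<eta>) - 1 / a (\<eta>, ?Y s \<eta>) - ft (\<eta>, ?Y s \<eta>) * \<delta> \<eta>)\<bar> * (1 / ?E \<eta>)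
            \<le> (\<epsilon> * (C * \<bar>h\<bar>)) * C"
          using order_trans[OF err[OF \<eta>] mult_left_mono[OF \<delta>le[OF \<eta>], of \<epsilon>]] \<epsilon> invE C1 Epos[of \<eta>]
          by (intro mult_mono) auto
        thus "norm ((1 / a (\<eta>, ?Y (s + h) \<eta>) - 1 / a (\<eta>, ?Y s \<eta>) - ft (\<eta>, ?Y s \<eta>) * \<delta> \<eta>) / ?E \<eta>)
            \<le> \<epsilon> * C\<^sup>2 * \<bar>h\<bar>"
          using Epos[of \<eta>] by (simp add: abs_mult abs_divide power2_eq_square mult_ac)
      qed (use x \<xi> in auto)
      also have "\<dots> \<le> (\<epsilon> * C\<^sup>2 * \<bar>h\<bar>) * 1"
        using x \<xi> \<epsilon> by (intro mult_left_mono) auto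
      finally have "\<bar>\<delta> \<xi> / ?E \<xi> - h\<bar> \<le> \<epsilon> * C\<^sup>2 * \<bar>h\<bar>"
        by (simp add: wexp_self \<delta>_def omega_self[OF x])
      hence "?E \<xi> * \<bar>\<delta> \<xi> / ?E \<xi> - h\<bar> \<le> C * (\<epsilon> * C\<^sup>2 * \<bar>h\<bar>)"
        using E(2)[OF \<xi>] Epos[of \<xi>] C1 by (intro mult_mono) auto
      moreover have "?E \<xi> * \<bar>\<delta> \<xi> / ?E \<xi> - h\<bar> = \<bar>\<delta> \<xi> - h * ?E \<xi>\<bar>"
      proof -
        have "\<delta> \<xi> - h * ?E \<xi> = ?E \<xi> * (\<delta> \<xi> / ?E \<xi> - h)"
          using Epos[of \<xi>] by (simp add: field_simps)
        thus ?thesis using Epos[of \<xi>] by (simp add: abs_mult)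
      qed
      moreover have "\<bar>\<delta> \<xi> / h - ?E \<xi>\<bar> = \<bar>\<delta> \<xi> - h * ?E \<xi>\<bar> / \<bar>h\<bar>"
        using h by (subst abs_divide[symmetric]) (simp add: field_simps)
      ultimately have "\<bar>\<delta> \<xi> / h - ?E \<xi>\<bar> \<le> C * (\<epsilon> * C\<^sup>2)"
        using h by (simp add: field_simps)
      also have "\<dots> = r / 2" using C1 by (simp add: \<epsilon>_def power2_eq_square power3_eq_cube)
      also have "\<dots> < r" using r by simp
      finally show ?thesis by (simp add: \<delta>_def)
    qed
    thus ?thesis using d' by (intro exI[of _ d']) auto
  qed
  thus ?thesis unfolding DERIV_def by (intro LIM_I) auto
qed

lemma has_dt_Psi:
  assumes x: "x \<in> {0..1}" and q: "has_dt q qt"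
  shows "has_dt (\<lambda>z. q (Psi x z)) (\<lambda>z. qt (Psi x z) * stretch x z)"
  unfolding has_dt_def Psi_def
  using has_dtD[OF q] has_dt_omega[OF x] by (auto intro: DERIV_chain2)

lemma has_dx_Psi:
  assumes x: "x \<in> {0..1}" and q: "C1_strip q qx qt"
  shows "has_dx (\<lambda>z. q (Psi x z)) (\<lambda>z. qx (Psi x z) + qt (Psi x z) * (1 / a (Psi x z)))"
  unfolding has_dx_def Psi_def
  using C1_strip_chain[OF q _ is_characteristicD(2)[OF is_characteristic_omega[OF x]]] by auto

text \<open>The logarithmic \<open>t\<close>-derivative of \<open>wexp x q\<close>, when
  \<open>qt\<close> is the \<open>t\<close>-derivative of \<open>q\<close>. The factor
  \<open>stretch\<close> enters by the chain rule, because \<open>Psi x\<close> moves with the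
  label.\<close>

definition wexp_t :: "real \<Rightarrow> (real \<times> real \<Rightarrow> real) \<Rightarrow> real \<times> real \<Rightarrow> real"
  where "wexp_t x qt = (\<lambda>z. prim (\<lambda>z. qt (Psi x z) * stretch x z) z -
    prim (\<lambda>z. qt (Psi x z) * stretch x z) (x, snd z))"

lemma continuous_stretch: "x \<in> {0..1} \<Longrightarrow> continuous_on strip (stretch x)"
  by (rule continuous_wexp[OF _ ft_cont])

lemma continuous_wexp_t:
  assumes "x \<in> {0..1}" "continuous_on strip qt"
  shows "continuous_on strip (wexp_t x qt)"
  unfolding wexp_t_def
  by (intro continuous_intros continuous_prim continuous_Psi assms continuous_prim_at continuous_stretch)

lemma has_dt_wexp:
  assumes x: "x \<in> {0..1}" and q: "continuous_on strip q" "continuous_on strip qt" "has_dt q qt"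
  shows "has_dt (wexp x q) (\<lambda>z. wexp_t x qt z * wexp x q z)"
proof -
  have p: "has_dt (prim (\<lambda>z. q (Psi x z))) (prim (\<lambda>z. qt (Psi x z) * stretch x z))"
    by (intro has_dt_prim continuous_Psi has_dt_Psi continuous_intros continuous_stretch x q)
  show ?thesis
    unfolding has_dt_def wexp_def wexp_t_def
    using x by (auto intro!: DERIV_cong[OF DERIV_fun_exp[OF DERIV_diff[OF has_dtD[OF p] has_dtD[OF p]]]]
      simp: wexp_def)
qed

lemma wexp_t_bound:
  assumes x: "x \<in> {0..1}" and q: "continuous_on strip qt"
    and B: "\<And>z. z \<in> strip \<Longrightarrow> \<bar>qt z\<bar> \<le> B" and z: "z \<in> strip"
  shows "\<bar>wexp_t x qt z\<bar> \<le> B * exp L"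
proof -
  obtain \<xi> s where zz: "z = (\<xi>, s)" "\<xi> \<in> {0..1}" using z by (auto simp: strip_def)
  have B0: "B \<ge> 0" using B[OF z] by linarith
  have "\<bar>prim (\<lambda>z. qt (Psi x z) * stretch x z) (\<xi>, s) - prim (\<lambda>z. qt (Psi x z) * stretch x z) (x, s)\<bar> \<le> B * exp L"
  proof (rule prim_diff_bound_const)
    show "continuous_on strip (\<lambda>z. qt (Psi x z) * stretch x z)"
      by (intro continuous_intros continuous_Psi continuous_stretch x q)
    fix \<eta> :: real assume \<eta>: "\<eta> \<in> {0..1}"
    show "\<bar>qt (Psi x (\<eta>, s)) * stretch x (\<eta>, s)\<bar> \<le> B * exp L"
      unfolding abs_mult
      by (intro mult_mono B wexp_bounds(3)[OF x ft_cont ft_le] B0) (use \<eta> in auto)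
  qed (use x zz in auto)
  thus ?thesis by (simp add: wexp_t_def zz)
qed

lemma cfac_eq_wexp:
  assumes x: "x \<in> {0..1}" and \<xi>: "\<xi> \<in> {0..1}" and q: "continuous_on strip (\<lambda>z. bd z / a z)"
  shows "cfac a bd \<xi> x t = wexp x (\<lambda>z. bd z / a z) (\<xi>, t)"
proof -
  let ?k = "\<lambda>z. bd (Psi x z) / a (Psi x z)"
  have k: "continuous_on strip ?k" using continuous_Psi[OF x q] .
  have iv: "(LBINT \<eta>=u..v. ?k (\<eta>, t)) = prim ?k (v, t) - prim ?k (u, t)"
    if uv: "0 \<le> u" "u \<le> v" "v \<le> 1" for u v :: real
  proof -
    have ik: "(\<lambda>\<eta>. ?k (\<eta>, t)) integrable_on {r..r'}" if "0 \<le> r" "r' \<le> 1" for r r'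
      by (rule integrable_continuous_real continuous_on_subset[OF cont_slice[OF k]])+ (use that in auto)
    have ab: "set_integrable lborel {u..v} (\<lambda>\<eta>. ?k (\<eta>, t))"
      by (rule borel_integrable_atLeastAtMost'[OF continuous_on_subset[OF cont_slice[OF k]]])
        (use uv in auto)
    have "(LBINT \<eta>=u..v. ?k (\<eta>, t)) = integral {u..v} (\<lambda>\<eta>. ?k (\<eta>, t))"
      using interval_integral_eq_integral[OF uv(2) ab] by simp
    also have "\<dots> = prim ?k (v, t) - prim ?k (u, t)"
      using Henstock_Kurzweil_Integration.integral_combine[OF uv(1,2) ik] uv by (auto simp: prim_def)
    finally show ?thesis .
  qed
  have "(LBINT \<eta>=x..\<xi>. ?k (\<eta>, t)) = prim ?k (\<xi>, t) - prim ?k (x, t)"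
  proof (cases "x \<le> \<xi>")
    case True
    thus ?thesis using iv[of x \<xi>] x \<xi> by auto
  next
    case False
    thus ?thesis using iv[of \<xi> x] x \<xi> by (subst interval_integral_endpoints_reverse) auto
  qed
  thus ?thesis by (simp add: cfac_def wexp_def Psi_def)
qed

lemma omega_mono:
  assumes x: "x \<in> {0..1}" and \<xi>: "\<xi> \<in> {0..1}" and "s \<le> s'"
  shows "omega a \<xi> x s \<le> omega a \<xi> x s'"
  by (rule DERIV_nonneg_imp_nondecreasing[OF assms(3)])
    (use has_dt_omega[OF x \<xi>] in \<open>auto intro!: exI simp: wexp_def\<close>)

text \<open>\<open>stretch\<close> is the Jacobian of the substitution and is at least
  \<open>exp (- L)\<close>, so inserting it into the integral of a nonnegative function costs at
  most \<open>exp L\<close>.\<close>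

lemma integral_omega_le:
  assumes x: "x \<in> {0..1}" and \<xi>: "\<xi> \<in> {0..1}" and g: "continuous_on UNIV g"
    and nonneg: "\<And>s. 0 \<le> g s" and ab: "\<alpha> \<le> \<beta>"
  shows "integral {\<alpha>..\<beta>} (\<lambda>s. g (omega a \<xi> x s)) \<le>
    exp L * integral {omega a \<xi> x \<alpha>..omega a \<xi> x \<beta>} g"
proof -
  let ?Y = "\<lambda>s. omega a \<xi> x s" and ?E = "\<lambda>s. stretch x (\<xi>, s)"
  have Yc: "continuous_on S ?Y" for S
    using has_dt_omega[OF x \<xi>] by (meson DERIV_continuous_on has_field_derivative_at_within)
  have Ec: "continuous_on S ?E" for S
    by (rule cont_slice_t[OF continuous_stretch[OF x] \<xi>])
  have gY: "continuous_on S (\<lambda>s. g (?Y s))" for S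
    by (rule continuous_on_compose2[OF g Yc]) auto
  have E: "1 \<le> exp L * ?E s" for s
  proof -
    have "exp (- L) \<le> ?E s" using wexp_bounds(1)[OF x ft_cont ft_le] \<xi> by auto
    thus ?thesis by (simp add: exp_minus field_simps)
  qed
  have sub: "((\<lambda>s. ?E s *\<^sub>R g (?Y s)) has_integral integral {?Y \<alpha>..?Y \<beta>} g) {\<alpha>..\<beta>}"
    by (rule has_integral_substitution[where c = "?Y \<alpha>" and d = "?Y \<beta>"])
      (use ab in \<open>auto intro!: omega_mono[OF x \<xi>] has_field_derivative_at_within[OF has_dt_omega[OF x \<xi>]]
        continuous_on_subset[OF g]\<close>)
  have "integral {\<alpha>..\<beta>} (\<lambda>s. g (?Y s)) \<le> integral {\<alpha>..\<beta>} (\<lambda>s. exp L * (?E s * g (?Y s)))"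
  proof (rule integral_le)
    fix s
    show "g (?Y s) \<le> exp L * (?E s * g (?Y s))"
      using mult_right_mono[OF E nonneg[of "?Y s"], of s] by (simp add: mult_ac)
  qed (auto intro!: integrable_continuous_real continuous_intros gY Ec)
  also have "\<dots> = exp L * integral {?Y \<alpha>..?Y \<beta>} g"
    using integral_unique[OF sub] by simp
  finally show ?thesis .
qed

end

lemma has_dt_mult:
  "has_dt f f' \<Longrightarrow> has_dt g g' \<Longrightarrow> has_dt (\<lambda>z. f z * g z) (\<lambda>z. f' z * g z + f z * g' z)"
  unfolding has_dt_def by (auto intro!: derivative_eq_intros)

lemma has_dx_mult:
  "has_dx f f' \<Longrightarrow> has_dx g g' \<Longrightarrow> has_dx (\<lambda>z. f z * g z) (\<lambda>z. f' z * g z + f z * g' z)"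
  unfolding has_dx_def by (auto intro!: derivative_eq_intros)

section \<open>Gain of a derivative in the coupling terms\<close>

context flow
begin

text \<open>
  The coupling enters through the primitive of \<open>wexp x q * p(\<Psi>) * h(\<Psi>)\<close> along the characteristic,
  where \<open>p = \<gamma> (1/a - 1/A)\<close> and \<open>h\<close> solves a transport equation with the other speed \<open>A\<close>.
  Because of the factor \<open>1/a - 1/A\<close>, the \<open>t\<close>-derivative of the integrand is a derivative along the
  characteristic up to terms of order zero in \<open>h\<close>. So the primitive gains one derivative.
\<close>
lemma coupling_gains_derivative:
  assumes q: "continuous_on strip q" "continuous_on strip qt" "has_dt q qt"
      "bounded_strip q" "bounded_strip qt"
    and \<gamma>: "BC1_strip \<gamma> \<gamma>x \<gamma>t"
    and A: "continuous_on strip A" "\<mu> > 0" "\<And>z. z \<in> strip \<Longrightarrow> \<mu> \<le> \<bar>A z\<bar>"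
    and p: "continuous_on strip p" "continuous_on strip pt" "has_dt p pt"
      "bounded_strip p" "bounded_strip pt"
      "\<And>z. z \<in> strip \<Longrightarrow> p z = \<gamma> z * (1 / a z - 1 / A z)"
  shows "\<exists>K\<ge>0. \<forall>h hx ht x y s. C1_strip h hx ht \<longrightarrow> x \<in> {0..1} \<longrightarrow> y \<in> {0..1} \<longrightarrow>
    (\<exists>D. ((\<lambda>s. prim (\<lambda>z. wexp x q z * p (Psi x z) * h (Psi x z)) (x, s) -
             prim (\<lambda>z. wexp x q z * p (Psi x z) * h (Psi x z)) (y, s)) has_real_derivative D) (at s) \<and>
       \<bar>D\<bar> \<le> K * (\<bar>h (x, s)\<bar> + \<bar>h (Psi x (y, s))\<bar> +
         integral {0..1} (\<lambda>\<xi>. \<bar>h (Psi x (\<xi>, s))\<bar> +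
           \<bar>ht (Psi x (\<xi>, s)) + A (Psi x (\<xi>, s)) * hx (Psi x (\<xi>, s))\<bar>)))"
proof -
  obtain Bq where Bq: "Bq > 0" "\<And>z. z \<in> strip \<Longrightarrow> \<bar>q z\<bar> \<le> Bq" using bounded_stripE[OF q(4)] by blast
  obtain Bqt where Bqt: "Bqt > 0" "\<And>z. z \<in> strip \<Longrightarrow> \<bar>qt z\<bar> \<le> Bqt" using bounded_stripE[OF q(5)] by blast
  obtain Bp where Bp: "Bp > 0" "\<And>z. z \<in> strip \<Longrightarrow> \<bar>p z\<bar> \<le> Bp" using bounded_stripE[OF p(4)] by blast
  obtain Bpt where Bpt: "Bpt > 0" "\<And>z. z \<in> strip \<Longrightarrow> \<bar>pt z\<bar> \<le> Bpt" using bounded_stripE[OF p(5)] by blast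
  note \<gamma>' = \<gamma>[unfolded BC1_strip_def]
  obtain Bg where Bg: "Bg > 0" "\<And>z. z \<in> strip \<Longrightarrow> \<bar>\<gamma> z\<bar> \<le> Bg" using bounded_stripE \<gamma>' by blast
  obtain Bgx where Bgx: "Bgx > 0" "\<And>z. z \<in> strip \<Longrightarrow> \<bar>\<gamma>x z\<bar> \<le> Bgx" using bounded_stripE \<gamma>' by blast
  obtain Bgt where Bgt: "Bgt > 0" "\<And>z. z \<in> strip \<Longrightarrow> \<bar>\<gamma>t z\<bar> \<le> Bgt" using bounded_stripE \<gamma>' by blast
  note \<gamma>C = C1_stripD[OF \<gamma>'[THEN conjunct1]]
  note fC = C1_stripD[OF C1f]
  define C where "C = exp L"
  define M where "M = exp Bq"
  have CM: "C > 0" "M > 0" by (auto simp: C_def M_def)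
  \<comment> \<open>The product with the bracket bounds the coefficient of \<open>h\<close> in the
    remainder \<open>H\<close> below, the last summand that of the transport expression
    \<open>?g\<close>. The constant \<open>K\<close> adds the bound for the boundary terms
    \<open>G\<close>.\<close>
  define K1 where "K1 = M * (Bqt * C * Bp + Bpt * C + Bq * C * Bg + L * C * Bg + C * (Bgx + Bgt * L))
    + M * C * Bg / \<mu>"
  define K where "K = K1 + M * C * Bg"
  have pos: "L > 0" "Bq > 0" "Bqt > 0" "Bp > 0" "Bpt > 0" "Bg > 0" "Bgx > 0" "Bgt > 0" "C > 0" "M > 0" "\<mu> > 0"
    using L_pos Bq Bqt Bp Bpt Bg Bgx Bgt CM A by auto
  have K1: "K1 \<ge> 0" unfolding K1_def
    using pos by (intro add_nonneg_nonneg mult_nonneg_nonneg divide_nonneg_nonneg) auto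
  have K: "K \<ge> 0" unfolding K_def using pos K1 by auto
  show ?thesis
  proof (rule exI[of _ K], intro conjI K allI impI)
    fix h hx ht :: "real \<times> real \<Rightarrow> real" and x y s :: real
    assume h: "C1_strip h hx ht" and x: "x \<in> {0..1}" and y: "y \<in> {0..1}"
    note hC = C1_stripD[OF h]
    let ?e = "wexp x q" and ?E = "stretch x"
    let ?g = "\<lambda>z. ht z + A z * hx z"
    define F where "F = (\<lambda>z. ?e z * p (Psi x z) * h (Psi x z))"
    define Fs where "Fs = (\<lambda>z. ((wexp_t x qt z * ?e z) * p (Psi x z) + ?e z * (pt (Psi x z) * ?E z)) * h (Psi x z)
      + (?e z * p (Psi x z)) * (ht (Psi x z) * ?E z))"
    \<comment> \<open>Chosen so that \<open>Gx\<close> absorbs the top order part of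
      \<open>Fs\<close>: with \<open>p = \<gamma> (1/a - 1/A)\<close> one has \<open>p * ht =
      \<gamma> * (hx + ht/a) - (\<gamma>/A) * (ht + A * hx)\<close>, and \<open>hx + ht/a\<close> is
      the derivative of \<open>h\<close> along the characteristic. The factor \<open>?E\<close> is
      there because differentiating \<open>h (Psi x z)\<close> in the label produces it.\<close>
    define G where "G = (\<lambda>z. ?e z * ?E z * \<gamma> (Psi x z) * h (Psi x z))"
    define Gx where "Gx = (\<lambda>z. (((q (Psi x z) * ?e z) * ?E z + ?e z * (ft (Psi x z) * ?E z)) * \<gamma> (Psi x z)
      + ?e z * ?E z * (\<gamma>x (Psi x z) + \<gamma>t (Psi x z) * (1 / a (Psi x z)))) * h (Psi x z)
      + ?e z * ?E z * \<gamma> (Psi x z) * (hx (Psi x z) + ht (Psi x z) * (1 / a (Psi x z))))"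
    define H where "H = (\<lambda>z. Fs z - Gx z)"
    note cI = continuous_on_add continuous_on_mult continuous_on_diff continuous_on_rabs
      continuous_Psi[OF x q(1)] continuous_Psi[OF x p(1)] continuous_Psi[OF x p(2)]
      continuous_Psi[OF x \<gamma>C(1)] continuous_Psi[OF x \<gamma>C(2)] continuous_Psi[OF x \<gamma>C(3)]
      continuous_Psi[OF x fC(1)] continuous_Psi[OF x fC(3)] continuous_Psi[OF x A(1)]
      continuous_Psi[OF x hC(1)] continuous_Psi[OF x hC(2)] continuous_Psi[OF x hC(3)]
      continuous_wexp[OF x q(1)] continuous_wexp_t[OF x q(2)] continuous_stretch[OF x]
    have Fc: "continuous_on strip F" unfolding F_def by (intro cI)
    have Fsc: "continuous_on strip Fs" unfolding Fs_def by (intro cI)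
    have Gxc: "continuous_on strip Gx" unfolding Gx_def by (intro cI)
    have Hc: "continuous_on strip H" unfolding H_def by (intro cI Fsc Gxc)
    have Fdt: "has_dt F Fs"
      unfolding F_def Fs_def
      by (rule has_dt_mult[OF has_dt_mult[OF has_dt_wexp[OF x q(1-3)] has_dt_Psi[OF x p(3)]]
            has_dt_Psi[OF x hC(5)]])
    have "has_dx G Gx"
      unfolding G_def Gx_def
      by (rule has_dx_mult[OF has_dx_mult[OF has_dx_mult[OF has_dx_wexp[OF x q(1)] has_dx_wexp[OF x ft_cont]]
            has_dx_Psi[OF x \<gamma>'[THEN conjunct1]]] has_dx_Psi[OF x h]])
    hence Gdx: "((\<lambda>\<xi>. G (\<xi>, t)) has_real_derivative Gx (\<xi>, t)) (at \<xi> within {0..1})"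
      if "\<xi> \<in> {0..1}" for \<xi> t
      using has_dxD that by blast
    have e: "\<bar>?e z\<bar> \<le> M" "\<bar>?E z\<bar> \<le> C" if "z \<in> strip" for z
      using wexp_bounds(3)[OF x q(1) Bq(2) that] wexp_bounds(3)[OF x ft_cont ft_le that]
      by (auto simp: C_def M_def)
    have Hle: "\<bar>H z\<bar> \<le> K1 * (\<bar>h (Psi x z)\<bar> + \<bar>?g (Psi x z)\<bar>)" if z: "z \<in> strip" for z
    proof -
      have Pz: "Psi x z \<in> strip" using z by simp
      have Anz: "A (Psi x z) \<noteq> 0" using A(3)[OF Pz] A(2) by auto
      define R where "R = wexp_t x qt z * p (Psi x z) + pt (Psi x z) * ?E z
        - q (Psi x z) * ?E z * \<gamma> (Psi x z) - ft (Psi x z) * ?E z * \<gamma> (Psi x z)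
        - ?E z * (\<gamma>x (Psi x z) + \<gamma>t (Psi x z) * (1 / a (Psi x z)))"
      have "H z = ?e z * R * h (Psi x z)
          + ?e z * ?E z * (p (Psi x z) * ht (Psi x z) - \<gamma> (Psi x z) * (hx (Psi x z) + ht (Psi x z) * (1 / a (Psi x z))))"
      proof -
        have alg: "((k * e) * p + e * (pt * E)) * h + (e * p) * (ht * E)
            - ((((q * e) * E + e * (ft * E)) * g + e * E * (gx + gt * f)) * h + e * E * g * (hx + ht * f))
          = e * (k * p + pt * E - q * E * g - ft * E * g - E * (gx + gt * f)) * h
            + e * E * (p * ht - g * (hx + ht * f))" for k e p pt E h ht q ft g gx gt f hx :: real
          by (simp only: algebra_simps)
        show ?thesis unfolding H_def Fs_def Gx_def R_def by (rule alg)
      qed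
      also have "p (Psi x z) * ht (Psi x z) - \<gamma> (Psi x z) * (hx (Psi x z) + ht (Psi x z) * (1 / a (Psi x z)))
          = - \<gamma> (Psi x z) * (1 / A (Psi x z)) * ?g (Psi x z)"
      proof -
        have alg: "g * (f - 1 / B) * ht - g * (hx + ht * f) = - g * (1 / B) * (ht + B * hx)"
          if "B \<noteq> 0" for g f B ht hx :: real
          using that by (simp add: field_simps)
        show ?thesis unfolding p(6)[OF Pz] by (rule alg[OF Anz])
      qed
      finally have Heq: "H z = ?e z * R * h (Psi x z)
          + ?e z * ?E z * (- \<gamma> (Psi x z) * (1 / A (Psi x z)) * ?g (Psi x z))" .
      have R: "\<bar>R\<bar> \<le> Bqt * C * Bp + Bpt * C + Bq * C * Bg + L * C * Bg + C * (Bgx + Bgt * L)"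
      proof -
        have 1: "\<bar>wexp_t x qt z * p (Psi x z)\<bar> \<le> Bqt * C * Bp"
          unfolding abs_mult C_def by (intro mult_mono wexp_t_bound[OF x q(2) Bqt(2)] Bp z Pz) (use pos in auto)
        have 2: "\<bar>pt (Psi x z) * ?E z\<bar> \<le> Bpt * C"
          unfolding abs_mult by (intro mult_mono Bpt e z Pz) (use pos in auto)
        have 3: "\<bar>q (Psi x z) * ?E z * \<gamma> (Psi x z)\<bar> \<le> Bq * C * Bg"
          unfolding abs_mult by (intro mult_mono Bq Bg e z Pz mult_nonneg_nonneg) (use pos in auto)
        have 4: "\<bar>ft (Psi x z) * ?E z * \<gamma> (Psi x z)\<bar> \<le> L * C * Bg"
          unfolding abs_mult by (intro mult_mono ft_le Bg e z Pz mult_nonneg_nonneg) (use pos in auto)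
        have "\<bar>\<gamma>t (Psi x z) * (1 / a (Psi x z))\<bar> \<le> Bgt * L"
          unfolding abs_mult by (intro mult_mono f_le Bgt Pz) (use pos in auto)
        hence "\<bar>\<gamma>x (Psi x z) + \<gamma>t (Psi x z) * (1 / a (Psi x z))\<bar> \<le> Bgx + Bgt * L"
          using Bgx(2)[OF Pz] by linarith
        hence 5: "\<bar>?E z * (\<gamma>x (Psi x z) + \<gamma>t (Psi x z) * (1 / a (Psi x z)))\<bar> \<le> C * (Bgx + Bgt * L)"
          unfolding abs_mult by (intro mult_mono e z) (use pos in auto)
        show ?thesis unfolding R_def using 1 2 3 4 5 by linarith
      qed
      have t1: "\<bar>?e z * R * h (Psi x z)\<bar> \<le>
          (M * (Bqt * C * Bp + Bpt * C + Bq * C * Bg + L * C * Bg + C * (Bgx + Bgt * L))) * \<bar>h (Psi x z)\<bar>"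
        unfolding abs_mult by (intro mult_mono e z R mult_nonneg_nonneg order_refl) (use pos in auto)
      have iA: "\<bar>1 / A (Psi x z)\<bar> \<le> 1 / \<mu>" using A(2) A(3)[OF Pz] by (simp add: frac_le)
      have t2: "\<bar>?e z * ?E z * (- \<gamma> (Psi x z) * (1 / A (Psi x z)) * ?g (Psi x z))\<bar> \<le>
          M * C * (Bg * (1 / \<mu>) * \<bar>?g (Psi x z)\<bar>)"
        unfolding abs_mult abs_minus_cancel
        by (intro mult_mono e z Bg iA Pz mult_nonneg_nonneg order_refl) (use pos in auto)
      define X where "X = M * (Bqt * C * Bp + Bpt * C + Bq * C * Bg + L * C * Bg + C * (Bgx + Bgt * L))"
      have X0: "X \<ge> 0" unfolding X_def using pos by (intro mult_nonneg_nonneg add_nonneg_nonneg) auto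
      have "\<bar>H z\<bar> \<le> X * \<bar>h (Psi x z)\<bar> + M * C * Bg / \<mu> * \<bar>?g (Psi x z)\<bar>"
      proof -
        have "M * C * (Bg * (1 / \<mu>) * \<bar>?g (Psi x z)\<bar>) = M * C * Bg / \<mu> * \<bar>?g (Psi x z)\<bar>" by simp
        thus ?thesis unfolding Heq
          using order_trans[OF abs_triangle_ineq add_mono[OF t1 t2]] by (simp only: X_def)
      qed
      also have "\<dots> \<le> K1 * \<bar>h (Psi x z)\<bar> + K1 * \<bar>?g (Psi x z)\<bar>"
        by (intro add_mono mult_right_mono) (use X0 pos in \<open>auto simp: K1_def X_def[symmetric]\<close>)
      finally show ?thesis by (simp add: distrib_left)
    qed
    have Gle: "\<bar>G z\<bar> \<le> M * C * Bg * \<bar>h (Psi x z)\<bar>" if z: "z \<in> strip" for z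
      unfolding G_def abs_mult
      by (intro mult_mono e z Bg mult_nonneg_nonneg order_refl) (use z pos in auto)
    let ?I = "integral {0..1} (\<lambda>\<xi>. \<bar>h (Psi x (\<xi>, s))\<bar> + \<bar>?g (Psi x (\<xi>, s))\<bar>)"
    have hgc: "continuous_on strip (\<lambda>z. \<bar>h (Psi x z)\<bar> + \<bar>?g (Psi x z)\<bar>)"
      by (intro cI)
    have Hint: "\<bar>prim H (x, s) - prim H (y, s)\<bar> \<le> integral {0..1} (\<lambda>\<xi>. K1 * (\<bar>h (Psi x (\<xi>, s))\<bar> + \<bar>?g (Psi x (\<xi>, s))\<bar>))"
      by (rule prim_diff_bound[OF Hc _ _ x y])
        (use Hle in \<open>auto intro!: continuous_on_mult_left cont_slice[OF hgc]\<close>)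
    have I0: "?I \<ge> 0" by (rule integral_nonneg) (auto intro!: integrable_continuous_real cont_slice[OF hgc])
    \<comment> \<open>Integration of \<open>Fs = Gx + H\<close>: the derivative part leaves only
      boundary values of \<open>h\<close>, and the rest is of order zero apart from the transport
      expression.\<close>
    have eqD: "prim Fs (x, s) - prim Fs (y, s) = (G (x, s) + prim H (x, s)) - (G (y, s) + prim H (y, s))"
    proof (rule prim_diff_eq[OF Fsc _ x y])
      fix \<xi> :: real assume \<xi>: "\<xi> \<in> {0..1}"
      show "((\<lambda>\<xi>. G (\<xi>, s) + prim H (\<xi>, s)) has_real_derivative Fs (\<xi>, s)) (at \<xi> within {0..1})"
        by (rule DERIV_cong[OF DERIV_add[OF Gdx[OF \<xi>] has_dxD[OF has_dx_prim[OF Hc] \<xi>]]])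
          (simp add: H_def)
    qed
    have d: "((\<lambda>s. prim F (x, s) - prim F (y, s)) has_real_derivative prim Fs (x, s) - prim Fs (y, s)) (at s)"
      by (intro DERIV_diff has_dtD[OF has_dt_prim[OF Fc Fsc Fdt]] x y)
    have Gx1: "\<bar>G (x, s)\<bar> \<le> M * C * Bg * \<bar>h (x, s)\<bar>" using Gle[of "(x, s)"] x by (simp add: Psi_self[OF x])
    have Gy1: "\<bar>G (y, s)\<bar> \<le> M * C * Bg * \<bar>h (Psi x (y, s))\<bar>" using Gle[of "(y, s)"] y by simp
    have "\<bar>prim Fs (x, s) - prim Fs (y, s)\<bar> \<le>
        M * C * Bg * (\<bar>h (x, s)\<bar> + \<bar>h (Psi x (y, s))\<bar>) + K1 * ?I"
    proof -
      have "\<bar>prim H (x, s) - prim H (y, s)\<bar> \<le> K1 * ?I" using Hint by (simp only: integral_mult_right)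
      thus ?thesis unfolding eqD distrib_left using Gx1 Gy1 by linarith
    qed
    also have "\<dots> \<le> K * (\<bar>h (x, s)\<bar> + \<bar>h (Psi x (y, s))\<bar>) + K * ?I"
      by (intro add_mono mult_right_mono) (use I0 K1 pos in \<open>auto simp: K_def\<close>)
    finally have "\<bar>prim Fs (x, s) - prim Fs (y, s)\<bar> \<le> K * (\<bar>h (x, s)\<bar> + \<bar>h (Psi x (y, s))\<bar> + ?I)"
      by (simp add: distrib_left)
    thus "\<exists>D. ((\<lambda>s. prim (\<lambda>z. wexp x q z * p (Psi x z) * h (Psi x z)) (x, s) -
             prim (\<lambda>z. wexp x q z * p (Psi x z) * h (Psi x z)) (y, s)) has_real_derivative D) (at s) \<and>
       \<bar>D\<bar> \<le> K * (\<bar>h (x, s)\<bar> + \<bar>h (Psi x (y, s))\<bar> + ?I)"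
      using d unfolding F_def by blast
  qed
qed

text \<open>The companion estimate for the undifferentiated primitive. Only the average of
  \<open>h\<close> along the characteristic occurs, no value at its ends, so it can be fed with
  bounds on time slices.\<close>

lemma coupling_bound:
  assumes q: "continuous_on strip q" "bounded_strip q" and p: "continuous_on strip p" "bounded_strip p"
  shows "\<exists>K\<ge>0. \<forall>h x y s. continuous_on strip h \<longrightarrow> x \<in> {0..1} \<longrightarrow> y \<in> {0..1} \<longrightarrow>
    \<bar>prim (\<lambda>z. wexp x q z * p (Psi x z) * h (Psi x z)) (x, s) -
       prim (\<lambda>z. wexp x q z * p (Psi x z) * h (Psi x z)) (y, s)\<bar>
     \<le> K * integral {0..1} (\<lambda>\<xi>. \<bar>h (Psi x (\<xi>, s))\<bar>)"
proof -
  obtain Bq where Bq: "Bq > 0" "\<And>z. z \<in> strip \<Longrightarrow> \<bar>q z\<bar> \<le> Bq" using bounded_stripE[OF q(2)] by blast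
  obtain Bp where Bp: "Bp > 0" "\<And>z. z \<in> strip \<Longrightarrow> \<bar>p z\<bar> \<le> Bp" using bounded_stripE[OF p(2)] by blast
  show ?thesis
  proof (intro exI[of _ "exp Bq * Bp"] conjI allI impI)
    fix h :: "real \<times> real \<Rightarrow> real" and x y s :: real
    assume h: "continuous_on strip h" and x: "x \<in> {0..1}" and y: "y \<in> {0..1}"
    have "\<bar>wexp x q z * p (Psi x z) * h (Psi x z)\<bar> \<le> exp Bq * Bp * \<bar>h (Psi x z)\<bar>" if z: "z \<in> strip" for z
      unfolding abs_mult
      by (intro mult_mono wexp_bounds(3)[OF x q(1) Bq(2)] z Bp(2) order_refl mult_nonneg_nonneg)
        (use z Bp in auto)
    hence "\<bar>prim (\<lambda>z. wexp x q z * p (Psi x z) * h (Psi x z)) (x, s) -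
       prim (\<lambda>z. wexp x q z * p (Psi x z) * h (Psi x z)) (y, s)\<bar>
       \<le> integral {0..1} (\<lambda>\<xi>. exp Bq * Bp * \<bar>h (Psi x (\<xi>, s))\<bar>)"
      by (intro prim_diff_bound x y continuous_intros continuous_wexp continuous_Psi q p h
          cont_slice[OF continuous_Psi[OF x h]]) auto
    thus "\<bar>prim (\<lambda>z. wexp x q z * p (Psi x z) * h (Psi x z)) (x, s) -
       prim (\<lambda>z. wexp x q z * p (Psi x z) * h (Psi x z)) (y, s)\<bar>
       \<le> exp Bq * Bp * integral {0..1} (\<lambda>\<xi>. \<bar>h (Psi x (\<xi>, s))\<bar>)" by simp
  qed (use Bp in auto)
qed

end

section \<open>Integrals over time windows\<close>

text \<open>
  \<open>wb t\<^sub>0 g h r B\<close> bounds the integral of \<open>\<bar>g\<bar>\<close> over all windows of length at most \<open>h\<close> within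
  distance \<open>r\<close> of \<open>t\<^sub>0\<close>. With \<open>h = 2 r\<close> this is an \<open>L\<^sup>1\<close> bound; with \<open>B\<close> proportional to \<open>h\<close> and
  \<open>h \<rightarrow> 0\<close> it is a sup bound, so that one argument covers both norms.
\<close>
definition wb :: "real \<Rightarrow> (real \<Rightarrow> real) \<Rightarrow> real \<Rightarrow> real \<Rightarrow> real \<Rightarrow> bool"
  where "wb t\<^sub>0 g h r B \<longleftrightarrow> (\<forall>\<alpha> \<beta>. t\<^sub>0 - r \<le> \<alpha> \<longrightarrow> \<alpha> \<le> \<beta> \<longrightarrow> \<beta> \<le> t\<^sub>0 + r \<longrightarrow> \<beta> - \<alpha> \<le> h \<longrightarrow>
    integral {\<alpha>..\<beta>} (\<lambda>s. \<bar>g s\<bar>) \<le> B)"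

lemma wbD:
  "wb t\<^sub>0 g h r B \<Longrightarrow> t\<^sub>0 - r \<le> \<alpha> \<Longrightarrow> \<alpha> \<le> \<beta> \<Longrightarrow> \<beta> \<le> t\<^sub>0 + r \<Longrightarrow> \<beta> - \<alpha> \<le> h \<Longrightarrow>
    integral {\<alpha>..\<beta>} (\<lambda>s. \<bar>g s\<bar>) \<le> B"
  by (auto simp: wb_def)

lemma wb_weaken:
  assumes "wb t\<^sub>0 g h r B" "h' \<le> h" "r' \<le> r" "B \<le> B'"
  shows "wb t\<^sub>0 g h' r' B'"
  using assms unfolding wb_def by (meson add_left_mono diff_left_mono order_trans)

lemma abs_integrable_UNIV:
  "continuous_on UNIV g \<Longrightarrow> (\<lambda>s. \<bar>g s :: real\<bar>) integrable_on {\<alpha>..\<beta>::real}"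
  by (intro integrable_continuous_real continuous_on_rabs) (auto intro: continuous_on_subset)

lemma wb_dominated:
  assumes "wb t\<^sub>0 g' h r B" "continuous_on UNIV g" "continuous_on UNIV g'"
    and "\<And>s. t\<^sub>0 - r \<le> s \<Longrightarrow> s \<le> t\<^sub>0 + r \<Longrightarrow> \<bar>g s\<bar> \<le> \<bar>g' s\<bar>"
  shows "wb t\<^sub>0 g h r B"
  unfolding wb_def
proof (intro allI impI)
  fix \<alpha> \<beta> assume ab: "t\<^sub>0 - r \<le> \<alpha>" "\<alpha> \<le> \<beta>" "\<beta> \<le> t\<^sub>0 + r" "\<beta> - \<alpha> \<le> h"
  have "integral {\<alpha>..\<beta>} (\<lambda>s. \<bar>g s\<bar>) \<le> integral {\<alpha>..\<beta>} (\<lambda>s. \<bar>g' s\<bar>)"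
    by (rule integral_le) (use ab assms in \<open>auto intro!: abs_integrable_UNIV\<close>)
  thus "integral {\<alpha>..\<beta>} (\<lambda>s. \<bar>g s\<bar>) \<le> B" using wbD[OF assms(1) ab] by linarith
qed

lemma wb_cmult:
  assumes "wb t\<^sub>0 g h r B"
  shows "wb t\<^sub>0 (\<lambda>s. c * g s) h r (\<bar>c\<bar> * B)"
  using assms unfolding wb_def abs_mult by (auto intro!: mult_left_mono)

lemma wb_add:
  assumes "wb t\<^sub>0 f h r A" "wb t\<^sub>0 g h r B" "continuous_on UNIV f" "continuous_on UNIV g"
  shows "wb t\<^sub>0 (\<lambda>s. f s + g s) h r (A + B)"
  unfolding wb_def
proof (intro allI impI)
  fix \<alpha> \<beta> assume ab: "t\<^sub>0 - r \<le> \<alpha>" "\<alpha> \<le> \<beta>" "\<beta> \<le> t\<^sub>0 + r" "\<beta> - \<alpha> \<le> h"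
  have "integral {\<alpha>..\<beta>} (\<lambda>s. \<bar>f s + g s\<bar>) \<le> integral {\<alpha>..\<beta>} (\<lambda>s. \<bar>f s\<bar> + \<bar>g s\<bar>)"
    by (rule integral_le) (use assms in \<open>auto intro!: Henstock_Kurzweil_Integration.integrable_add abs_integrable_UNIV continuous_on_add\<close>)
  also have "\<dots> = integral {\<alpha>..\<beta>} (\<lambda>s. \<bar>f s\<bar>) + integral {\<alpha>..\<beta>} (\<lambda>s. \<bar>g s\<bar>)"
    using assms by (intro Henstock_Kurzweil_Integration.integral_add abs_integrable_UNIV)
  finally show "integral {\<alpha>..\<beta>} (\<lambda>s. \<bar>f s + g s\<bar>) \<le> A + B"
    using wbD[OF assms(1) ab] wbD[OF assms(2) ab] by linarith
qed

lemma wb_zero: "B \<ge> 0 \<Longrightarrow> wb t\<^sub>0 (\<lambda>s. 0) h r B"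
  by (simp add: wb_def)

lemma wb_sum:
  assumes "finite I" "\<And>i. i \<in> I \<Longrightarrow> wb t\<^sub>0 (g i) h r (B i)" "\<And>i. i \<in> I \<Longrightarrow> continuous_on UNIV (g i)"
  shows "wb t\<^sub>0 (\<lambda>s. \<Sum>i\<in>I. g i s) h r (\<Sum>i\<in>I. B i)"
  using assms
proof (induction I rule: finite_induct)
  case empty
  thus ?case by (simp add: wb_zero)
next
  case (insert i I)
  have "wb t\<^sub>0 (\<lambda>s. g i s + (\<Sum>i\<in>I. g i s)) h r (B i + (\<Sum>i\<in>I. B i))"
    by (rule wb_add) (use insert in \<open>auto intro!: continuous_on_sum\<close>)
  thus ?case using insert by simp
qed

lemma wb_abs: "wb t\<^sub>0 (\<lambda>s. \<bar>g s\<bar>) h r B \<longleftrightarrow> wb t\<^sub>0 g h r B"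
  by (simp add: wb_def)

text \<open>The map \<open>omega\<close> stretches a window by at most \<open>exp L\<close> and
  shifts it by at most \<open>L\<close>, which explains the larger window in the assumption; the
  factor in the bound comes from the Jacobian.\<close>

lemma (in flow) wb_omega:
  assumes x: "x \<in> {0..1}" and y: "y \<in> {0..1}" and g: "continuous_on UNIV g"
    and wb: "wb t\<^sub>0 g (exp L * h) (r + L) B"
  shows "wb t\<^sub>0 (\<lambda>s. g (omega a y x s)) h r (exp L * B)"
  unfolding wb_def
proof (intro allI impI)
  fix \<alpha> \<beta> assume ab: "t\<^sub>0 - r \<le> \<alpha>" "\<alpha> \<le> \<beta>" "\<beta> \<le> t\<^sub>0 + r" "\<beta> - \<alpha> \<le> h"
  have "integral {\<alpha>..\<beta>} (\<lambda>s. \<bar>g (omega a y x s)\<bar>) \<le>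
      exp L * integral {omega a y x \<alpha>..omega a y x \<beta>} (\<lambda>s. \<bar>g s\<bar>)"
    by (rule integral_omega_le[OF x y]) (use g ab in \<open>auto intro!: continuous_on_rabs\<close>)
  also have "\<dots> \<le> exp L * B"
  proof (intro mult_left_mono wbD[OF wb])
    show "omega a y x \<alpha> \<le> omega a y x \<beta>" by (rule omega_mono[OF x y ab(2)])
    show "t\<^sub>0 - (r + L) \<le> omega a y x \<alpha>" using omega_dist[OF x y, of \<alpha>] ab by (simp add: abs_le_iff)
    show "omega a y x \<beta> \<le> t\<^sub>0 + (r + L)" using omega_dist[OF x y, of \<beta>] ab by (simp add: abs_le_iff)
    have "omega a y x \<beta> - omega a y x \<alpha> \<le> exp L * (\<beta> - \<alpha>)"
      using omega_lipschitz_t[OF x y, of \<beta> \<alpha>] ab by (auto simp: abs_le_iff)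
    also have "\<dots> \<le> exp L * h" using ab by simp
    finally show "omega a y x \<beta> - omega a y x \<alpha> \<le> exp L * h" .
  qed simp
  finally show "integral {\<alpha>..\<beta>} (\<lambda>s. \<bar>g (omega a y x s)\<bar>) \<le> exp L * B" .
qed

lemma (in flow) continuous_omega_t:
  "x \<in> {0..1} \<Longrightarrow> y \<in> {0..1} \<Longrightarrow> continuous_on S (omega a y x)"
  using has_dt_omega by (meson DERIV_continuous_on has_field_derivative_at_within)

section \<open>The boundary operator\<close>

text \<open>\<open>\<mu>\<close> is the lower bound for all speeds, and a single \<open>L\<close>
  serves all components, so every window is enlarged by the same amounts whichever characteristics
  are followed. The function \<open>\<beta>\<close> holds one choice of factor for each
  pair.\<close>

locale hyperbolic =
  fixes n m N :: nat and p :: "nat \<Rightarrow> nat \<Rightarrow> real" and a :: vfield and b :: "nat \<Rightarrow> vfield"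
    and \<beta> :: "nat \<Rightarrow> nat \<Rightarrow> real \<times> real \<Rightarrow> real" and \<mu> L :: real
    and fx ft :: vfield
  assumes n: "n \<ge> 2" and m: "m \<le> n" and \<mu>: "\<mu> > 0"
    and aBC: "\<And>j. j \<in> {1..n} \<Longrightarrow> BC1_strip (a j) (dx strip (a j)) (dt strip (a j))"
    and bBC: "\<And>j k. j \<in> {1..n} \<Longrightarrow> k \<in> {1..n} \<Longrightarrow> BC1_strip (b j k) (dx strip (b j k)) (dt strip (b j k))"
    and a_pos: "\<And>j z. j \<in> {1..n} \<Longrightarrow> j \<le> m \<Longrightarrow> z \<in> strip \<Longrightarrow> \<mu> \<le> a j z"
    and a_neg: "\<And>j z. j \<in> {1..n} \<Longrightarrow> m < j \<Longrightarrow> z \<in> strip \<Longrightarrow> a j z \<le> - \<mu>"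
    and fl: "\<And>j. j \<in> {1..n} \<Longrightarrow> flow (a j) (fx j) (ft j) L"
    and \<beta>BC: "\<And>j k. j \<in> {1..n} \<Longrightarrow> k \<in> {1..n} \<Longrightarrow> j \<noteq> k \<Longrightarrow>
      BC1_strip (\<beta> j k) (dx strip (\<beta> j k)) (dt strip (\<beta> j k))"
    and b_eq: "\<And>j k z. j \<in> {1..n} \<Longrightarrow> k \<in> {1..n} \<Longrightarrow> j \<noteq> k \<Longrightarrow> z \<in> strip \<Longrightarrow>
      b j k z = \<beta> j k z * (a k z - a j z)"
    and nilpotent: "\<And>u j z. (\<forall>j\<in>{1..n}. continuous_on strip (u j)) \<Longrightarrow> j \<in> {1..n} \<Longrightarrow> z \<in> strip \<Longrightarrow>
      ((\<lambda>v. Cop m a b (Pop m n p v)) ^^ N) u j z = 0"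
begin

abbreviation Q :: "vfield \<Rightarrow> vfield" where "Q \<equiv> (\<lambda>v. Cop m a b (Pop m n p v))"

lemma a_abs: "j \<in> {1..n} \<Longrightarrow> z \<in> strip \<Longrightarrow> \<mu> \<le> \<bar>a j z\<bar>"
  using a_pos[of j z] a_neg[of j z] by (cases "j \<le> m") auto

lemma L_pos: "L > 0"
  using flow.L_pos[OF fl[of 1]] n by simp

lemma y01: "bpt m j \<in> {0..1}" "1 - bpt m j \<in> {0..1}"
  by (auto simp: bpt_def)

text \<open>\<open>1 - bpt m k\<close> is the end at which component \<open>k\<close> leaves the
  interval. Both sums of the boundary condition read the outgoing traces, which merges them into
  one.\<close>

lemma Pop_eq: "Pop m n p u j t = (\<Sum>k=1..n. p j k * u k (1 - bpt m k, t))"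
proof -
  have "{1..n} = {1..m} \<union> {m+1..n}" "{1..m} \<inter> {m+1..n} = {}" using m by auto
  hence "(\<Sum>k=1..n. p j k * u k (1 - bpt m k, t)) =
      (\<Sum>k=1..m. p j k * u k (1 - bpt m k, t)) + (\<Sum>k=m+1..n. p j k * u k (1 - bpt m k, t))"
    by (simp only: sum.union_disjoint finite_atLeastAtMost)
  thus ?thesis by (simp add: Pop_def bpt_def)
qed

definition qd :: "nat \<Rightarrow> real \<times> real \<Rightarrow> real" where "qd j = (\<lambda>z. b j j z / a j z)"

lemma coef_BC:
  assumes "j \<in> {1..n}" "k \<in> {1..n}"
  shows "\<exists>cx ct. BC1_strip (\<lambda>z. b j k z / a j z) cx ct"
  using BC1_strip_mult[OF bBC[OF assms] BC1_strip_inverse[OF aBC[OF assms(1)] \<mu> a_abs[OF assms(1)]]]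
  by (simp only: times_divide_eq_right mult_1_right) blast

text \<open>Existence and boundedness of the \<open>t\<close>-derivative is all that later estimates
  use, so it is chosen rather than computed.\<close>

definition qdt :: "nat \<Rightarrow> real \<times> real \<Rightarrow> real"
  where "qdt j = (SOME ct. \<exists>cx. BC1_strip (qd j) cx ct)"

lemma qd_props:
  assumes "j \<in> {1..n}"
  shows "continuous_on strip (qd j)" "continuous_on strip (qdt j)" "has_dt (qd j) (qdt j)"
    "bounded_strip (qd j)" "bounded_strip (qdt j)"
proof -
  have "\<exists>ct cx. BC1_strip (qd j) cx ct" using coef_BC[OF assms assms] unfolding qd_def by blast
  from someI_ex[OF this] obtain cx where "BC1_strip (qd j) cx (qdt j)" unfolding qdt_def by blast
  thus "continuous_on strip (qd j)" "continuous_on strip (qdt j)" "has_dt (qd j) (qdt j)"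
    "bounded_strip (qd j)" "bounded_strip (qdt j)"
    by (auto simp: BC1_strip_def C1_strip_def)
qed

lemma Q_eq:
  assumes j: "j \<in> {1..n}" and x: "x \<in> {0..1}"
  shows "Q v j (x, t) = flow.wexp (a j) x (qd j) (bpt m j, t) *
    Pop m n p v j (omega (a j) (bpt m j) x t)"
  using flow.cfac_eq_wexp[OF fl[OF j] x y01(1), of "b j j" j t] qd_props(1)[OF j]
  by (simp add: Cop_def qd_def)

lemma Q_diff: "Q (\<lambda>j z. u j z - v j z) = (\<lambda>j z. Q u j z - Q v j z)"
  by (auto simp: Cop_def Pop_eq fun_eq_iff right_diff_distrib sum_subtractf)

lemma Q_pow_diff: "(Q ^^ i) (\<lambda>j z. u j z - v j z) = (\<lambda>j z. (Q ^^ i) u j z - (Q ^^ i) v j z)"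
  by (induction i) (simp_all only: funpow.simps comp_apply id_apply Q_diff)

text \<open>By linearity the \<open>i\<close>-th summand is \<open>Q^i u - Q^(i+1) u\<close>. With
  \<open>k = N\<close> the last power vanishes on the strip, and \<open>u\<close> is recovered from
  \<open>u - Q u\<close>.\<close>

lemma Q_telescope:
  "(\<Sum>i<k. (Q ^^ i) (\<lambda>j z. u j z - Q u j z) j z) = u j z - (Q ^^ k) u j z"
proof (induction k)
  case (Suc k)
  have "(Q ^^ k) (Q u) = (Q ^^ Suc k) u" by (simp only: funpow_Suc_right comp_apply)
  thus ?case using Suc unfolding Q_pow_diff by simp
qed simp

text \<open>Regularity is tracked in \<open>t\<close> alone, on each line of fixed \<open>x\<close>:
  \<open>Q\<close> reads its argument only on the two boundary lines, and all window integrals run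
  in \<open>t\<close>.\<close>

definition tcont :: "vfield \<Rightarrow> bool"
  where "tcont w \<longleftrightarrow> (\<forall>j\<in>{1..n}. \<forall>x\<in>{0..1}. continuous_on UNIV (\<lambda>s. w j (x, s)))"

definition tC1 :: "vfield \<Rightarrow> vfield \<Rightarrow> bool"
  where "tC1 w w' \<longleftrightarrow> tcont w' \<and> (\<forall>j\<in>{1..n}. has_dt (w j) (w' j))"

definition WB :: "real \<Rightarrow> vfield \<Rightarrow> real \<Rightarrow> real \<Rightarrow> real \<Rightarrow> bool"
  where "WB t\<^sub>0 w h r B \<longleftrightarrow> (\<forall>j\<in>{1..n}. \<forall>x\<in>{0..1}. wb t\<^sub>0 (\<lambda>s. w j (x, s)) h r B)"

lemma tcontD: "tcont w \<Longrightarrow> j \<in> {1..n} \<Longrightarrow> x \<in> {0..1} \<Longrightarrow> continuous_on S (\<lambda>s. w j (x, s))"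
  unfolding tcont_def by (meson continuous_on_subset subset_UNIV)

lemma tC1_tcont: "tC1 w w' \<Longrightarrow> tcont w"
  unfolding tC1_def tcont_def has_dt_def
  by (meson DERIV_continuous_on has_field_derivative_at_within)

lemma tcont_Pop: "tcont w \<Longrightarrow> continuous_on S (Pop m n p w j)"
  unfolding Pop_eq[abs_def] using y01 by (intro continuous_intros tcontD) auto

lemma continuous_on_Q:
  assumes j: "j \<in> {1..n}" and x: "x \<in> {0..1}" and w: "tcont w"
  shows "continuous_on S (\<lambda>s. Q w j (x, s))"
proof -
  interpret flow "a j" "fx j" "ft j" L by (rule fl[OF j])
  have "continuous_on S (\<lambda>s. Pop m n p w j (omega (a j) (bpt m j) x s))"
    by (rule continuous_on_compose2[OF tcont_Pop[OF w, of UNIV] continuous_omega_t[OF x y01(1)]]) auto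
  moreover have "continuous_on S (\<lambda>s. wexp x (qd j) (bpt m j, s))"
    by (rule cont_slice_t[OF continuous_wexp[OF x qd_props(1)[OF j]] y01(1)])
  ultimately show ?thesis unfolding Q_eq[OF j x] by (intro continuous_on_mult)
qed

lemma tcont_Q: "tcont w \<Longrightarrow> tcont (Q w)"
  unfolding tcont_def by (intro ballI continuous_on_Q) (auto simp: tcont_def)

definition pmax :: real where "pmax = (\<Sum>j=1..n. \<Sum>k=1..n. \<bar>p j k\<bar>)"

lemma p_le_pmax: "j \<in> {1..n} \<Longrightarrow> k \<in> {1..n} \<Longrightarrow> \<bar>p j k\<bar> \<le> pmax"
  unfolding pmax_def
  by (rule order_trans[OF member_le_sum[of k "{1..n}"] member_le_sum[of j "{1..n}"]])
    (auto intro!: sum_nonneg)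

lemma pmax_nonneg: "pmax \<ge> 0" unfolding pmax_def by (intro sum_nonneg) auto

lemma Pop_omega_wb:
  assumes j: "j \<in> {1..n}" and x: "x \<in> {0..1}" and w: "tcont w" and B: "B \<ge> 0"
    and WB: "WB t\<^sub>0 w (exp L * h) (r + L) B"
  shows "wb t\<^sub>0 (\<lambda>s. Pop m n p w j (omega (a j) (bpt m j) x s)) h r (real n * pmax * exp L * B)"
proof -
  interpret flow "a j" "fx j" "ft j" L by (rule fl[OF j])
  let ?Y = "\<lambda>s. omega (a j) (bpt m j) x s"
  have Yc: "continuous_on UNIV (\<lambda>s. w k (1 - bpt m k, ?Y s))" if "k \<in> {1..n}" for k
    by (rule continuous_on_compose2[OF tcontD[OF w that y01(2), of UNIV] continuous_omega_t[OF x y01(1)]]) auto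
  have "wb t\<^sub>0 (\<lambda>s. \<Sum>k=1..n. p j k * w k (1 - bpt m k, ?Y s)) h r (\<Sum>k=1..n. \<bar>p j k\<bar> * (exp L * B))"
  proof (intro wb_sum wb_cmult)
    fix k assume k: "k \<in> {1..n}"
    show "wb t\<^sub>0 (\<lambda>s. w k (1 - bpt m k, ?Y s)) h r (exp L * B)"
      using WB k y01(2) by (intro wb_omega[OF x y01(1)] tcontD[OF w]) (auto simp: WB_def)
  qed (auto intro!: continuous_on_mult_left Yc)
  moreover have "(\<Sum>k=1..n. \<bar>p j k\<bar> * (exp L * B)) \<le> (\<Sum>k=1..n. pmax * (exp L * B))"
    using B by (intro sum_mono mult_right_mono p_le_pmax[OF j]) auto
  ultimately show ?thesis
    unfolding Pop_eq by (auto elim!: wb_weaken simp: mult_ac)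
qed

definition Qbound :: real
  where "Qbound = (SOME M. M > 0 \<and> (\<forall>j\<in>{1..n}. \<forall>z\<in>strip. \<bar>qd j z\<bar> \<le> M \<and> \<bar>qdt j z\<bar> \<le> M))"

lemma Qbound:
  "Qbound > 0" "\<And>j z. j \<in> {1..n} \<Longrightarrow> z \<in> strip \<Longrightarrow> \<bar>qd j z\<bar> \<le> Qbound"
  "\<And>j z. j \<in> {1..n} \<Longrightarrow> z \<in> strip \<Longrightarrow> \<bar>qdt j z\<bar> \<le> Qbound"
proof -
  have "\<exists>B>0. \<forall>z\<in>strip. \<bar>qd j z\<bar> \<le> B \<and> \<bar>qdt j z\<bar> \<le> B" if j: "j \<in> {1..n}" for j
  proof -
    obtain B where B: "B > 0" "\<And>z. z \<in> strip \<Longrightarrow> \<bar>qd j z\<bar> \<le> B"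
      using bounded_stripE[OF qd_props(4)[OF j]] by blast
    obtain B' where B': "B' > 0" "\<And>z. z \<in> strip \<Longrightarrow> \<bar>qdt j z\<bar> \<le> B'"
      using bounded_stripE[OF qd_props(5)[OF j]] by blast
    show ?thesis
      by (rule exI[of _ "B + B'"]) (use B B' in \<open>auto intro: add_increasing add_increasing2 less_imp_le\<close>)
  qed
  then obtain B where B: "\<And>j. j \<in> {1..n} \<Longrightarrow> B j > 0"
    "\<And>j z. j \<in> {1..n} \<Longrightarrow> z \<in> strip \<Longrightarrow> \<bar>qd j z\<bar> \<le> B j \<and> \<bar>qdt j z\<bar> \<le> B j" by metis
  have le: "B j \<le> (\<Sum>j=1..n. B j)" if "j \<in> {1..n}" for j
    by (rule member_le_sum) (use that B(1) in \<open>auto intro: less_imp_le\<close>)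
  have "(\<Sum>j=1..n. B j) > 0" using n B(1) by (intro sum_pos) auto
  hence "\<exists>M. M > 0 \<and> (\<forall>j\<in>{1..n}. \<forall>z\<in>strip. \<bar>qd j z\<bar> \<le> M \<and> \<bar>qdt j z\<bar> \<le> M)"
    using B(2) le by (meson order_trans)
  from someI_ex[OF this] show "Qbound > 0" "\<And>j z. j \<in> {1..n} \<Longrightarrow> z \<in> strip \<Longrightarrow> \<bar>qd j z\<bar> \<le> Qbound"
    "\<And>j z. j \<in> {1..n} \<Longrightarrow> z \<in> strip \<Longrightarrow> \<bar>qdt j z\<bar> \<le> Qbound"
    unfolding Qbound_def by blast+
qed

text \<open>One constant for \<open>Q\<close> and its \<open>t\<close>-derivative.
  \<open>exp Qbound\<close> bounds the factor \<open>c_j\<close>, \<open>Qbound * exp L\<close> its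
  logarithmic \<open>t\<close>-derivative, the \<open>exp L\<close> in the same bracket is the
  stretch of \<open>omega\<close>, the 1 covers \<open>Q\<close> itself, and the last factor bounds
  \<open>P\<close> along a characteristic.\<close>

definition KQ :: real
  where "KQ = exp Qbound * (Qbound * exp L + 1 + exp L) * (real n * pmax * exp L)"

lemma KQ_nonneg: "KQ \<ge> 0"
  unfolding KQ_def using pmax_nonneg Qbound(1) by (intro mult_nonneg_nonneg add_nonneg_nonneg) auto

lemma WB_Q:
  assumes w: "tcont w" and B: "B \<ge> 0" and WB: "WB t\<^sub>0 w (exp L * h) (r + L) B"
  shows "WB t\<^sub>0 (Q w) h r (KQ * B)"
  unfolding WB_def
proof (intro ballI)
  fix j x assume j: "j \<in> {1..n}" and x: "x \<in> {0..1::real}"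
  interpret flow "a j" "fx j" "ft j" L by (rule fl[OF j])
  let ?Y = "\<lambda>s. omega (a j) (bpt m j) x s"
  let ?P = "\<lambda>s. Pop m n p w j (?Y s)"
  have Pc: "continuous_on UNIV ?P"
    by (rule continuous_on_compose2[OF tcont_Pop[OF w, of UNIV] continuous_omega_t[OF x y01(1)]]) auto
  have "wb t\<^sub>0 (\<lambda>s. Q w j (x, s)) h r (\<bar>exp Qbound\<bar> * (real n * pmax * exp L * B))"
  proof (rule wb_dominated[OF wb_cmult[OF Pop_omega_wb[OF j x w B WB], of "exp Qbound"]])
    fix s
    show "\<bar>Q w j (x, s)\<bar> \<le> \<bar>exp Qbound * ?P s\<bar>"
      unfolding Q_eq[OF j x] abs_mult abs_exp_cancel
      by (intro mult_right_mono wexp_bounds(3)[OF x qd_props(1)[OF j] Qbound(2)[OF j]])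
        (use y01 in auto)
  qed (auto intro!: continuous_on_Q[OF j x w] continuous_on_mult_left Pc)
  moreover have "\<bar>exp Qbound\<bar> * (real n * pmax * exp L * B) \<le> KQ * B"
  proof -
    have "exp Qbound * 1 * (real n * pmax * exp L) * B \<le> KQ * B"
      unfolding KQ_def using pmax_nonneg Qbound(1) B by (intro mult_right_mono mult_left_mono) auto
    thus ?thesis by (simp add: mult_ac)
  qed
  ultimately show "wb t\<^sub>0 (\<lambda>s. Q w j (x, s)) h r (KQ * B)" by (rule wb_weaken[OF _ order_refl order_refl])
qed

text \<open>The product rule applied to the formula for \<open>Q\<close>, with \<open>w'\<close> in
  place of the \<open>t\<close>-derivative of \<open>w\<close>. The derivative enters only through
  the transported boundary values, so \<open>Q\<close> preserves but does not improve smoothness in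
  \<open>t\<close>.\<close>

definition Qt :: "vfield \<Rightarrow> vfield \<Rightarrow> vfield"
  where "Qt w w' j = (\<lambda>(x, t). let y = bpt m j; e = flow.wexp (a j) x (qd j) (y, t); Y = omega (a j) y x t in
    (flow.wexp_t (a j) (ft j) x (qdt j) (y, t) * e) * Pop m n p w j Y +
    e * (Pop m n p w' j Y * flow.wexp (a j) x (ft j) (y, t)))"

lemma has_dt_Q:
  assumes j: "j \<in> {1..n}" and w: "tC1 w w'"
  shows "has_dt (Q w j) (Qt w w' j)"
  unfolding has_dt_def
proof (intro ballI allI)
  fix x t :: real assume x: "x \<in> {0..1}"
  interpret flow "a j" "fx j" "ft j" L by (rule fl[OF j])
  have P: "(Pop m n p w j has_real_derivative Pop m n p w' j t) (at t)" for t
    unfolding Pop_eq[abs_def]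
    by (intro DERIV_sum DERIV_cmult has_dtD[of "w _" "w' _"]) (use w y01(2) in \<open>auto simp: tC1_def\<close>)
  have "((\<lambda>s. Q w j (x, s)) has_real_derivative
      (wexp_t x (qdt j) (bpt m j, t) * wexp x (qd j) (bpt m j, t)) * Pop m n p w j (omega (a j) (bpt m j) x t)
      + (Pop m n p w' j (omega (a j) (bpt m j) x t) * stretch x (bpt m j, t)) * wexp x (qd j) (bpt m j, t)) (at t)"
    unfolding Q_eq[OF j x]
    by (intro DERIV_mult has_dtD[OF has_dt_wexp[OF x qd_props(1,2,3)[OF j]] y01(1)]
        DERIV_chain2[OF P has_dt_omega[OF x y01(1)]])
  thus "((\<lambda>s. Q w j (x, s)) has_real_derivative Qt w w' j (x, t)) (at t)"
    by (simp add: Qt_def Let_def mult_ac)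
qed

lemma continuous_on_Qt:
  assumes j: "j \<in> {1..n}" and x: "x \<in> {0..1}" and w: "tcont w" "tcont w'"
  shows "continuous_on S (\<lambda>s. Qt w w' j (x, s))"
proof -
  interpret flow "a j" "fx j" "ft j" L by (rule fl[OF j])
  have P: "continuous_on S (\<lambda>s. Pop m n p w j (omega (a j) (bpt m j) x s))" if "tcont w" for w
    by (rule continuous_on_compose2[OF tcont_Pop[OF that, of UNIV] continuous_omega_t[OF x y01(1)]]) auto
  show ?thesis
    unfolding Qt_def Let_def case_prod_conv
    by (intro continuous_on_add continuous_on_mult P w
        cont_slice_t[OF continuous_wexp[OF x qd_props(1)[OF j]] y01(1)]
        cont_slice_t[OF continuous_wexp_t[OF x qd_props(2)[OF j]] y01(1)]
        cont_slice_t[OF continuous_stretch[OF x] y01(1)])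
qed

lemma tC1_Q: "tC1 w w' \<Longrightarrow> tC1 (Q w) (Qt w w')"
  using has_dt_Q continuous_on_Qt[of _ _ w w' UNIV] tC1_tcont[of w w'] by (auto simp: tC1_def tcont_def)

lemma WB_Qt:
  assumes w: "tC1 w w'" and B: "B \<ge> 0" and WB: "WB t\<^sub>0 w (exp L * h) (r + L) B"
    and WB': "WB t\<^sub>0 w' (exp L * h) (r + L) B"
  shows "WB t\<^sub>0 (Qt w w') h r (KQ * B)"
  unfolding WB_def
proof (intro ballI)
  fix j x assume j: "j \<in> {1..n}" and x: "x \<in> {0..1::real}"
  interpret flow "a j" "fx j" "ft j" L by (rule fl[OF j])
  have wc: "tcont w" "tcont w'" using w tC1_tcont by (auto simp: tC1_def)
  let ?Y = "\<lambda>s. omega (a j) (bpt m j) x s"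
  let ?P = "\<lambda>w s. Pop m n p w j (?Y s)"
  let ?c = "Qbound * exp L * exp Qbound" and ?c' = "exp Qbound * exp L" and ?B = "real n * pmax * exp L * B"
  have Pc: "continuous_on UNIV (?P w)" if "tcont w" for w
    by (rule continuous_on_compose2[OF tcont_Pop[OF that, of UNIV] continuous_omega_t[OF x y01(1)]]) auto
  have "wb t\<^sub>0 (\<lambda>s. Qt w w' j (x, s)) h r (\<bar>?c\<bar> * ?B + \<bar>?c'\<bar> * ?B)"
  proof (rule wb_dominated)
    show "wb t\<^sub>0 (\<lambda>s. \<bar>?c * ?P w s\<bar> + \<bar>?c' * ?P w' s\<bar>) h r (\<bar>?c\<bar> * ?B + \<bar>?c'\<bar> * ?B)"
      by (intro wb_add wb_abs[THEN iffD2] wb_cmult Pop_omega_wb[OF j x _ B] wc WB WB'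
          continuous_on_rabs continuous_on_mult_left Pc)
    fix s
    have "\<bar>wexp_t x (qdt j) (bpt m j, s)\<bar> \<le> Qbound * exp L"
      by (rule wexp_t_bound[OF x qd_props(2)[OF j] Qbound(3)[OF j]]) (use y01 in auto)
    moreover have e: "\<bar>wexp x (qd j) (bpt m j, s)\<bar> \<le> exp Qbound"
      by (rule wexp_bounds(3)[OF x qd_props(1)[OF j] Qbound(2)[OF j]]) (use y01 in auto)
    moreover have "\<bar>stretch x (bpt m j, s)\<bar> \<le> exp L"
      by (rule wexp_bounds(3)[OF x ft_cont ft_le]) (use y01 in auto)
    ultimately have "\<bar>(wexp_t x (qdt j) (bpt m j, s) * wexp x (qd j) (bpt m j, s)) * ?P w s\<bar> \<le> \<bar>?c * ?P w s\<bar>"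
      "\<bar>wexp x (qd j) (bpt m j, s) * (?P w' s * stretch x (bpt m j, s))\<bar> \<le> \<bar>?c' * ?P w' s\<bar>"
    proof -
      assume 1: "\<bar>wexp_t x (qdt j) (bpt m j, s)\<bar> \<le> Qbound * exp L"
        and 3: "\<bar>stretch x (bpt m j, s)\<bar> \<le> exp L"
      show "\<bar>(wexp_t x (qdt j) (bpt m j, s) * wexp x (qd j) (bpt m j, s)) * ?P w s\<bar> \<le> \<bar>?c * ?P w s\<bar>"
        unfolding abs_mult abs_exp_cancel using 1 e Qbound(1) by (intro mult_right_mono mult_mono) auto
      have "\<bar>wexp x (qd j) (bpt m j, s)\<bar> * \<bar>stretch x (bpt m j, s)\<bar> * \<bar>?P w' s\<bar> \<le> exp Qbound * exp L * \<bar>?P w' s\<bar>"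
        using 3 e by (intro mult_right_mono mult_mono) auto
      thus "\<bar>wexp x (qd j) (bpt m j, s) * (?P w' s * stretch x (bpt m j, s))\<bar> \<le> \<bar>?c' * ?P w' s\<bar>"
        by (simp add: abs_mult mult_ac)
    qed
    thus "\<bar>Qt w w' j (x, s)\<bar> \<le> \<bar>\<bar>?c * ?P w s\<bar> + \<bar>?c' * ?P w' s\<bar>\<bar>"
      unfolding Qt_def Let_def case_prod_conv by linarith
  qed (intro continuous_on_Qt[OF j x] wc continuous_on_add continuous_on_rabs continuous_on_mult_left Pc)+
  moreover have "\<bar>?c\<bar> * ?B + \<bar>?c'\<bar> * ?B \<le> KQ * B"
  proof -
    have "exp Qbound * (Qbound * exp L + exp L) * (real n * pmax * exp L) * B \<le> KQ * B"
      unfolding KQ_def using pmax_nonneg Qbound(1) B by (intro mult_right_mono mult_left_mono) auto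
    moreover have "\<bar>?c\<bar> = ?c" "\<bar>?c'\<bar> = ?c'" using Qbound(1) by auto
    ultimately show ?thesis by (simp add: algebra_simps)
  qed
  ultimately show "wb t\<^sub>0 (\<lambda>s. Qt w w' j (x, s)) h r (KQ * B)" by (rule wb_weaken[OF _ order_refl order_refl])
qed

text \<open>Each application of \<open>Q\<close> follows one more characteristic and therefore costs
  a factor \<open>exp L\<close> in window length and \<open>L\<close> in radius.\<close>

lemma Q_pow_WB:
  assumes w: "tcont w" and B: "B \<ge> 0"
    and WB: "WB t\<^sub>0 w (exp L ^ i * h) (r + real i * L) B"
  shows "tcont ((Q ^^ i) w) \<and> WB t\<^sub>0 ((Q ^^ i) w) h r (KQ ^ i * B)"
  using w WB
proof (induction i arbitrary: h r)
  case (Suc i)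
  have *: "tcont ((Q ^^ i) w)" "WB t\<^sub>0 ((Q ^^ i) w) (exp L * h) (r + L) (KQ ^ i * B)"
    using Suc.IH[of "exp L * h" "r + L"] Suc.prems by (simp_all add: algebra_simps)
  show ?case
    using tcont_Q[OF *(1)] WB_Q[OF *(1) _ *(2)] B KQ_nonneg by (simp add: mult_ac)
qed simp

lemma Q_pow_tC1:
  assumes w: "tC1 w w'" and B: "B \<ge> 0"
    and WB: "WB t\<^sub>0 w (exp L ^ i * h) (r + real i * L) B" "WB t\<^sub>0 w' (exp L ^ i * h) (r + real i * L) B"
  shows "\<exists>v'. tC1 ((Q ^^ i) w) v' \<and> WB t\<^sub>0 v' h r (KQ ^ i * B)"
  using w WB
proof (induction i arbitrary: h r)
  case 0
  thus ?case by auto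
next
  case (Suc i)
  obtain v' where v': "tC1 ((Q ^^ i) w) v'" "WB t\<^sub>0 v' (exp L * h) (r + L) (KQ ^ i * B)"
    using Suc.IH[of "exp L * h" "r + L"] Suc.prems by (auto simp: algebra_simps)
  have "WB t\<^sub>0 ((Q ^^ i) w) (exp L * h) (r + L) (KQ ^ i * B)"
    using Q_pow_WB[OF tC1_tcont[OF w] B, of t\<^sub>0 i "exp L * h" "r + L"] Suc.prems by (simp add: algebra_simps)
  hence "WB t\<^sub>0 (Qt ((Q ^^ i) w) v') h r (KQ * (KQ ^ i * B))"
    by (intro WB_Qt v') (use B KQ_nonneg in auto)
  thus ?case using tC1_Q[OF v'(1)] by (auto simp: mult_ac)
qed

end

section \<open>Time windows of averages along characteristics\<close>

lemma (in flow) prim_Psi_window: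
  assumes x: "x \<in> {0..1}" and h: "continuous_on strip h"
    and le: "\<And>\<xi>. \<xi> \<in> {0..1} \<Longrightarrow> integral {\<alpha>..\<beta>} (\<lambda>s. \<bar>h (Psi x (\<xi>, s))\<bar>) \<le> c \<xi>"
    and c: "continuous_on {0..1} c" and ab: "\<alpha> \<le> \<beta>"
  shows "integral {\<alpha>..\<beta>} (\<lambda>s. prim (\<lambda>z. \<bar>h (Psi x z)\<bar>) (1, s)) \<le> integral {0..1} c"
proof -
  have k: "continuous_on strip (\<lambda>z. \<bar>h (Psi x z)\<bar>)" by (intro continuous_on_rabs continuous_Psi x h)
  have "continuous_on (cbox (\<alpha>, 0) (\<beta>, 1)) (\<lambda>(s, \<xi>). \<bar>h (Psi x (\<xi>, s))\<bar>)"
    unfolding case_prod_unfold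
    by (rule continuous_on_strip_curve[OF k]) (auto intro!: continuous_intros simp: cbox_Pair_eq)
  \<comment> \<open>Fubini in the straightened coordinates: the window integral is now taken at
    fixed position \<open>\<xi>\<close> and averaged over \<open>\<xi>\<close> afterwards.\<close>
  from integral_swap_continuous[OF this]
  have "integral {\<alpha>..\<beta>} (\<lambda>s. prim (\<lambda>z. \<bar>h (Psi x z)\<bar>) (1, s)) =
      integral {0..1} (\<lambda>\<xi>. integral {\<alpha>..\<beta>} (\<lambda>s. \<bar>h (Psi x (\<xi>, s))\<bar>))"
    by (simp add: prim_def)
  also have "\<dots> \<le> integral {0..1} c"
  proof (rule integral_le)
    have "continuous_on {0..1} (\<lambda>\<xi>. integral (cbox \<alpha> \<beta>) (\<lambda>s. \<bar>h (Psi x (\<xi>, s))\<bar>))"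
      by (rule integral_continuous_on_param, unfold case_prod_unfold)
        (rule continuous_on_strip_curve[OF k], auto intro!: continuous_intros)
    thus "(\<lambda>\<xi>. integral {\<alpha>..\<beta>} (\<lambda>s. \<bar>h (Psi x (\<xi>, s))\<bar>)) integrable_on {0..1}"
      by (simp add: integrable_continuous_real)
  qed (use le c in \<open>auto intro: integrable_continuous_real\<close>)
  finally show ?thesis .
qed

lemma (in flow) continuous_prim_Psi:
  assumes x: "x \<in> {0..1}" and h: "continuous_on strip h"
  shows "continuous_on S (\<lambda>s. prim (\<lambda>z. \<bar>h (Psi x z)\<bar>) (1, s))"
  by (rule cont_slice_t[OF continuous_prim]) (auto intro!: continuous_on_rabs continuous_Psi x h)

lemma prim_abs_nonneg: "\<xi> \<in> {0..1} \<Longrightarrow> continuous_on strip k \<Longrightarrow> (\<And>z. k z \<ge> 0) \<Longrightarrow> prim k (\<xi>, s) \<ge> 0"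
  unfolding prim_def case_prod_conv
  by (rule integral_nonneg) (auto intro!: integrable_continuous_real continuous_on_subset[OF cont_slice])

lemma (in flow) wb_average:
  assumes x: "x \<in> {0..1}" and h: "continuous_on strip h"
    and wb: "\<And>\<xi>. \<xi> \<in> {0..1} \<Longrightarrow> wb t\<^sub>0 (\<lambda>s. h (\<xi>, s)) (exp L * d) (r + L) B"
  shows "wb t\<^sub>0 (\<lambda>s. prim (\<lambda>z. \<bar>h (Psi x z)\<bar>) (1, s)) d r (exp L * B)"
  unfolding wb_def
proof (intro allI impI)
  fix \<alpha> \<beta> assume ab: "t\<^sub>0 - r \<le> \<alpha>" "\<alpha> \<le> \<beta>" "\<beta> \<le> t\<^sub>0 + r" "\<beta> - \<alpha> \<le> d"
  have "integral {\<alpha>..\<beta>} (\<lambda>s. prim (\<lambda>z. \<bar>h (Psi x z)\<bar>) (1, s)) \<le> integral {0..1} (\<lambda>\<xi>::real. exp L * B)"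
  proof (rule prim_Psi_window[OF x h])
    fix \<xi> :: real assume \<xi>: "\<xi> \<in> {0..1}"
    have "wb t\<^sub>0 (\<lambda>s. h (\<xi>, omega a \<xi> x s)) d r (exp L * B)"
      by (rule wb_omega[OF x \<xi> _ wb[OF \<xi>]]) (rule cont_slice_t[OF h \<xi>])
    from wbD[OF this ab] show "integral {\<alpha>..\<beta>} (\<lambda>s. \<bar>h (Psi x (\<xi>, s))\<bar>) \<le> exp L * B"
      by (simp add: Psi_def)
  qed (use ab in auto)
  moreover have "\<bar>prim (\<lambda>z. \<bar>h (Psi x z)\<bar>) (1, s)\<bar> = prim (\<lambda>z. \<bar>h (Psi x z)\<bar>) (1, s)" for s
    by (intro abs_of_nonneg prim_abs_nonneg continuous_on_rabs continuous_Psi x h) auto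
  ultimately show "integral {\<alpha>..\<beta>} (\<lambda>s. \<bar>prim (\<lambda>z. \<bar>h (Psi x z)\<bar>) (1, s)\<bar>) \<le> exp L * B" by simp
qed

text \<open>Bounds on time slices become window bounds here. At fixed \<open>\<xi>\<close> the
  substitution replaces the characteristic by the vertical line, and exchanging the integrals again
  yields spatial integrals at fixed time. These are integrated over the whole enlarged interval of
  length \<open>2 * (r + L)\<close>, so the bound is the same for all window lengths
  \<open>d\<close>.\<close>

lemma (in flow) wb_average_L1:
  assumes x: "x \<in> {0..1}" and h: "continuous_on strip h" and r: "r \<ge> 0"
    and S: "\<And>s. t\<^sub>0 - (r + L) \<le> s \<Longrightarrow> s \<le> t\<^sub>0 + (r + L) \<Longrightarrow> prim (\<lambda>z. \<bar>h z\<bar>) (1, s) \<le> S"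
  shows "wb t\<^sub>0 (\<lambda>s. prim (\<lambda>z. \<bar>h (Psi x z)\<bar>) (1, s)) d r (exp L * (2 * (r + L) * S))"
  unfolding wb_def
proof (intro allI impI)
  fix \<alpha> \<beta> assume ab: "t\<^sub>0 - r \<le> \<alpha>" "\<alpha> \<le> \<beta>" "\<beta> \<le> t\<^sub>0 + r" "\<beta> - \<alpha> \<le> d"
  define lo hi where "lo = t\<^sub>0 - (r + L)" and "hi = t\<^sub>0 + (r + L)"
  have lohi: "lo \<le> hi" using r L_pos by (simp add: lo_def hi_def)
  have hc: "continuous_on strip (\<lambda>z. \<bar>h z\<bar>)" by (intro continuous_on_rabs h)
  have cont: "continuous_on (cbox (0, lo) (1, hi)) (\<lambda>(\<xi>, s). \<bar>h (\<xi>, s)\<bar>)"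
    unfolding case_prod_unfold
    by (rule continuous_on_strip_curve[OF hc]) (auto intro!: continuous_intros simp: cbox_Pair_eq)
  have "integral {\<alpha>..\<beta>} (\<lambda>s. prim (\<lambda>z. \<bar>h (Psi x z)\<bar>) (1, s)) \<le>
      integral {0..1} (\<lambda>\<xi>. exp L * integral {lo..hi} (\<lambda>s. \<bar>h (\<xi>, s)\<bar>))"
  proof (rule prim_Psi_window[OF x h])
    fix \<xi> :: real assume \<xi>: "\<xi> \<in> {0..1}"
    have c: "continuous_on A (\<lambda>s. \<bar>h (\<xi>, s)\<bar>)" for A by (rule cont_slice_t[OF hc \<xi>])
    have "integral {\<alpha>..\<beta>} (\<lambda>s. \<bar>h (\<xi>, omega a \<xi> x s)\<bar>) \<le>
        exp L * integral {omega a \<xi> x \<alpha>..omega a \<xi> x \<beta>} (\<lambda>s. \<bar>h (\<xi>, s)\<bar>)"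
      by (rule integral_omega_le[OF x \<xi> c]) (use ab in auto)
    also have "\<dots> \<le> exp L * integral {lo..hi} (\<lambda>s. \<bar>h (\<xi>, s)\<bar>)"
    proof (intro mult_left_mono integral_subset_le)
      show "{omega a \<xi> x \<alpha>..omega a \<xi> x \<beta>} \<subseteq> {lo..hi}"
        using omega_dist[OF x \<xi>, of \<alpha>] omega_dist[OF x \<xi>, of \<beta>] ab by (auto simp: lo_def hi_def abs_le_iff)
    qed (auto intro!: integrable_continuous_real c)
    finally show "integral {\<alpha>..\<beta>} (\<lambda>s. \<bar>h (Psi x (\<xi>, s))\<bar>) \<le> exp L * integral {lo..hi} (\<lambda>s. \<bar>h (\<xi>, s)\<bar>)"
      by (simp add: Psi_def)
  next
    have "continuous_on {0..1} (\<lambda>\<xi>. integral (cbox lo hi) (\<lambda>s. \<bar>h (\<xi>, s)\<bar>))"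
      by (rule integral_continuous_on_param, unfold case_prod_unfold)
        (rule continuous_on_strip_curve[OF hc], auto intro!: continuous_intros)
    thus "continuous_on {0..1} (\<lambda>\<xi>. exp L * integral {lo..hi} (\<lambda>s. \<bar>h (\<xi>, s)\<bar>))"
      by (intro continuous_on_mult_left) simp
  qed (use ab in auto)
  also have "\<dots> = exp L * integral {lo..hi} (\<lambda>s. prim (\<lambda>z. \<bar>h z\<bar>) (1, s))"
    using integral_swap_continuous[OF cont] by (simp add: prim_def)
  also have "\<dots> \<le> exp L * integral {lo..hi} (\<lambda>s. S)"
    by (intro mult_left_mono integral_le integrable_continuous_real cont_slice_t[OF continuous_prim[OF hc]])
      (use S in \<open>auto simp: lo_def hi_def\<close>)
  also have "\<dots> = exp L * (2 * (r + L) * S)"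
    using lohi by (simp add: lo_def hi_def)
  finally show "integral {\<alpha>..\<beta>} (\<lambda>s. \<bar>prim (\<lambda>z. \<bar>h (Psi x z)\<bar>) (1, s)\<bar>) \<le> exp L * (2 * (r + L) * S)"
    using prim_abs_nonneg[OF _ continuous_on_rabs[OF continuous_Psi[OF x h]]] by simp
qed

section \<open>From window bounds to pointwise bounds\<close>

text \<open>One-dimensional Sobolev embedding: \<open>f s\<close> differs from any other value in
  the interval by at most the integral of the derivative. Averaging over an interval of length at
  least 1 then costs no constant.\<close>

lemma sobolev_window:
  assumes d: "\<And>s. (f has_real_derivative f' s) (at s)" and f': "continuous_on UNIV f'"
    and A: "wb t\<^sub>0 f (2 * r) r A" and B: "wb t\<^sub>0 f' (2 * r) r B"
    and r: "2 * r \<ge> 1" and s: "\<bar>s - t\<^sub>0\<bar> \<le> r"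
  shows "\<bar>f s\<bar> \<le> A + B"
proof -
  have fc: "continuous_on S f" for S
    using d by (meson DERIV_continuous_on has_field_derivative_at_within)
  have AB: "0 \<le> A" "0 \<le> B"
    using wbD[OF A, of t\<^sub>0 t\<^sub>0] wbD[OF B, of t\<^sub>0 t\<^sub>0] r by auto
  have diff: "\<bar>f u - f v\<bar> \<le> B" if uv: "t\<^sub>0 - r \<le> v" "v \<le> u" "u \<le> t\<^sub>0 + r" for u v
  proof -
    have "(f' has_integral f u - f v) {v..u}"
      by (rule fundamental_theorem_of_calculus[OF uv(2)])
        (use d in \<open>auto simp: has_real_derivative_iff_has_vector_derivative intro: has_vector_derivative_at_within\<close>)
    hence "\<bar>f u - f v\<bar> = \<bar>integral {v..u} f'\<bar>" by (simp add: integral_unique)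
    also have "\<dots> \<le> integral {v..u} (\<lambda>s. \<bar>f' s\<bar>)"
      unfolding real_norm_def[symmetric]
      by (rule integral_norm_bound_integral)
        (auto intro!: integrable_continuous_real continuous_intros continuous_on_subset[OF f'])
    also have "\<dots> \<le> B" by (rule wbD[OF B]) (use uv in auto)
    finally show ?thesis .
  qed
  have "\<bar>f s\<bar> - B \<le> \<bar>f v\<bar>" if v: "v \<in> {t\<^sub>0 - r..t\<^sub>0 + r}" for v
  proof (cases "v \<le> s")
    case True
    hence "\<bar>f s - f v\<bar> \<le> B" using diff[of v s] v s by (auto simp: abs_le_iff)
    thus ?thesis using abs_triangle_ineq2[of "f s" "f v"] by linarith
  next
    case False
    hence "\<bar>f v - f s\<bar> \<le> B" using diff[of s v] v s by (auto simp: abs_le_iff)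
    thus ?thesis using abs_triangle_ineq3[of "f s" "f v"] by linarith
  qed
  hence "integral {t\<^sub>0 - r..t\<^sub>0 + r} (\<lambda>v. \<bar>f s\<bar> - B) \<le> integral {t\<^sub>0 - r..t\<^sub>0 + r} (\<lambda>v. \<bar>f v\<bar>)"
    by (intro integral_le abs_integrable_UNIV fc) auto
  also have "\<dots> \<le> A" by (rule wbD[OF A]) (use r in auto)
  finally have *: "(2 * r) * (\<bar>f s\<bar> - B) \<le> A" using r by simp
  show ?thesis
  proof (cases "\<bar>f s\<bar> - B \<le> 0")
    case False
    hence "1 * (\<bar>f s\<bar> - B) \<le> (2 * r) * (\<bar>f s\<bar> - B)" using r by (intro mult_right_mono) auto
    from order_trans[OF this *] show ?thesis by simp
  qed (use AB in linarith)
qed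

text \<open>The passage to vanishing window length. If the value exceeded \<open>C\<close>,
  continuity would keep the function above some \<open>c > C\<close> on a short window, against the
  linear bound.\<close>

lemma abs_le_of_windows:
  assumes g: "continuous_on UNIV (g :: real \<Rightarrow> real)"
    and le: "\<And>h. 0 < h \<Longrightarrow> h \<le> 1 \<Longrightarrow> integral {t\<^sub>0..t\<^sub>0 + h} (\<lambda>s. \<bar>g s\<bar>) \<le> C * h"
  shows "\<bar>g t\<^sub>0\<bar> \<le> C"
proof (rule ccontr)
  assume "\<not> \<bar>g t\<^sub>0\<bar> \<le> C"
  define c where "c = (C + \<bar>g t\<^sub>0\<bar>) / 2"
  have c: "C < c" "c < \<bar>g t\<^sub>0\<bar>" using \<open>\<not> _\<close> by (auto simp: c_def)
  have "isCont (\<lambda>s. \<bar>g s\<bar>) t\<^sub>0"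
    using g by (intro continuous_intros) (simp add: continuous_on_eq_continuous_at)
  hence "eventually (\<lambda>s. c < \<bar>g s\<bar>) (at t\<^sub>0)"
    using c(2) by (intro order_tendstoD) (auto simp: continuous_at)
  then obtain e where e: "e > 0" "\<And>s. dist s t\<^sub>0 < e \<Longrightarrow> c < \<bar>g s\<bar>"
    using c(2) unfolding eventually_at by (metis UNIV_I)
  define h where "h = min 1 (e / 2)"
  have h: "0 < h" "h \<le> 1" "h < e" using e(1) by (auto simp: h_def)
  have "c * h = integral {t\<^sub>0..t\<^sub>0 + h} (\<lambda>s. c)" using h by simp
  also have "\<dots> \<le> integral {t\<^sub>0..t\<^sub>0 + h} (\<lambda>s. \<bar>g s\<bar>)"
    by (intro integral_le abs_integrable_UNIV g) (use e(2) h in \<open>auto simp: dist_real_def intro!: less_imp_le\<close>)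
  also have "\<dots> \<le> C * h" by (rule le[OF h(1,2)])
  finally show False using c h by simp
qed

section \<open>A priori estimates for solutions\<close>

context hyperbolic
begin

text \<open>
  Solutions are extended to all times as \<open>C\<^sup>1\<close> functions; the system holds only from \<open>\<tau>\<close> on.
\<close>
definition sol :: "real \<Rightarrow> vfield \<Rightarrow> vfield \<Rightarrow> vfield \<Rightarrow> bool"
  where "sol \<tau> u ux ut \<longleftrightarrow> (\<forall>j\<in>{1..n}. C1_strip (u j) (ux j) (ut j) \<and>
    (\<forall>x\<in>{0..1}. \<forall>t\<ge>\<tau>. ut j (x, t) + a j (x, t) * ux j (x, t) + (\<Sum>k=1..n. b j k (x, t) * u k (x, t)) = 0) \<and>
    (\<forall>t\<ge>\<tau>. u j (bpt m j, t) = Pop m n p u j t))"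

lemma solD:
  assumes "sol \<tau> u ux ut" "j \<in> {1..n}"
  shows "C1_strip (u j) (ux j) (ut j)"
    "x \<in> {0..1} \<Longrightarrow> t \<ge> \<tau> \<Longrightarrow>
      ut j (x, t) + a j (x, t) * ux j (x, t) + (\<Sum>k=1..n. b j k (x, t) * u k (x, t)) = 0"
    "t \<ge> \<tau> \<Longrightarrow> u j (bpt m j, t) = Pop m n p u j t"
  using assms by (auto simp: sol_def)

lemma sol_tC1: "sol \<tau> u ux ut \<Longrightarrow> tC1 u ut"
  unfolding tC1_def tcont_def
  using solD(1) by (auto simp: C1_strip_def intro!: cont_slice_t)

abbreviation coupling_term :: "nat \<Rightarrow> nat \<Rightarrow> real \<Rightarrow> (real \<times> real \<Rightarrow> real) \<Rightarrow> real \<times> real \<Rightarrow> real"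
  where "coupling_term j k x h \<equiv> (\<lambda>z. flow.wexp (a j) x (qd j) z * (b j k (flow.Psi (a j) x z) / a j (flow.Psi (a j) x z)) *
    h (flow.Psi (a j) x z))"

text \<open>
  \<open>jump j k x (u k)\<close> is the contribution of \<open>u\<^sub>k\<close> to \<open>(CPu - u)\<^sub>j\<close>, and \<open>load\<close> bounds its \<open>t\<close>-derivative.
\<close>
definition jump :: "nat \<Rightarrow> nat \<Rightarrow> real \<Rightarrow> (real \<times> real \<Rightarrow> real) \<Rightarrow> real \<Rightarrow> real"
  where "jump j k x h s = prim (coupling_term j k x h) (x, s) - prim (coupling_term j k x h) (bpt m j, s)"

definition load :: "nat \<Rightarrow> nat \<Rightarrow> real \<Rightarrow> (real \<times> real \<Rightarrow> real) \<Rightarrow> (real \<times> real \<Rightarrow> real) \<Rightarrow>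
    (real \<times> real \<Rightarrow> real) \<Rightarrow> real \<Rightarrow> real"
  where "load j k x h hx ht s = (let P = flow.Psi (a j) x in \<bar>h (x, s)\<bar> + \<bar>h (P (bpt m j, s))\<bar> +
    integral {0..1} (\<lambda>\<xi>. \<bar>h (P (\<xi>, s))\<bar> + \<bar>ht (P (\<xi>, s)) + a k (P (\<xi>, s)) * hx (P (\<xi>, s))\<bar>))"

text \<open>If \<open>f\<close> is not integrable, its integral is 0 by convention, and the
  inequality holds in that case as well.\<close>

lemma integral_nonneg_of_nonneg: "(\<And>\<xi>. f \<xi> \<ge> 0) \<Longrightarrow> integral {0..1} f \<ge> 0"
  for f :: "real \<Rightarrow> real"
  using integral_nonneg[of f "{0..1}"] not_integrable_integral[of f "{0..1}"] by force

lemma load_nonneg: "load j k x h hx ht s \<ge> 0"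
  unfolding load_def Let_def by (intro add_nonneg_nonneg integral_nonneg_of_nonneg) auto

lemma continuous_coupling_term:
  assumes j: "j \<in> {1..n}" and k: "k \<in> {1..n}" and x: "x \<in> {0..1}" and h: "continuous_on strip h"
  shows "continuous_on strip (coupling_term j k x h)"
proof -
  interpret flow "a j" "fx j" "ft j" L by (rule fl[OF j])
  obtain cx ct where "BC1_strip (\<lambda>z. b j k z / a j z) cx ct" using coef_BC[OF j k] by blast
  hence "continuous_on strip (\<lambda>z. b j k z / a j z)" by (simp add: BC1_strip_def C1_strip_def)
  from continuous_Psi[OF x this] show ?thesis
    by (intro continuous_on_mult continuous_wexp[OF x qd_props(1)[OF j]] continuous_Psi[OF x h])
qed

text \<open>Along a characteristic, the equation for \<open>u_j\<close> divided by
  \<open>a_j\<close> and multiplied by the integrating factor says that \<open>g\<close> has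
  derivative 0. Comparing \<open>g\<close> at \<open>x\<close> and at the inflow end gives the
  formula. The delay \<open>L\<close> guarantees that the whole characteristic lies after the
  initial time, where the system holds.\<close>

lemma representation:
  assumes u: "sol \<tau> u ux ut" and j: "j \<in> {1..n}" and x: "x \<in> {0..1}" and s: "s \<ge> \<tau> + L"
  shows "u j (x, s) - Q u j (x, s) =
    - (\<Sum>k\<in>{1..n}-{j}. jump j k x (u k) s)"
proof -
  interpret flow "a j" "fx j" "ft j" L by (rule fl[OF j])
  let ?e = "\<lambda>\<xi>. wexp x (qd j) (\<xi>, s)" and ?\<Psi> = "\<lambda>\<xi>. Psi x (\<xi>, s)" and ?y = "bpt m j"
  have late: "omega (a j) \<xi> x s \<ge> \<tau>" if "\<xi> \<in> {0..1}" for \<xi>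
    using omega_dist[OF x that, of s] s by (simp add: abs_le_iff)
  define g where "g = (\<lambda>\<xi>. ?e \<xi> * u j (?\<Psi> \<xi>) + (\<Sum>k\<in>{1..n}-{j}. prim (coupling_term j k x (u k)) (\<xi>, s)))"
  have "g x = g ?y"
  proof (rule has_dx_zero_const[OF _ x y01(1)])
    fix \<xi> :: real assume \<xi>: "\<xi> \<in> {0..1}"
    have "(g has_real_derivative ((qd j (?\<Psi> \<xi>) * ?e \<xi>) * u j (?\<Psi> \<xi>) +
        (ux j (?\<Psi> \<xi>) + ut j (?\<Psi> \<xi>) * (1 / a j (?\<Psi> \<xi>))) * ?e \<xi>)
        + (\<Sum>k\<in>{1..n}-{j}. coupling_term j k x (u k) (\<xi>, s))) (at \<xi> within {0..1})"
      unfolding g_def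
      by (intro DERIV_add DERIV_mult DERIV_sum has_dxD[OF has_dx_wexp[OF x qd_props(1)[OF j]] \<xi>]
          has_dxD[OF has_dx_Psi[OF x solD(1)[OF u j]] \<xi>] has_dxD[OF has_dx_prim \<xi>] continuous_coupling_term j x
          C1_stripD(1)[OF solD(1)[OF u]]) auto
    moreover have "((qd j (?\<Psi> \<xi>) * ?e \<xi>) * u j (?\<Psi> \<xi>) +
        (ux j (?\<Psi> \<xi>) + ut j (?\<Psi> \<xi>) * (1 / a j (?\<Psi> \<xi>))) * ?e \<xi>)
        + (\<Sum>k\<in>{1..n}-{j}. coupling_term j k x (u k) (\<xi>, s)) = 0"
    proof -
      have Pin: "?\<Psi> \<xi> \<in> strip" using \<xi> by simp
      have nz: "a j (?\<Psi> \<xi>) \<noteq> 0" using a_abs[OF j Pin] \<mu> by auto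
      have pde: "ut j (?\<Psi> \<xi>) + a j (?\<Psi> \<xi>) * ux j (?\<Psi> \<xi>) + (\<Sum>k=1..n. b j k (?\<Psi> \<xi>) * u k (?\<Psi> \<xi>)) = 0"
        unfolding Psi_def using solD(2)[OF u j \<xi> late[OF \<xi>]] by simp
      have "(\<Sum>k=1..n. b j k (?\<Psi> \<xi>) * u k (?\<Psi> \<xi>)) =
          b j j (?\<Psi> \<xi>) * u j (?\<Psi> \<xi>) + (\<Sum>k\<in>{1..n}-{j}. b j k (?\<Psi> \<xi>) * u k (?\<Psi> \<xi>))"
        using j by (simp add: sum.remove)
      with pde have pde': "(\<Sum>k\<in>{1..n}-{j}. b j k (?\<Psi> \<xi>) * u k (?\<Psi> \<xi>)) =
          - (ut j (?\<Psi> \<xi>) + a j (?\<Psi> \<xi>) * ux j (?\<Psi> \<xi>) + b j j (?\<Psi> \<xi>) * u j (?\<Psi> \<xi>))" by linarith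
      have "(\<Sum>k\<in>{1..n}-{j}. coupling_term j k x (u k) (\<xi>, s)) =
          ?e \<xi> / a j (?\<Psi> \<xi>) * (\<Sum>k\<in>{1..n}-{j}. b j k (?\<Psi> \<xi>) * u k (?\<Psi> \<xi>))"
        unfolding sum_distrib_left by (intro sum.cong refl) simp
      also have "\<dots> = - (((qd j (?\<Psi> \<xi>) * ?e \<xi>) * u j (?\<Psi> \<xi>) +
        (ux j (?\<Psi> \<xi>) + ut j (?\<Psi> \<xi>) * (1 / a j (?\<Psi> \<xi>))) * ?e \<xi>))"
      proof -
        have alg: "e / A * - (t + A * y + B * v) = - ((B / A * e) * v + (y + t * (1 / A)) * e)"
          if "A \<noteq> 0" for e A t y B v :: real
          using that by (simp add: field_simps)
        show ?thesis unfolding pde' qd_def by (rule alg[OF nz])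
      qed
      finally show ?thesis by linarith
    qed
    ultimately show "(g has_real_derivative 0) (at \<xi> within {0..1})" by (rule DERIV_cong)
  qed
  moreover have "g x = u j (x, s) + (\<Sum>k\<in>{1..n}-{j}. prim (coupling_term j k x (u k)) (x, s))"
    by (simp add: g_def wexp_self Psi_self[OF x])
  \<comment> \<open>At the inflow end the boundary condition replaces the trace of
    \<open>u_j\<close> by \<open>P u\<close>, and together with the integrating factor this is
    \<open>Q u\<close>.\<close>
  moreover have "g ?y = Q u j (x, s) + (\<Sum>k\<in>{1..n}-{j}. prim (coupling_term j k x (u k)) (?y, s))"
    unfolding g_def Q_eq[OF j x]
    using solD(3)[OF u j late[OF y01(1)]] by (simp add: Psi_def)
  ultimately show ?thesis by (simp add: sum_subtractf jump_def)
qed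

text \<open>There are finitely many pairs, and the sum of their nonnegative constants dominates each
  of them.\<close>

lemma uniform_pair_const:
  assumes P: "\<And>j k. j \<in> {1..n} \<Longrightarrow> k \<in> {1..n} - {j} \<Longrightarrow> \<exists>K\<ge>0::real. P j k K"
    and mono: "\<And>j k K K'. P j k K \<Longrightarrow> K \<le> K' \<Longrightarrow> P j k K'"
  shows "\<exists>K\<ge>0. \<forall>j\<in>{1..n}. \<forall>k\<in>{1..n}-{j}. P j k K"
proof -
  obtain K where K: "\<And>j k. j \<in> {1..n} \<Longrightarrow> k \<in> {1..n} - {j} \<Longrightarrow> K j k \<ge> 0 \<and> P j k (K j k)"
    using P by metis
  have le: "K j k \<le> (\<Sum>j=1..n. \<Sum>k\<in>{1..n}-{j}. K j k)" if "j \<in> {1..n}" "k \<in> {1..n} - {j}" for j k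
  proof -
    have "K j k \<le> (\<Sum>k\<in>{1..n}-{j}. K j k)"
      by (rule member_le_sum) (use that K in auto)
    also have "\<dots> \<le> (\<Sum>j=1..n. \<Sum>k\<in>{1..n}-{j}. K j k)"
      by (rule member_le_sum[of j "{1..n}" "\<lambda>j. \<Sum>k\<in>{1..n}-{j}. K j k"])
        (use that K in \<open>fastforce intro!: sum_nonneg\<close>)+
    finally show ?thesis .
  qed
  show ?thesis
  proof (rule exI[of _ "\<Sum>j=1..n. \<Sum>k\<in>{1..n}-{j}. K j k"], intro conjI ballI)
    show "0 \<le> (\<Sum>j=1..n. \<Sum>k\<in>{1..n}-{j}. K j k)"
      using K by (intro sum_nonneg) blast
    fix j k assume "j \<in> {1..n}" "k \<in> {1..n} - {j}"
    thus "P j k (\<Sum>j=1..n. \<Sum>k\<in>{1..n}-{j}. K j k)"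
      using K mono le by blast
  qed
qed

lemma coupling_const_t:
  "\<exists>K\<ge>0. \<forall>j\<in>{1..n}. \<forall>k\<in>{1..n}-{j}. \<forall>h hx ht x s. C1_strip h hx ht \<longrightarrow> x \<in> {0..1} \<longrightarrow>
    (\<exists>D. (jump j k x h has_real_derivative D) (at s) \<and> \<bar>D\<bar> \<le> K * load j k x h hx ht s)"
proof (rule uniform_pair_const)
  fix j k assume j: "j \<in> {1..n}" and k': "k \<in> {1..n} - {j}"
  hence k: "k \<in> {1..n}" "j \<noteq> k" by auto
  interpret flow "a j" "fx j" "ft j" L by (rule fl[OF j])
  obtain cx ct where c: "BC1_strip (\<lambda>z. b j k z / a j z) cx ct" using coef_BC[OF j k(1)] by blast
  note c' = c[unfolded BC1_strip_def C1_strip_def]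
  \<comment> \<open>The structural assumption on \<open>b_jk\<close> acts here: dividing by
    \<open>a_j\<close> exposes the difference of slopes required for the gain of a derivative, with
    \<open>\<gamma> = \<beta>_jk a_k\<close>.\<close>
  have eq: "b j k z / a j z = (\<beta> j k z * a k z) * (1 / a j z - 1 / a k z)" if z: "z \<in> strip" for z
  proof -
    have "a j z \<noteq> 0" "a k z \<noteq> 0" using a_abs[OF j z] a_abs[OF k(1) z] \<mu> by auto
    thus ?thesis unfolding b_eq[OF j k z] by (simp add: field_simps)
  qed
  show "\<exists>K\<ge>0. \<forall>h hx ht x s. C1_strip h hx ht \<longrightarrow> x \<in> {0..1} \<longrightarrow>
    (\<exists>D. (jump j k x h has_real_derivative D) (at s) \<and> \<bar>D\<bar> \<le> K * load j k x h hx ht s)"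
    using coupling_gains_derivative[OF qd_props[OF j] BC1_strip_mult[OF \<beta>BC[OF j k] aBC[OF k(1)]] _ \<mu> a_abs[OF k(1)]
        _ _ _ _ _ eq, of ct] c' aBC[OF k(1)] y01(1)
    unfolding BC1_strip_def C1_strip_def jump_def[abs_def] load_def Let_def by blast
next
  fix j k K K'
  assume *: "\<forall>h hx ht x s. C1_strip h hx ht \<longrightarrow> x \<in> {0..1} \<longrightarrow>
    (\<exists>D. (jump j k x h has_real_derivative D) (at s) \<and> \<bar>D\<bar> \<le> K * load j k x h hx ht s)" and K: "K \<le> (K'::real)"
  show "\<forall>h hx ht x s. C1_strip h hx ht \<longrightarrow> x \<in> {0..1} \<longrightarrow>
    (\<exists>D. (jump j k x h has_real_derivative D) (at s) \<and> \<bar>D\<bar> \<le> K' * load j k x h hx ht s)"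
    using * mult_right_mono[OF K load_nonneg] order_trans by blast
qed

lemma coupling_const:
  "\<exists>K\<ge>0. \<forall>j\<in>{1..n}. \<forall>k\<in>{1..n}-{j}. \<forall>h x s. continuous_on strip h \<longrightarrow> x \<in> {0..1} \<longrightarrow>
    \<bar>jump j k x h s\<bar> \<le> K * prim (\<lambda>z. \<bar>h (flow.Psi (a j) x z)\<bar>) (1, s)"
proof (rule uniform_pair_const)
  fix j k assume j: "j \<in> {1..n}" and k': "k \<in> {1..n} - {j}"
  interpret flow "a j" "fx j" "ft j" L by (rule fl[OF j])
  obtain cx ct where c: "BC1_strip (\<lambda>z. b j k z / a j z) cx ct" using coef_BC[OF j, of k] k' by blast
  note c' = c[unfolded BC1_strip_def C1_strip_def]
  show "\<exists>K\<ge>0. \<forall>h x s. continuous_on strip h \<longrightarrow> x \<in> {0..1} \<longrightarrow>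
    \<bar>jump j k x h s\<bar> \<le> K * prim (\<lambda>z. \<bar>h (flow.Psi (a j) x z)\<bar>) (1, s)"
    using coupling_bound[OF qd_props(1,4)[OF j], of "\<lambda>z. b j k z / a j z"] c' y01(1)[of j]
    unfolding jump_def prim_def case_prod_conv by blast
next
  fix j k K K'
  assume *: "\<forall>h x s. continuous_on strip h \<longrightarrow> x \<in> {0..1} \<longrightarrow>
    \<bar>jump j k x h s\<bar> \<le> K * prim (\<lambda>z. \<bar>h (flow.Psi (a j) x z)\<bar>) (1, s)" and K: "K \<le> (K'::real)"
  have R: "K * prim (\<lambda>z. \<bar>h (flow.Psi (a j) x z)\<bar>) (1, s) \<le> K' * prim (\<lambda>z. \<bar>h (flow.Psi (a j) x z)\<bar>) (1, s)"
    for h :: "real \<times> real \<Rightarrow> real" and x s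
    using integral_nonneg_of_nonneg by (intro mult_right_mono[OF K]) (auto simp: prim_def)
  show "\<forall>h x s. continuous_on strip h \<longrightarrow> x \<in> {0..1} \<longrightarrow>
    \<bar>jump j k x h s\<bar> \<le> K' * prim (\<lambda>z. \<bar>h (flow.Psi (a j) x z)\<bar>) (1, s)"
    using * R order_trans by blast
qed

end

section \<open>Window estimates for solutions and their time derivatives\<close>

context hyperbolic
begin

lemma b_bound: "\<exists>B\<ge>0. \<forall>j\<in>{1..n}. \<forall>k\<in>{1..n}. \<forall>z\<in>strip. \<bar>b j k z\<bar> \<le> B"
proof -
  have "\<exists>B>0. \<forall>z\<in>strip. \<bar>b j k z\<bar> \<le> B" if "j \<in> {1..n}" "k \<in> {1..n}" for j k
    using bBC[OF that] unfolding BC1_strip_def by (metis bounded_stripE)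
  then obtain B where B: "\<And>j k. j \<in> {1..n} \<Longrightarrow> k \<in> {1..n} \<Longrightarrow> B j k > 0 \<and> (\<forall>z\<in>strip. \<bar>b j k z\<bar> \<le> B j k)"
    by metis
  have le: "B j k \<le> (\<Sum>j=1..n. \<Sum>k=1..n. B j k)" if jk: "j \<in> {1..n}" "k \<in> {1..n}" for j k
  proof -
    have pos: "B j k \<ge> 0" if "j \<in> {1..n}" "k \<in> {1..n}" for j k using B[OF that] by auto
    have "B j k \<le> (\<Sum>k=1..n. B j k)" by (rule member_le_sum) (use jk pos in auto)
    also have "\<dots> \<le> (\<Sum>j=1..n. \<Sum>k=1..n. B j k)"
      by (rule member_le_sum[of j "{1..n}" "\<lambda>j. \<Sum>k=1..n. B j k"]) (use jk pos in \<open>auto intro!: sum_nonneg\<close>)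
    finally show ?thesis .
  qed
  show ?thesis
  proof (rule exI[of _ "\<Sum>j=1..n. \<Sum>k=1..n. B j k"], intro conjI ballI)
    show "0 \<le> (\<Sum>j=1..n. \<Sum>k=1..n. B j k)"
      by (intro sum_nonneg) (use B in \<open>auto intro: less_imp_le\<close>)
    fix j k z assume jk: "j \<in> {1..n}" "k \<in> {1..n}" and z: "z \<in> strip"
    have "\<bar>b j k z\<bar> \<le> B j k" using B[OF jk] z by blast
    thus "\<bar>b j k z\<bar> \<le> (\<Sum>j=1..n. \<Sum>k=1..n. B j k)" using le[OF jk] by linarith
  qed
qed

lemma sol_cont: "sol \<tau> u ux ut \<Longrightarrow> j \<in> {1..n} \<Longrightarrow> continuous_on strip (u j)"
  using solD(1) by (simp add: C1_strip_def)

text \<open>Differentiating the representation brings in \<open>load\<close>, which holds values of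
  \<open>u\<close> and the transport expression of \<open>u_k\<close>. The system turns the latter
  into \<open>- \<Sum> b_kl u_l\<close>, so only values of \<open>u\<close> are left: at the point,
  at the inflow end of the characteristic, and averaged along it.\<close>

lemma residual_t_bound:
  "\<exists>c\<ge>0. \<forall>\<tau> u ux ut t\<^sub>0 r h B. sol \<tau> u ux ut \<longrightarrow> \<tau> + L < t\<^sub>0 - r \<longrightarrow> 0 \<le> h \<longrightarrow> 0 \<le> B \<longrightarrow>
    WB t\<^sub>0 u (exp L * h) (r + L) B \<longrightarrow> WB t\<^sub>0 (\<lambda>j z. ut j z - Qt u ut j z) h r (c * B)"
proof -
  obtain K where K0: "K \<ge> 0" and K: "\<And>j k h hx ht x s. j \<in> {1..n} \<Longrightarrow> k \<in> {1..n}-{j} \<Longrightarrow> C1_strip h hx ht \<Longrightarrow> x \<in> {0..1} \<Longrightarrow>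
    \<exists>D. (jump j k x h has_real_derivative D) (at s) \<and> \<bar>D\<bar> \<le> K * load j k x h hx ht s"
    using coupling_const_t by blast
  obtain Bb where Bb0: "Bb \<ge> 0" and Bb: "\<And>j k z. j \<in> {1..n} \<Longrightarrow> k \<in> {1..n} \<Longrightarrow> z \<in> strip \<Longrightarrow> \<bar>b j k z\<bar> \<le> Bb"
    using b_bound by blast
  define c0 where "c0 = K * (1 + real n * Bb)"
  have c0: "c0 \<ge> 0" using K0 Bb0 by (simp add: c0_def)
  show ?thesis
  proof (rule exI[of _ "c0 * (real n * (1 + exp L + exp L))"], intro conjI allI impI)
    show "0 \<le> c0 * (real n * (1 + exp L + exp L))" using c0 by auto
    fix \<tau> u ux ut t\<^sub>0 r h B
    assume u: "sol \<tau> u ux ut" and late: "\<tau> + L < t\<^sub>0 - r" and h: "0 \<le> h" and B: "0 \<le> B"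
      and WB: "WB t\<^sub>0 u (exp L * h) (r + L) B"
    note uC = sol_tC1[OF u]
    show "WB t\<^sub>0 (\<lambda>j z. ut j z - Qt u ut j z) h r (c0 * (real n * (1 + exp L + exp L)) * B)"
      unfolding WB_def
    proof (intro ballI)
      fix j x assume j: "j \<in> {1..n}" and x: "x \<in> {0..1::real}"
      interpret flow "a j" "fx j" "ft j" L by (rule fl[OF j])
      let ?y = "bpt m j"
      \<comment> \<open>The three summands are estimated separately and produce the terms 1,
        \<open>exp L\<close> and \<open>exp L\<close> of the final constant. Summing over the
        coupled components yields \<open>c0\<close>.\<close>
      define A where "A = (\<lambda>l s. \<bar>u l (x, s)\<bar> + \<bar>u l (Psi x (?y, s))\<bar> + prim (\<lambda>z. \<bar>u l (Psi x z)\<bar>) (1, s))"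
      note uc = sol_cont[OF u]
      have uPc: "continuous_on strip (\<lambda>z. u l (Psi x z))" if "l \<in> {1..n}" for l
        by (rule continuous_Psi[OF x uc[OF that]])
      have Ac1: "continuous_on UNIV (\<lambda>s. \<bar>u l (x, s)\<bar>)" "continuous_on UNIV (\<lambda>s. \<bar>u l (Psi x (?y, s))\<bar>)"
        "continuous_on UNIV (\<lambda>s. prim (\<lambda>z. \<bar>u l (Psi x z)\<bar>) (1, s))" if l: "l \<in> {1..n}" for l
        by (intro continuous_on_rabs cont_slice_t[OF uc[OF l] x] cont_slice_t[OF uPc[OF l] y01(1)]
            continuous_prim_Psi[OF x uc[OF l]])+
      have Ac: "continuous_on UNIV (A l)" if "l \<in> {1..n}" for l
        unfolding A_def by (intro continuous_on_add Ac1 that)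
      have I0: "prim (\<lambda>z. \<bar>u l (Psi x z)\<bar>) (1, s) \<ge> 0" if "l \<in> {1..n}" for l s
        by (rule prim_abs_nonneg) (auto intro!: continuous_on_rabs uPc that)
      have A0: "A l s \<ge> 0" if "l \<in> {1..n}" for l s unfolding A_def using I0[OF that, of s] by simp
      have AW: "wb t\<^sub>0 (A l) h r (B + exp L * B + exp L * B)" if l: "l \<in> {1..n}" for l
        unfolding A_def
      proof (intro wb_add wb_abs[THEN iffD2] Ac1[OF l] continuous_on_add)
        have "exp L * h \<ge> h" using L_pos h by (simp add: mult_le_cancel_right1)
        thus "wb t\<^sub>0 (\<lambda>s. u l (x, s)) h r B"
          using wb_weaken[of t\<^sub>0 "\<lambda>s. u l (x, s)" "exp L * h" "r + L" B h r B] WB l x L_pos by (auto simp: WB_def)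
        show "wb t\<^sub>0 (\<lambda>s. u l (Psi x (?y, s))) h r (exp L * B)"
          unfolding Psi_def fst_conv snd_conv
          by (rule wb_omega[OF x y01(1) cont_slice_t[OF uc[OF l] y01(1)]]) (use WB l y01 in \<open>auto simp: WB_def\<close>)
        show "wb t\<^sub>0 (\<lambda>s. prim (\<lambda>z. \<bar>u l (Psi x z)\<bar>) (1, s)) h r (exp L * B)"
          by (rule wb_average[OF x uc[OF l]]) (use WB l in \<open>auto simp: WB_def\<close>)
      qed
      have "wb t\<^sub>0 (\<lambda>s. ut j (x, s) - Qt u ut j (x, s)) h r (\<bar>c0\<bar> * (\<Sum>l=1..n. B + exp L * B + exp L * B))"
      proof (rule wb_dominated[OF wb_cmult[OF wb_sum[OF _ AW Ac]]])
        fix s assume s: "t\<^sub>0 - r \<le> s" "s \<le> t\<^sub>0 + r"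
        have "\<exists>D. \<forall>k\<in>{1..n}-{j}. (jump j k x (u k) has_real_derivative D k) (at s) \<and>
            \<bar>D k\<bar> \<le> K * load j k x (u k) (ux k) (ut k) s"
          by (rule bchoice) (use K[OF j _ solD(1)[OF u] x] in blast)
        then obtain D where D: "\<And>k. k \<in> {1..n}-{j} \<Longrightarrow> (jump j k x (u k) has_real_derivative D k) (at s)"
            "\<And>k. k \<in> {1..n}-{j} \<Longrightarrow> \<bar>D k\<bar> \<le> K * load j k x (u k) (ux k) (ut k) s"
          by blast
        have d1: "((\<lambda>s. u j (x, s) - Q u j (x, s)) has_real_derivative ut j (x, s) - Qt u ut j (x, s)) (at s)"
          using uC j has_dt_Q[OF j uC] x by (intro DERIV_diff has_dtD[of "u j"] has_dtD[of "Q u j"]) (auto simp: tC1_def)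
        have d2: "((\<lambda>s. - (\<Sum>k\<in>{1..n}-{j}. jump j k x (u k) s))
            has_real_derivative - (\<Sum>k\<in>{1..n}-{j}. D k)) (at s)"
          by (intro DERIV_minus DERIV_sum D)
        \<comment> \<open>The representation is available only from \<open>\<tau> + L\<close> on;
          the strict inequality in the assumption supplies the neighbourhood of \<open>s\<close> on
          which both sides may be differentiated.\<close>
        have "((\<lambda>s. u j (x, s) - Q u j (x, s)) has_real_derivative - (\<Sum>k\<in>{1..n}-{j}. D k)) (at s)"
          by (rule has_field_derivative_transform_within_open[OF d2, of "{\<tau> + L<..}"])
            (use s late representation[OF u j x] in auto)
        from DERIV_unique[OF d1 this] have eq: "ut j (x, s) - Qt u ut j (x, s) = - (\<Sum>k\<in>{1..n}-{j}. D k)" .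
        have Dle: "\<bar>D k\<bar> \<le> K * (A k s + Bb * (\<Sum>l=1..n. A l s))" if k': "k \<in> {1..n}-{j}" for k
        proof -
          have k: "k \<in> {1..n}" using k' by auto
          \<comment> \<open>Every point of the characteristic lies after \<open>\<tau>\<close>, so
            the system expresses the transport operator of \<open>u_k\<close> through
            undifferentiated components.\<close>
          have g: "\<bar>ut k (Psi x (\<xi>, s)) + a k (Psi x (\<xi>, s)) * ux k (Psi x (\<xi>, s))\<bar> \<le>
              Bb * (\<Sum>l=1..n. \<bar>u l (Psi x (\<xi>, s))\<bar>)" if \<xi>: "\<xi> \<in> {0..1}" for \<xi>
          proof -
            have "omega (a j) \<xi> x s \<ge> \<tau>" using omega_dist[OF x \<xi>, of s] s late by (simp add: abs_le_iff)
            from solD(2)[OF u k \<xi> this] have "ut k (Psi x (\<xi>, s)) + a k (Psi x (\<xi>, s)) * ux k (Psi x (\<xi>, s))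
               = - (\<Sum>l=1..n. b k l (Psi x (\<xi>, s)) * u l (Psi x (\<xi>, s)))" by (simp add: Psi_def)
            hence "\<bar>ut k (Psi x (\<xi>, s)) + a k (Psi x (\<xi>, s)) * ux k (Psi x (\<xi>, s))\<bar> \<le>
               (\<Sum>l=1..n. \<bar>b k l (Psi x (\<xi>, s)) * u l (Psi x (\<xi>, s))\<bar>)" using sum_abs by simp
            also have "\<dots> \<le> (\<Sum>l=1..n. Bb * \<bar>u l (Psi x (\<xi>, s))\<bar>)"
              unfolding abs_mult using \<xi> by (intro sum_mono mult_right_mono Bb[OF k]) auto
            finally show ?thesis by (simp add: sum_distrib_left)
          qed
          have ci: "continuous_on {0..1} (\<lambda>\<xi>. \<bar>u l (Psi x (\<xi>, s))\<bar>)" if "l \<in> {1..n}" for l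
            by (intro continuous_on_rabs cont_slice[OF uPc[OF that]])
          have kC: "continuous_on strip (\<lambda>z. ut k (Psi x z) + a k (Psi x z) * ux k (Psi x z))"
            using solD(1)[OF u k] aBC[OF k]
            by (intro continuous_on_add continuous_on_mult continuous_Psi[OF x, of "ut k"] continuous_Psi[OF x, of "a k"]
                continuous_Psi[OF x, of "ux k"]) (auto simp: C1_strip_def BC1_strip_def)
          have "integral {0..1} (\<lambda>\<xi>. \<bar>u k (Psi x (\<xi>, s))\<bar> + \<bar>ut k (Psi x (\<xi>, s)) + a k (Psi x (\<xi>, s)) * ux k (Psi x (\<xi>, s))\<bar>)
              \<le> integral {0..1} (\<lambda>\<xi>. \<bar>u k (Psi x (\<xi>, s))\<bar> + Bb * (\<Sum>l=1..n. \<bar>u l (Psi x (\<xi>, s))\<bar>))"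
            by (intro integral_le integrable_continuous_real continuous_on_add continuous_on_mult_left
                continuous_on_sum ci k continuous_on_rabs cont_slice[OF kC]) (use g in auto)
          also have "\<dots> = integral {0..1} (\<lambda>\<xi>. \<bar>u k (Psi x (\<xi>, s))\<bar>) +
              Bb * (\<Sum>l=1..n. integral {0..1} (\<lambda>\<xi>. \<bar>u l (Psi x (\<xi>, s))\<bar>))"
          proof -
            have "integral {0..1} (\<lambda>\<xi>. \<Sum>l=1..n. \<bar>u l (Psi x (\<xi>, s))\<bar>) =
                (\<Sum>l=1..n. integral {0..1} (\<lambda>\<xi>. \<bar>u l (Psi x (\<xi>, s))\<bar>))"
              by (intro Henstock_Kurzweil_Integration.integral_sum integrable_continuous_real ci) auto
            moreover have "integral {0..1} (\<lambda>\<xi>. \<bar>u k (Psi x (\<xi>, s))\<bar> + Bb * (\<Sum>l=1..n. \<bar>u l (Psi x (\<xi>, s))\<bar>)) =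
                integral {0..1} (\<lambda>\<xi>. \<bar>u k (Psi x (\<xi>, s))\<bar>) +
                integral {0..1} (\<lambda>\<xi>. Bb * (\<Sum>l=1..n. \<bar>u l (Psi x (\<xi>, s))\<bar>))"
              by (intro Henstock_Kurzweil_Integration.integral_add integrable_continuous_real
                  continuous_on_mult_left continuous_on_sum ci k)
            ultimately show ?thesis by (simp only: integral_mult_right)
          qed
          also have "\<dots> \<le> prim (\<lambda>z. \<bar>u k (Psi x z)\<bar>) (1, s) + Bb * (\<Sum>l=1..n. A l s)"
            by (intro add_mono mult_left_mono sum_mono Bb0) (auto simp: prim_def A_def)
          finally have "load j k x (u k) (ux k) (ut k) s \<le> A k s + Bb * (\<Sum>l=1..n. A l s)"
            unfolding load_def Let_def A_def by linarith
          from order_trans[OF D(2)[OF k'] mult_left_mono[OF this K0]] show ?thesis .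
        qed
        have "\<bar>ut j (x, s) - Qt u ut j (x, s)\<bar> \<le> (\<Sum>k\<in>{1..n}-{j}. K * (A k s + Bb * (\<Sum>l=1..n. A l s)))"
          unfolding eq abs_minus_cancel by (rule order_trans[OF sum_abs sum_mono[OF Dle]])
        also have "\<dots> \<le> (\<Sum>k=1..n. K * (A k s + Bb * (\<Sum>l=1..n. A l s)))"
          by (rule sum_mono2) (auto intro!: mult_nonneg_nonneg add_nonneg_nonneg K0 Bb0 A0 sum_nonneg)
        also have "\<dots> = c0 * (\<Sum>l=1..n. A l s)"
          by (simp add: c0_def sum.distrib algebra_simps flip: sum_distrib_left)
        finally show "\<bar>ut j (x, s) - Qt u ut j (x, s)\<bar> \<le> \<bar>c0 * (\<Sum>l=1..n. A l s)\<bar>" by linarith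
      next
        show "continuous_on UNIV (\<lambda>s. ut j (x, s) - Qt u ut j (x, s))"
          using uC tC1_tcont[OF uC] by (intro continuous_on_diff tcontD[of ut] continuous_on_Qt[OF j x] j x) (auto simp: tC1_def)
      qed (auto intro!: continuous_on_mult_left continuous_on_sum Ac)
      thus "wb t\<^sub>0 (\<lambda>s. ut j (x, s) - Qt u ut j (x, s)) h r (c0 * (real n * (1 + exp L + exp L)) * B)"
        using c0 by (simp add: algebra_simps)
    qed
  qed
qed

text \<open>The undifferentiated representation contains averages along characteristics and no
  traces. Spatial integrals of the solution at fixed times therefore suffice to bound the residual
  on every line of fixed \<open>x\<close>.\<close>

lemma residual_bound:
  "\<exists>c\<ge>0. \<forall>\<tau> u ux ut t\<^sub>0 r d S. sol \<tau> u ux ut \<longrightarrow> \<tau> + L \<le> t\<^sub>0 - r \<longrightarrow> 0 \<le> r \<longrightarrow>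
    (\<forall>k\<in>{1..n}. \<forall>s. t\<^sub>0 - (r + L) \<le> s \<longrightarrow> s \<le> t\<^sub>0 + (r + L) \<longrightarrow> prim (\<lambda>z. \<bar>u k z\<bar>) (1, s) \<le> S) \<longrightarrow>
    WB t\<^sub>0 (\<lambda>j z. u j z - Q u j z) d r (c * (r + L) * S)"
proof -
  obtain K where K0: "K \<ge> 0" and K: "\<And>j k h x s. j \<in> {1..n} \<Longrightarrow> k \<in> {1..n}-{j} \<Longrightarrow> continuous_on strip h \<Longrightarrow> x \<in> {0..1} \<Longrightarrow>
    \<bar>jump j k x h s\<bar> \<le> K * prim (\<lambda>z. \<bar>h (flow.Psi (a j) x z)\<bar>) (1, s)"
    using coupling_const by blast
  show ?thesis
  proof (rule exI[of _ "K * (real n * (exp L * 2))"], intro conjI allI impI)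
    show "0 \<le> K * (real n * (exp L * 2))" using K0 by auto
    fix \<tau> u ux ut t\<^sub>0 r d S
    assume u: "sol \<tau> u ux ut" and late: "\<tau> + L \<le> t\<^sub>0 - r" and r: "0 \<le> r"
      and S: "\<forall>k\<in>{1..n}. \<forall>s. t\<^sub>0 - (r + L) \<le> s \<longrightarrow> s \<le> t\<^sub>0 + (r + L) \<longrightarrow> prim (\<lambda>z. \<bar>u k z\<bar>) (1, s) \<le> S"
    note uC = sol_tC1[OF u]
    show "WB t\<^sub>0 (\<lambda>j z. u j z - Q u j z) d r (K * (real n * (exp L * 2)) * (r + L) * S)"
      unfolding WB_def
    proof (intro ballI)
      fix j x assume j: "j \<in> {1..n}" and x: "x \<in> {0..1::real}"
      interpret flow "a j" "fx j" "ft j" L by (rule fl[OF j])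
      note uc = sol_cont[OF u]
      let ?I = "\<lambda>k s. prim (\<lambda>z. \<bar>u k (Psi x z)\<bar>) (1, s)"
      have Ic: "continuous_on UNIV (?I k)" if "k \<in> {1..n}" for k
        by (rule continuous_prim_Psi[OF x uc[OF that]])
      have I0: "?I l s \<ge> 0" if "l \<in> {1..n}" for l s
        by (rule prim_abs_nonneg) (auto intro!: continuous_on_rabs continuous_Psi[OF x uc] that)
      have IW: "wb t\<^sub>0 (?I k) d r (exp L * (2 * (r + L) * S))" if "k \<in> {1..n}" for k
        by (rule wb_average_L1[OF x uc[OF that] r]) (use S that in auto)
      have "wb t\<^sub>0 (\<lambda>s. u j (x, s) - Q u j (x, s)) d r (\<bar>K\<bar> * (\<Sum>k=1..n. exp L * (2 * (r + L) * S)))"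
      proof (rule wb_dominated[OF wb_cmult[OF wb_sum[OF _ IW Ic]]])
        fix s assume s: "t\<^sub>0 - r \<le> s" "s \<le> t\<^sub>0 + r"
        hence s': "s \<ge> \<tau> + L" using late by linarith
        have "\<bar>u j (x, s) - Q u j (x, s)\<bar> \<le> (\<Sum>k\<in>{1..n}-{j}. K * ?I k s)"
          unfolding representation[OF u j x s'] abs_minus_cancel
          by (rule order_trans[OF sum_abs sum_mono]) (use K[OF j _ uc x] in auto)
        also have "\<dots> \<le> (\<Sum>k=1..n. K * ?I k s)"
          by (rule sum_mono2) (auto intro!: mult_nonneg_nonneg K0 I0)
        finally show "\<bar>u j (x, s) - Q u j (x, s)\<bar> \<le> \<bar>K * (\<Sum>k=1..n. ?I k s)\<bar>"
          by (simp add: sum_distrib_left)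
      qed (auto intro!: continuous_on_mult_left continuous_on_sum Ic continuous_on_diff
          cont_slice_t[OF uc[OF j] x] continuous_on_Q[OF j x tC1_tcont[OF uC]])
      thus "wb t\<^sub>0 (\<lambda>s. u j (x, s) - Q u j (x, s)) d r (K * (real n * (exp L * 2)) * (r + L) * S)"
        using K0 by (simp add: algebra_simps)
    qed
  qed
qed

lemma residual_expansion:
  assumes u: "sol \<tau> u ux ut" and j: "j \<in> {1..n}" and z: "z \<in> strip"
  shows "u j z = (\<Sum>i<N. (Q ^^ i) (\<lambda>j z. u j z - Q u j z) j z)"
  using Q_telescope[where k = N and u = u and j = j and z = z] nilpotent[of u j z] sol_cont[OF u] j z by auto

lemma WB_weaken: "WB t\<^sub>0 w h r B \<Longrightarrow> h' \<le> h \<Longrightarrow> r' \<le> r \<Longrightarrow> B \<le> B' \<Longrightarrow> WB t\<^sub>0 w h' r' B'"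
  unfolding WB_def by (meson wb_weaken)

lemma window_mono:
  assumes "i \<le> N" "h \<ge> 0"
  shows "exp L ^ i * h \<le> exp L ^ N * h" "r + real i * L \<le> r + real N * L"
proof -
  have "exp L ^ i \<le> exp L ^ N" using assms L_pos by (intro power_increasing) auto
  thus "exp L ^ i * h \<le> exp L ^ N * h" using assms(2) by (rule mult_right_mono)
  show "r + real i * L \<le> r + real N * L" using assms L_pos by (simp add: mult_right_mono)
qed

definition KN :: real where "KN = (\<Sum>i<N. KQ ^ i)"

lemma KN_nonneg: "KN \<ge> 0" unfolding KN_def using KQ_nonneg by (intro sum_nonneg) auto

text \<open>The \<open>i\<close>-th term of the expansion follows \<open>i\<close> characteristics
  in succession; the window \<open>exp L ^ N * h\<close> and radius \<open>r + N * L\<close> are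
  large enough for all terms.\<close>

lemma sol_WB:
  assumes u: "sol \<tau> u ux ut" and h: "h \<ge> 0" and B: "B \<ge> 0"
    and W: "WB t\<^sub>0 (\<lambda>j z. u j z - Q u j z) (exp L ^ N * h) (r + real N * L) B"
  shows "WB t\<^sub>0 u h r (KN * B)"
  unfolding WB_def
proof (intro ballI)
  let ?w = "\<lambda>j z. u j z - Q u j z"
  have wc: "tcont ?w"
    using tC1_tcont[OF sol_tC1[OF u]] tcont_Q[OF tC1_tcont[OF sol_tC1[OF u]]]
    unfolding tcont_def by (auto intro: continuous_on_diff)
  fix j x assume j: "j \<in> {1..n}" and x: "x \<in> {0..1::real}"
  have i: "tcont ((Q ^^ i) ?w) \<and> WB t\<^sub>0 ((Q ^^ i) ?w) h r (KQ ^ i * B)" if "i \<in> {..<N}" for i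
    by (rule Q_pow_WB[OF wc B WB_weaken[OF W]]) (use that h window_mono(1)[of i h] window_mono(2)[of i h r] in auto)
  have "wb t\<^sub>0 (\<lambda>s. \<Sum>i<N. (Q ^^ i) ?w j (x, s)) h r (\<Sum>i<N. KQ ^ i * B)"
    by (rule wb_sum) (use i j x in \<open>auto simp: WB_def tcont_def\<close>)
  thus "wb t\<^sub>0 (\<lambda>s. u j (x, s)) h r (KN * B)"
    using residual_expansion[OF u j] x by (simp add: KN_def sum_distrib_right)
qed

text \<open>The terms of the expansion are differentiable with some derivatives obeying the window
  bounds; uniqueness of derivatives identifies their sum with \<open>ut\<close>.\<close>

lemma sol_t_WB:
  assumes u: "sol \<tau> u ux ut" and h: "h \<ge> 0" and B: "B \<ge> 0"
    and W: "WB t\<^sub>0 (\<lambda>j z. u j z - Q u j z) (exp L ^ N * h) (r + real N * L) B"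
    and W': "WB t\<^sub>0 (\<lambda>j z. ut j z - Qt u ut j z) (exp L ^ N * h) (r + real N * L) B"
  shows "WB t\<^sub>0 ut h r (KN * B)"
  unfolding WB_def
proof (intro ballI)
  let ?w = "\<lambda>j z. u j z - Q u j z" and ?w' = "\<lambda>j z. ut j z - Qt u ut j z"
  note uC = sol_tC1[OF u]
  have wC: "tC1 ?w ?w'"
    using uC tC1_Q[OF uC] unfolding tC1_def tcont_def has_dt_def
    by (auto intro!: continuous_on_diff DERIV_diff)
  fix j x assume j: "j \<in> {1..n}" and x: "x \<in> {0..1::real}"
  have "\<exists>v. \<forall>i\<in>{..<N}. tC1 ((Q ^^ i) ?w) (v i) \<and> WB t\<^sub>0 (v i) h r (KQ ^ i * B)"
  proof (rule bchoice, intro ballI)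
    fix i assume "i \<in> {..<N}"
    thus "\<exists>v. tC1 ((Q ^^ i) ?w) v \<and> WB t\<^sub>0 v h r (KQ ^ i * B)"
      by (intro Q_pow_tC1[OF wC B] WB_weaken[OF W] WB_weaken[OF W']) (use h window_mono(1)[of i h] window_mono(2)[of i h r] in auto)
  qed
  then obtain v where v: "\<And>i. i < N \<Longrightarrow> tC1 ((Q ^^ i) ?w) (v i)"
    "\<And>i. i < N \<Longrightarrow> WB t\<^sub>0 (v i) h r (KQ ^ i * B)" by auto
  have "ut j (x, s) = (\<Sum>i<N. v i j (x, s))" for s
  proof (rule DERIV_unique)
    show "((\<lambda>s. u j (x, s)) has_real_derivative ut j (x, s)) (at s)"
      using uC j x by (intro has_dtD) (auto simp: tC1_def)
    have "((\<lambda>s. \<Sum>i<N. (Q ^^ i) ?w j (x, s)) has_real_derivative (\<Sum>i<N. v i j (x, s))) (at s)"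
      by (intro DERIV_sum has_dtD[of "(Q ^^ _) ?w j"]) (use v(1) j x in \<open>auto simp: tC1_def\<close>)
    thus "((\<lambda>s. u j (x, s)) has_real_derivative (\<Sum>i<N. v i j (x, s))) (at s)"
      using residual_expansion[OF u j] x by simp
  qed
  moreover have "wb t\<^sub>0 (\<lambda>s. \<Sum>i<N. v i j (x, s)) h r (\<Sum>i<N. KQ ^ i * B)"
    by (rule wb_sum) (use v j x in \<open>auto simp: WB_def tC1_def tcont_def\<close>)
  ultimately show "wb t\<^sub>0 (\<lambda>s. ut j (x, s)) h r (KN * B)"
    by (simp add: KN_def sum_distrib_right)
qed

text \<open>One enlargement of the window pays for the residual and its derivative, the other
  \<open>N\<close> for the expansion; hence \<open>Suc N\<close>.\<close>

lemma WB_derivative_bound: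
  "\<exists>c\<ge>0. \<forall>\<tau> u ux ut t\<^sub>0 r h B. sol \<tau> u ux ut \<longrightarrow> \<tau> + L < t\<^sub>0 - (r + real N * L) \<longrightarrow> 0 \<le> h \<longrightarrow> 0 \<le> B \<longrightarrow>
    WB t\<^sub>0 u (exp L ^ Suc N * h) (r + real (Suc N) * L) B \<longrightarrow> WB t\<^sub>0 ut h r (c * B)"
proof -
  obtain c where c0: "c \<ge> 0" and c: "\<And>\<tau> u ux ut t\<^sub>0 r h B. sol \<tau> u ux ut \<Longrightarrow> \<tau> + L < t\<^sub>0 - r \<Longrightarrow> 0 \<le> h \<Longrightarrow> 0 \<le> B \<Longrightarrow>
    WB t\<^sub>0 u (exp L * h) (r + L) B \<Longrightarrow> WB t\<^sub>0 (\<lambda>j z. ut j z - Qt u ut j z) h r (c * B)"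
    using residual_t_bound by blast
  show ?thesis
  \<comment> \<open>\<open>1 + KQ\<close> bounds the residual \<open>u - Q u\<close> by the triangle
    inequality and \<open>c\<close> bounds its derivative; their sum serves as the common bound that
    the expansion asks for.\<close>
  proof (rule exI[of _ "KN * (c + 1 + KQ)"], intro conjI allI impI)
    show "0 \<le> KN * (c + 1 + KQ)" using KN_nonneg c0 KQ_nonneg by auto
    fix \<tau> u ux ut t\<^sub>0 r h B
    assume u: "sol \<tau> u ux ut" and late: "\<tau> + L < t\<^sub>0 - (r + real N * L)" and h: "0 \<le> h" and B: "0 \<le> B"
      and W: "WB t\<^sub>0 u (exp L ^ Suc N * h) (r + real (Suc N) * L) B"
    let ?h = "exp L ^ N * h" and ?r = "r + real N * L"
    have h': "?h \<ge> 0" using h by simp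
    have W1: "WB t\<^sub>0 u (exp L * ?h) (?r + L) B" using W by (simp add: algebra_simps)
    have "?h \<le> exp L * ?h" using L_pos h' by (simp add: mult_le_cancel_right1)
    hence W2: "WB t\<^sub>0 u ?h ?r B" using L_pos by (intro WB_weaken[OF W1]) auto
    have uc: "tcont u" using tC1_tcont[OF sol_tC1[OF u]] .
    have WQ: "WB t\<^sub>0 (Q u) ?h ?r (KQ * B)" by (rule WB_Q[OF uc B W1])
    have "WB t\<^sub>0 (\<lambda>j z. u j z - Q u j z) ?h ?r (B + \<bar>-1\<bar> * (KQ * B))"
      unfolding WB_def
    proof (intro ballI)
      fix j x assume j: "j \<in> {1..n}" and x: "x \<in> {0..1::real}"
      have "wb t\<^sub>0 (\<lambda>s. u j (x, s) + (-1) * Q u j (x, s)) ?h ?r (B + \<bar>-1\<bar> * (KQ * B))"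
        using W2 WQ j x tcontD[OF uc j x] continuous_on_Q[OF j x uc]
        by (intro wb_add wb_cmult continuous_on_mult_left) (auto simp: WB_def)
      thus "wb t\<^sub>0 (\<lambda>s. u j (x, s) - Q u j (x, s)) ?h ?r (B + \<bar>-1\<bar> * (KQ * B))" by simp
    qed
    hence "WB t\<^sub>0 (\<lambda>j z. u j z - Q u j z) ?h ?r ((c + 1 + KQ) * B)"
      by (rule WB_weaken) (use c0 B in \<open>auto simp: algebra_simps\<close>)
    moreover have "WB t\<^sub>0 (\<lambda>j z. ut j z - Qt u ut j z) ?h ?r ((c + 1 + KQ) * B)"
      by (rule WB_weaken[OF c[OF u late h' B W1]])
        (use KQ_nonneg B in \<open>auto simp: algebra_simps intro!: add_nonneg_nonneg mult_nonneg_nonneg\<close>)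
    ultimately have "WB t\<^sub>0 ut h r (KN * ((c + 1 + KQ) * B))"
      by (intro sol_t_WB[OF u h]) (use c0 KQ_nonneg B in auto)
    thus "WB t\<^sub>0 ut h r (KN * (c + 1 + KQ) * B)" by (simp add: mult.assoc)
  qed
qed

lemma sup_estimate:
  "\<exists>K\<ge>0. \<exists>R>0. \<forall>\<tau> u ux ut t\<^sub>0 S. sol \<tau> u ux ut \<longrightarrow> \<tau> + R \<le> t\<^sub>0 \<longrightarrow>
    (\<forall>k\<in>{1..n}. \<forall>s. t\<^sub>0 - R \<le> s \<longrightarrow> s \<le> t\<^sub>0 + R \<longrightarrow> prim (\<lambda>z. \<bar>u k z\<bar>) (1, s) \<le> S) \<longrightarrow>
    (\<forall>j\<in>{1..n}. \<forall>x\<in>{0..1}. \<bar>u j (x, t\<^sub>0)\<bar> \<le> K * S \<and> \<bar>ut j (x, t\<^sub>0)\<bar> \<le> K * S)"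
proof -
  obtain c where c0: "c \<ge> 0" and c: "\<And>\<tau> u ux ut t\<^sub>0 r d S. sol \<tau> u ux ut \<Longrightarrow> \<tau> + L \<le> t\<^sub>0 - r \<Longrightarrow> 0 \<le> r \<Longrightarrow>
    (\<forall>k\<in>{1..n}. \<forall>s. t\<^sub>0 - (r + L) \<le> s \<longrightarrow> s \<le> t\<^sub>0 + (r + L) \<longrightarrow> prim (\<lambda>z. \<bar>u k z\<bar>) (1, s) \<le> S) \<Longrightarrow>
    WB t\<^sub>0 (\<lambda>j z. u j z - Q u j z) d r (c * (r + L) * S)"
    using residual_bound by blast
  obtain e where e0: "e \<ge> 0" and e: "\<And>\<tau> u ux ut t\<^sub>0 r h B. sol \<tau> u ux ut \<Longrightarrow> \<tau> + L < t\<^sub>0 - (r + real N * L) \<Longrightarrow>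
    0 \<le> h \<Longrightarrow> 0 \<le> B \<Longrightarrow> WB t\<^sub>0 u (exp L ^ Suc N * h) (r + real (Suc N) * L) B \<Longrightarrow> WB t\<^sub>0 ut h r (e * B)"
    using WB_derivative_bound by blast
  \<comment> \<open>The radius lost in one pass through the residual and the expansion. There are
    three passes: time slices to windows, windows of \<open>u\<close> to windows of
    \<open>ut\<close>, and the sup bound on \<open>u\<close> to that on \<open>ut\<close>.
    \<open>R\<close> collects them, with some margin.\<close>
  define \<rho> where "\<rho> = real (Suc N) * L"
  have \<rho>: "\<rho> > 0" using L_pos by (simp add: \<rho>_def)
  have \<rho>N: "real N * L + L = \<rho>" by (simp add: \<rho>_def algebra_simps)
  define r\<^sub>1 where "r\<^sub>1 = 1 + \<rho>"
  define R where "R = r\<^sub>1 + \<rho> + \<rho> + 1"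
  \<comment> \<open>\<open>c\<^sub>2\<close> belongs to the window bound on \<open>u\<close>,
    \<open>c\<^sub>3\<close> to its sup bound after the Sobolev step, and \<open>c\<^sub>4\<close>
    to the sup bound on \<open>ut\<close>; the power of \<open>exp L\<close> in
    \<open>c\<^sub>4\<close> is the factor by which the last pass lengthens windows.\<close>
  define c\<^sub>2 where "c\<^sub>2 = KN * (c * (r\<^sub>1 + \<rho> + \<rho>))"
  define c\<^sub>3 where "c\<^sub>3 = c\<^sub>2 + e * c\<^sub>2"
  define c\<^sub>4 where "c\<^sub>4 = e * (exp L ^ Suc N * c\<^sub>3)"
  have c2: "c\<^sub>2 \<ge> 0" unfolding c\<^sub>2_def using KN_nonneg c0 \<rho> by (auto simp: r\<^sub>1_def intro!: mult_nonneg_nonneg)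
  have c3: "c\<^sub>3 \<ge> 0" unfolding c\<^sub>3_def using c2 e0 by auto
  have c4: "c\<^sub>4 \<ge> 0" unfolding c\<^sub>4_def using c3 e0 by auto
  show ?thesis
  proof (rule exI[of _ "c\<^sub>3 + c\<^sub>4"], intro conjI, use c3 c4 in simp, rule exI[of _ R], intro conjI allI impI ballI)
    show "R > 0" using \<rho> by (simp add: R_def r\<^sub>1_def)
    fix \<tau> u ux ut t\<^sub>0 S
    assume u: "sol \<tau> u ux ut" and late: "\<tau> + R \<le> t\<^sub>0"
      and S: "\<forall>k\<in>{1..n}. \<forall>s. t\<^sub>0 - R \<le> s \<longrightarrow> s \<le> t\<^sub>0 + R \<longrightarrow> prim (\<lambda>z. \<bar>u k z\<bar>) (1, s) \<le> S"
    note uC = sol_tC1[OF u]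
    have S0: "S \<ge> 0"
    proof -
      have "prim (\<lambda>z. \<bar>u 1 z\<bar>) (1, t\<^sub>0) \<ge> 0"
        by (rule prim_abs_nonneg) (use sol_cont[OF u, of 1] n in \<open>auto intro!: continuous_on_rabs\<close>)
      moreover have "prim (\<lambda>z. \<bar>u 1 z\<bar>) (1, t\<^sub>0) \<le> S" using S n \<open>R > 0\<close> by auto
      ultimately show ?thesis by linarith
    qed
    have WBu: "WB t\<^sub>0 u h (r\<^sub>1 + \<rho>) (c\<^sub>2 * S)" if h: "h \<ge> 0" for h
    proof -
      have "WB t\<^sub>0 (\<lambda>j z. u j z - Q u j z) (exp L ^ N * h) (r\<^sub>1 + \<rho> + real N * L) (c * (r\<^sub>1 + \<rho> + real N * L + L) * S)"
        by (rule c[OF u]) (use late S L_pos \<rho> \<rho>N in \<open>auto simp: R_def r\<^sub>1_def algebra_simps\<close>)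
      hence "WB t\<^sub>0 (\<lambda>j z. u j z - Q u j z) (exp L ^ N * h) (r\<^sub>1 + \<rho> + real N * L) (c * (r\<^sub>1 + \<rho> + \<rho>) * S)"
        using \<rho>N by (simp add: add.assoc)
      from sol_WB[OF u h _ this] show ?thesis
        using c0 S0 \<rho> by (simp add: c\<^sub>2_def r\<^sub>1_def mult.assoc)
    qed
    have WBut: "WB t\<^sub>0 ut (2 * r\<^sub>1) r\<^sub>1 (e * (c\<^sub>2 * S))"
      by (rule e[OF u])
        (use late L_pos \<rho> \<rho>N c2 S0 WBu[of "exp L ^ Suc N * (2 * r\<^sub>1)"] in
          \<open>auto simp: R_def r\<^sub>1_def \<rho>_def[symmetric] simp del: of_nat_Suc\<close>)
    have sup: "\<bar>u j (x, s)\<bar> \<le> c\<^sub>3 * S" if j: "j \<in> {1..n}" and x: "x \<in> {0..1}" and s: "\<bar>s - t\<^sub>0\<bar> \<le> r\<^sub>1" for j x s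
    proof -
      have "\<bar>u j (x, s)\<bar> \<le> c\<^sub>2 * S + e * (c\<^sub>2 * S)"
      proof (rule sobolev_window[where f = "\<lambda>s. u j (x, s)" and t\<^sub>0 = t\<^sub>0 and f' = "\<lambda>s. ut j (x, s)" and r = r\<^sub>1])
        show "wb t\<^sub>0 (\<lambda>s. u j (x, s)) (2 * r\<^sub>1) r\<^sub>1 (c\<^sub>2 * S)"
          using WB_weaken[OF WBu[of "2 * r\<^sub>1"], of "2 * r\<^sub>1" r\<^sub>1 "c\<^sub>2 * S"] j x \<rho> by (auto simp: WB_def r\<^sub>1_def)
        show "wb t\<^sub>0 (\<lambda>s. ut j (x, s)) (2 * r\<^sub>1) r\<^sub>1 (e * (c\<^sub>2 * S))"
          using WBut j x by (auto simp: WB_def)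
        show "((\<lambda>s. u j (x, s)) has_real_derivative ut j (x, s)) (at s)" for s
          using uC j x by (intro has_dtD) (auto simp: tC1_def)
        show "continuous_on UNIV (\<lambda>s. ut j (x, s))"
          using uC j x by (auto simp: tC1_def intro: tcontD)
      qed (use s \<rho> in \<open>auto simp: r\<^sub>1_def\<close>)
      thus ?thesis by (simp add: c\<^sub>3_def algebra_simps)
    qed
    fix j x assume jx: "j \<in> {1..n}" "x \<in> {0..1::real}"
    show "\<bar>u j (x, t\<^sub>0)\<bar> \<le> (c\<^sub>3 + c\<^sub>4) * S"
      using sup[OF jx, of t\<^sub>0] \<rho> mult_nonneg_nonneg[OF c4 S0] by (simp add: r\<^sub>1_def distrib_right)
    have "\<bar>ut j (x, t\<^sub>0)\<bar> \<le> c\<^sub>4 * S"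
    proof (rule abs_le_of_windows[where g = "\<lambda>s. ut j (x, s)"])
      show "continuous_on UNIV (\<lambda>s. ut j (x, s))"
        using uC jx by (auto simp: tC1_def intro: tcontD)
      fix h :: real assume h: "0 < h" "h \<le> 1"
      let ?h = "exp L ^ Suc N * h"
      \<comment> \<open>With a sup bound at hand, window integrals are proportional to the window
        length. The derivative estimate keeps this proportionality, and letting \<open>h\<close>
        tend to 0 returns a pointwise bound.\<close>
      have "WB t\<^sub>0 u ?h r\<^sub>1 (c\<^sub>3 * S * ?h)"
        unfolding WB_def wb_def
      proof (intro ballI allI impI)
        fix j x \<alpha> \<beta> assume *: "j \<in> {1..n}" "x \<in> {0..1::real}" "t\<^sub>0 - r\<^sub>1 \<le> \<alpha>" "\<alpha> \<le> \<beta>" "\<beta> \<le> t\<^sub>0 + r\<^sub>1" "\<beta> - \<alpha> \<le> ?h"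
        have "integral {\<alpha>..\<beta>} (\<lambda>s. \<bar>u j (x, s)\<bar>) \<le> integral {\<alpha>..\<beta>} (\<lambda>s. c\<^sub>3 * S)"
          using * tC1_tcont[OF uC] by (intro integral_le abs_integrable_UNIV tcontD sup) auto
        also have "\<dots> = c\<^sub>3 * S * (\<beta> - \<alpha>)" using * by simp
        also have "\<dots> \<le> c\<^sub>3 * S * ?h" using * c3 S0 by (intro mult_left_mono) auto
        finally show "integral {\<alpha>..\<beta>} (\<lambda>s. \<bar>u j (x, s)\<bar>) \<le> c\<^sub>3 * S * ?h" .
      qed
      hence "WB t\<^sub>0 ut h 1 (e * (c\<^sub>3 * S * ?h))"
        by (intro e[OF u]) (use late L_pos \<rho> \<rho>N c3 S0 h in
          \<open>auto simp: R_def r\<^sub>1_def \<rho>_def[symmetric] simp del: of_nat_Suc\<close>)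
      hence "wb t\<^sub>0 (\<lambda>s. ut j (x, s)) h 1 (e * (c\<^sub>3 * S * ?h))"
        using jx by (auto simp: WB_def)
      from wbD[OF this, of t\<^sub>0 "t\<^sub>0 + h"]
      have "integral {t\<^sub>0..t\<^sub>0 + h} (\<lambda>s. \<bar>ut j (x, s)\<bar>) \<le> e * (c\<^sub>3 * S * ?h)"
        using h by simp
      thus "integral {t\<^sub>0..t\<^sub>0 + h} (\<lambda>s. \<bar>ut j (x, s)\<bar>) \<le> c\<^sub>4 * S * h"
        by (simp add: c\<^sub>4_def mult_ac)
    qed
    thus "\<bar>ut j (x, t\<^sub>0)\<bar> \<le> (c\<^sub>3 + c\<^sub>4) * S"
      using mult_nonneg_nonneg[OF c3 S0] by (simp add: distrib_right)
  qed
qed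

end

section \<open>Energy estimate and smoothing of classical solutions\<close>

context hyperbolic
begin

definition esq :: "vfield \<Rightarrow> real \<Rightarrow> real"
  where "esq u t = (\<Sum>j=1..n. prim (\<lambda>z. (u j z)\<^sup>2) (1, t))"

lemma prim_sq_nonneg: "continuous_on strip h \<Longrightarrow> prim (\<lambda>z. (h z)\<^sup>2) (1, t) \<ge> 0"
  by (rule prim_abs_nonneg) (auto intro!: continuous_intros)

text \<open>
  The weight of each component is \<open>1\<close> at the inflow end and \<open>1 + M\<close> at the outflow end. For large
  \<open>M\<close> the outflow dominates the reflected inflow.
\<close>
lemma energy_estimate:
  "\<exists>K\<ge>0. \<exists>M\<ge>0. \<forall>\<tau> u ux ut t. sol \<tau> u ux ut \<longrightarrow> \<tau> \<le> t \<longrightarrow>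
    esq u t \<le> (1 + M) * exp (K * (t - \<tau>)) * esq u \<tau>"
proof -
  obtain Bb where Bb0: "Bb \<ge> 0" and Bb: "\<And>j k z. j \<in> {1..n} \<Longrightarrow> k \<in> {1..n} \<Longrightarrow> z \<in> strip \<Longrightarrow> \<bar>b j k z\<bar> \<le> Bb"
    using b_bound by blast
  have "\<exists>A>0. \<forall>z\<in>strip. \<bar>a j z\<bar> \<le> A \<and> \<bar>dx strip (a j) z\<bar> \<le> A" if j: "j \<in> {1..n}" for j
  proof -
    obtain A1 where A1: "A1 > 0" "\<And>z. z \<in> strip \<Longrightarrow> \<bar>a j z\<bar> \<le> A1"
      using bounded_stripE aBC[OF j] unfolding BC1_strip_def by metis
    obtain A2 where A2: "A2 > 0" "\<And>z. z \<in> strip \<Longrightarrow> \<bar>dx strip (a j) z\<bar> \<le> A2"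
      using bounded_stripE aBC[OF j] unfolding BC1_strip_def by metis
    show ?thesis
      by (rule exI[of _ "A1 + A2"]) (use A1 A2 in \<open>auto intro: add_increasing add_increasing2 less_imp_le\<close>)
  qed
  then obtain Af where Af: "\<And>j. j \<in> {1..n} \<Longrightarrow> Af j > 0"
    "\<And>j z. j \<in> {1..n} \<Longrightarrow> z \<in> strip \<Longrightarrow> \<bar>a j z\<bar> \<le> Af j \<and> \<bar>dx strip (a j) z\<bar> \<le> Af j" by metis
  define A where "A = (\<Sum>j=1..n. Af j)"
  have AfA: "Af j \<le> A" if "j \<in> {1..n}" for j
    unfolding A_def by (rule member_le_sum) (use that Af(1) in \<open>auto intro: less_imp_le\<close>)
  have A: "\<bar>a j z\<bar> \<le> A" "\<bar>dx strip (a j) z\<bar> \<le> A" if "j \<in> {1..n}" "z \<in> strip" for j z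
    using Af(2)[OF that] AfA[OF that(1)] by linarith+
  have A0: "A \<ge> 0" unfolding A_def using Af(1) by (intro sum_nonneg) (auto intro: less_imp_le)
  define Pq where "Pq = (\<Sum>j=1..n. \<Sum>k=1..n. (p j k)\<^sup>2)"
  have Pq0: "Pq \<ge> 0" unfolding Pq_def by (intro sum_nonneg) auto
  \<comment> \<open>Makes \<open>M * \<mu> = A * Pq\<close>. The inflow terms are at most
    \<open>A * Pq\<close> times the squared outgoing traces by Cauchy-Schwarz, and the outflow terms
    remove at least \<open>(1 + M) * \<mu>\<close> times the same quantity.\<close>
  define M where "M = A * Pq / \<mu>"
  have M0: "M \<ge> 0" unfolding M_def using A0 Pq0 \<mu> by auto
  define wt where "wt = (\<lambda>j (x::real). 1 + M * (if j \<le> m then x else 1 - x))"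
  define \<sigma> where "\<sigma> = (\<lambda>j. if j \<le> m then M else - M)"
  have wt: "1 \<le> wt j x" "wt j x \<le> 1 + M" if "x \<in> {0..1}" for j x
    using that M0 by (auto simp: wt_def mult_left_le)
  have wtd: "(wt j has_real_derivative \<sigma> j) (at x within X)" for j x X
    unfolding wt_def \<sigma>_def by (auto intro!: derivative_eq_intros)
  have wtc: "continuous_on X (\<lambda>z. wt j (fst z))" for j X
    by (cases "j \<le> m") (auto simp: wt_def intro!: continuous_intros)
  \<comment> \<open>The summands bound the contributions of the derivative of the weight, of the
    derivative of \<open>a_j\<close>, and of the zero order term. In the last one,
    \<open>2 u_j u_l\<close> is at most the sum of the squares, which gives
    \<open>1 + real n\<close>.\<close>
  define C where "C = M * A + (1 + M) * A + (1 + M) * Bb * (1 + real n)"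
  have C0: "C \<ge> 0" unfolding C_def using M0 A0 Bb0 by (intro add_nonneg_nonneg mult_nonneg_nonneg) auto
  define K where "K = real n * C"
  have K0: "K \<ge> 0" using C0 by (simp add: K_def)
  show ?thesis
  proof (rule exI[of _ K], intro conjI K0, rule exI[of _ M], intro conjI M0 allI impI)
    fix \<tau> u ux ut t
    assume u: "sol \<tau> u ux ut" and t: "\<tau> \<le> t"
    note uc = sol_cont[OF u]
    have utc: "continuous_on strip (ut j)" if "j \<in> {1..n}" for j using solD(1)[OF u that] by (simp add: C1_strip_def)
    define k where "k = (\<lambda>j z. wt j (fst z) * (u j z)\<^sup>2)"
    define k' where "k' = (\<lambda>j z. wt j (fst z) * (2 * u j z * ut j z))"
    have kc: "continuous_on strip (k j)" "continuous_on strip (k' j)" if "j \<in> {1..n}" for j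
      unfolding k_def k'_def by (intro continuous_intros wtc uc utc that)+
    have kd: "has_dt (k j) (k' j)" if j: "j \<in> {1..n}" for j
      unfolding has_dt_def k_def k'_def
      using has_dtD[OF C1_stripD(5)[OF solD(1)[OF u j]]]
      by (auto intro!: derivative_eq_intros)
    define E where "E = (\<lambda>t. \<Sum>j=1..n. prim (k j) (1, t))"
    have Ed: "(E has_real_derivative (\<Sum>j=1..n. prim (k' j) (1, s))) (at s)" for s
      unfolding E_def by (intro DERIV_sum has_dtD[OF has_dt_prim] kc kd) auto
    have prim_mono: "prim g (1, s) \<le> prim h (1, s)"
      if "continuous_on strip g" "continuous_on strip h" "\<And>x. x \<in> {0..1} \<Longrightarrow> g (x, s) \<le> h (x, s)" for g h s
      unfolding prim_def case_prod_conv
      by (rule integral_le) (use that in \<open>auto intro!: integrable_continuous_real cont_slice\<close>)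
    have sqc: "continuous_on strip (\<lambda>z. (u j z)\<^sup>2)" if "j \<in> {1..n}" for j by (intro continuous_intros uc that)
    have esq_E: "esq u s \<le> E s" for s
      unfolding esq_def E_def
      by (intro sum_mono prim_mono sqc kc) (auto simp: k_def intro!: mult_right_mono[OF wt(1), of _ "_\<^sup>2", simplified])
    have E_esq: "E s \<le> (1 + M) * esq u s" for s
      unfolding esq_def E_def sum_distrib_left
    proof (rule sum_mono)
      fix j assume j: "j \<in> {1..n}"
      have "prim (k j) (1, s) \<le> prim (\<lambda>z. (1 + M) * (u j z)\<^sup>2) (1, s)"
        by (intro prim_mono kc continuous_on_mult_left sqc j) (auto simp: k_def intro!: mult_right_mono wt(2))
      thus "prim (k j) (1, s) \<le> (1 + M) * prim (\<lambda>z. (u j z)\<^sup>2) (1, s)" by (simp add: prim_def)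
    qed
    have dle: "(\<Sum>j=1..n. prim (k' j) (1, s)) \<le> K * E s" if s: "\<tau> \<le> s" for s
    proof -
      \<comment> \<open>The energy flux. Inserting the equation into the \<open>t\<close>-derivative
        of the weighted square splits it into minus the space derivative of \<open>G\<close>, seen
        only at the ends, and the quadratic expression \<open>H\<close> without derivatives of
        \<open>u\<close>.\<close>
      define G where "G = (\<lambda>j \<xi>. wt j \<xi> * a j (\<xi>, s) * (u j (\<xi>, s))\<^sup>2)"
      define H where "H = (\<lambda>j z. \<sigma> j * a j z * (u j z)\<^sup>2 + wt j (fst z) * dx strip (a j) z * (u j z)\<^sup>2
        - 2 * wt j (fst z) * u j z * (\<Sum>l=1..n. b j l z * u l z))"
      define v where "v = (\<lambda>l. u l (1 - bpt m l, s))"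
      have ac: "continuous_on strip (a j)" "continuous_on strip (dx strip (a j))" "has_dx (a j) (dx strip (a j))"
        if "j \<in> {1..n}" for j using aBC[OF that] by (auto simp: BC1_strip_def C1_strip_def)
      have bc: "continuous_on strip (b j l)" if "j \<in> {1..n}" "l \<in> {1..n}" for j l
        using bBC[OF that] by (auto simp: BC1_strip_def C1_strip_def)
      have Hc: "continuous_on strip (H j)" if j: "j \<in> {1..n}" for j
        unfolding H_def
        by (intro continuous_on_add continuous_on_diff continuous_on_mult continuous_on_const wtc ac j sqc uc
            continuous_on_sum bc) auto
      have k'eq: "prim (k' j) (1, s) = - (G j 1 - G j 0) + prim (H j) (1, s)" if j: "j \<in> {1..n}" for j
      proof -
        have "prim (k' j) (1, s) - prim (k' j) (0, s) = (- G j 1 + prim (H j) (1, s)) - (- G j 0 + prim (H j) (0, s))"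
        proof (rule prim_diff_eq[OF kc(2)[OF j]])
          fix \<xi> :: real assume \<xi>: "\<xi> \<in> {0..1}"
          have "((\<lambda>\<xi>. - G j \<xi> + prim (H j) (\<xi>, s)) has_real_derivative
             - ((\<sigma> j * a j (\<xi>, s) + dx strip (a j) (\<xi>, s) * wt j \<xi>) * (u j (\<xi>, s))\<^sup>2 +
                (real 2 * (ux j (\<xi>, s) * u j (\<xi>, s) ^ (2 - Suc 0))) * (wt j \<xi> * a j (\<xi>, s))) + H j (\<xi>, s)) (at \<xi> within {0..1})"
            unfolding G_def
            by (intro DERIV_add DERIV_minus DERIV_mult DERIV_power wtd has_dxD[OF ac(3)[OF j] \<xi>]
                has_dxD[OF C1_stripD(4)[OF solD(1)[OF u j]] \<xi>] has_dxD[OF has_dx_prim[OF Hc[OF j]] \<xi>])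
          moreover have "- ((\<sigma> j * a j (\<xi>, s) + dx strip (a j) (\<xi>, s) * wt j \<xi>) * (u j (\<xi>, s))\<^sup>2 +
                (real 2 * (ux j (\<xi>, s) * u j (\<xi>, s) ^ (2 - Suc 0))) * (wt j \<xi> * a j (\<xi>, s))) + H j (\<xi>, s) = k' j (\<xi>, s)"
          proof -
            have pde: "ut j (\<xi>, s) = - a j (\<xi>, s) * ux j (\<xi>, s) - (\<Sum>l=1..n. b j l (\<xi>, s) * u l (\<xi>, s))"
              using solD(2)[OF u j \<xi> s] by linarith
            have alg: "- ((sg * A + dA * W) * U\<^sup>2 + (real 2 * (Ux * U ^ (2 - Suc 0))) * (W * A)) +
               (sg * A * U\<^sup>2 + W * dA * U\<^sup>2 - 2 * W * U * Sm) = W * (2 * U * (- A * Ux - Sm))" for sg A dA W U Ux Sm :: real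
              by (simp add: algebra_simps power2_eq_square)
            show ?thesis unfolding H_def k'_def pde fst_conv by (rule alg)
          qed
          ultimately show "((\<lambda>\<xi>. - G j \<xi> + prim (H j) (\<xi>, s)) has_real_derivative k' j (\<xi>, s)) (at \<xi> within {0..1})"
            by (rule DERIV_cong)
        qed auto
        thus ?thesis by (simp add: prim_def)
      qed
      have Hle: "prim (H j) (1, s) \<le> C * esq u s" if j: "j \<in> {1..n}" for j
      proof -
        have "prim (H j) (1, s) \<le> prim (\<lambda>z. C * (\<Sum>l=1..n. (u l z)\<^sup>2)) (1, s)"
        proof (intro prim_mono Hc j continuous_on_mult_left continuous_on_sum sqc)
          fix x :: real assume x: "x \<in> {0..1}"
          let ?z = "(x, s)" and ?S = "\<Sum>l=1..n. (u l (x, s))\<^sup>2"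
          have z: "?z \<in> strip" using x by simp
          have uS: "(u l ?z)\<^sup>2 \<le> ?S" if "l \<in> {1..n}" for l by (rule member_le_sum) (use that in auto)
          have S0: "?S \<ge> 0" by (intro sum_nonneg) auto
          have 1: "\<sigma> j * a j ?z * (u j ?z)\<^sup>2 \<le> M * A * ?S"
          proof -
            have "\<bar>\<sigma> j * a j ?z * (u j ?z)\<^sup>2\<bar> \<le> M * A * ?S"
              unfolding abs_mult by (intro mult_mono A z j) (use uS[OF j] M0 A0 in \<open>auto simp: \<sigma>_def\<close>)
            thus ?thesis by linarith
          qed
          have 2: "wt j x * dx strip (a j) ?z * (u j ?z)\<^sup>2 \<le> (1 + M) * A * ?S"
          proof -
            have "\<bar>wt j x * dx strip (a j) ?z * (u j ?z)\<^sup>2\<bar> \<le> (1 + M) * A * ?S"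
              unfolding abs_mult by (intro mult_mono A z j) (use uS[OF j] wt[OF x, of j] M0 A0 in auto)
            thus ?thesis by linarith
          qed
          have 3: "\<bar>2 * wt j x * u j ?z * (\<Sum>l=1..n. b j l ?z * u l ?z)\<bar> \<le> (1 + M) * Bb * (1 + real n) * ?S"
          proof -
            have "\<bar>2 * u j ?z * (\<Sum>l=1..n. b j l ?z * u l ?z)\<bar> = \<bar>\<Sum>l=1..n. b j l ?z * (2 * u j ?z * u l ?z)\<bar>"
              by (simp add: sum_distrib_left mult_ac)
            also have "\<dots> \<le> (\<Sum>l=1..n. \<bar>b j l ?z\<bar> * \<bar>2 * u j ?z * u l ?z\<bar>)"
              by (rule order_trans[OF sum_abs]) (simp add: abs_mult)
            also have "\<dots> \<le> (\<Sum>l=1..n. Bb * ((u j ?z)\<^sup>2 + (u l ?z)\<^sup>2))"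
            proof (intro sum_mono mult_mono Bb j z)
              fix l
              have "\<bar>2 * u j ?z * u l ?z\<bar> = 2 * \<bar>u j ?z\<bar> * \<bar>u l ?z\<bar>" by (simp add: abs_mult)
              also have "\<dots> \<le> \<bar>u j ?z\<bar>\<^sup>2 + \<bar>u l ?z\<bar>\<^sup>2" by (rule sum_squares_bound)
              finally show "\<bar>2 * u j ?z * u l ?z\<bar> \<le> (u j ?z)\<^sup>2 + (u l ?z)\<^sup>2" by simp
            qed (use Bb0 in auto)
            also have "\<dots> = Bb * (real n * (u j ?z)\<^sup>2 + ?S)"
              by (simp add: sum.distrib sum_distrib_left distrib_left)
            also have "\<dots> \<le> Bb * ((1 + real n) * ?S)"
              using uS[OF j] Bb0 by (intro mult_left_mono) (auto simp: distrib_right mult_left_mono)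
            finally have X: "\<bar>2 * u j ?z * (\<Sum>l=1..n. b j l ?z * u l ?z)\<bar> \<le> Bb * ((1 + real n) * ?S)" .
            have "\<bar>2 * wt j x * u j ?z * (\<Sum>l=1..n. b j l ?z * u l ?z)\<bar> =
              wt j x * \<bar>2 * u j ?z * (\<Sum>l=1..n. b j l ?z * u l ?z)\<bar>"
              using wt(1)[OF x, of j] by (simp add: abs_mult mult_ac)
            also have "\<dots> \<le> (1 + M) * (Bb * ((1 + real n) * ?S))"
              using wt[OF x, of j] X M0 by (intro mult_mono) auto
            finally show ?thesis by (simp only: mult.assoc)
          qed
          show "H j (x, s) \<le> C * ?S"
            unfolding H_def C_def fst_conv
              distrib_right[of "M * A + (1 + M) * A" _ ?S] distrib_right[of "M * A" _ ?S] using 1 2 3[unfolded abs_le_iff, THEN conjunct2] by linarith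
        qed auto
        also have "\<dots> = C * esq u s"
        proof -
          have "integral {0..1} (\<lambda>\<eta>. \<Sum>l=1..n. (u l (\<eta>, s))\<^sup>2) = (\<Sum>l=1..n. integral {0..1} (\<lambda>\<eta>. (u l (\<eta>, s))\<^sup>2))"
            by (intro Henstock_Kurzweil_Integration.integral_sum integrable_continuous_real cont_slice[OF sqc]) auto
          thus ?thesis by (simp add: prim_def esq_def)
        qed
        finally show ?thesis .
      qed
      have Gle: "- (G j 1 - G j 0) \<le> A * ((\<Sum>l=1..n. (p j l)\<^sup>2) * (\<Sum>l=1..n. (v l)\<^sup>2)) - (1 + M) * \<mu> * (v j)\<^sup>2"
        if j: "j \<in> {1..n}" for j
      proof -
        have bc: "(u j (bpt m j, s))\<^sup>2 \<le> (\<Sum>l=1..n. (p j l)\<^sup>2) * (\<Sum>l=1..n. (v l)\<^sup>2)"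
          unfolding solD(3)[OF u j s] Pop_eq v_def by (rule Cauchy_Schwarz_ineq_sum)
        have "- (G j 1 - G j 0) \<le> A * (u j (bpt m j, s))\<^sup>2 - (1 + M) * \<mu> * (v j)\<^sup>2"
        proof (cases "j \<le> m")
          case True
          have "a j (0, s) * (u j (0, s))\<^sup>2 \<le> A * (u j (0, s))\<^sup>2"
            using A(1)[OF j, of "(0, s)"] by (intro mult_right_mono) auto
          moreover have "(1 + M) * \<mu> * (u j (1, s))\<^sup>2 \<le> (1 + M) * a j (1, s) * (u j (1, s))\<^sup>2"
            using a_pos[OF j True, of "(1, s)"] M0 by (intro mult_right_mono mult_left_mono) auto
          ultimately show ?thesis using True by (simp add: G_def wt_def v_def bpt_def)
        next
          case False
          have "- a j (1, s) * (u j (1, s))\<^sup>2 \<le> A * (u j (1, s))\<^sup>2"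
            using A(1)[OF j, of "(1, s)"] by (intro mult_right_mono) auto
          moreover have "(1 + M) * \<mu> * (u j (0, s))\<^sup>2 \<le> (1 + M) * (- a j (0, s)) * (u j (0, s))\<^sup>2"
            using a_neg[OF j, of "(0, s)"] False M0 by (intro mult_right_mono mult_left_mono) auto
          ultimately show ?thesis using False by (simp add: G_def wt_def v_def bpt_def)
        qed
        also have "A * (u j (bpt m j, s))\<^sup>2 \<le> A * ((\<Sum>l=1..n. (p j l)\<^sup>2) * (\<Sum>l=1..n. (v l)\<^sup>2))"
          by (rule mult_left_mono[OF bc A0])
        finally show ?thesis by linarith
      qed
      have "(\<Sum>j=1..n. prim (k' j) (1, s)) = (\<Sum>j=1..n. - (G j 1 - G j 0) + prim (H j) (1, s))"
        by (intro sum.cong refl k'eq)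
      also have "\<dots> \<le> (\<Sum>j=1..n. (A * ((\<Sum>l=1..n. (p j l)\<^sup>2) * (\<Sum>l=1..n. (v l)\<^sup>2)) - (1 + M) * \<mu> * (v j)\<^sup>2) + C * esq u s)"
        by (intro sum_mono add_mono Gle Hle) auto
      also have "\<dots> = A * (Pq * (\<Sum>l=1..n. (v l)\<^sup>2)) - (1 + M) * \<mu> * (\<Sum>l=1..n. (v l)\<^sup>2) + K * esq u s"
        by (simp add: sum.distrib sum_subtractf Pq_def K_def flip: sum_distrib_left sum_distrib_right)
      also have "\<dots> \<le> K * esq u s"
      proof -
        have "A * Pq = M * \<mu>" using \<mu> by (simp add: M_def)
        hence "A * (Pq * (\<Sum>l=1..n. (v l)\<^sup>2)) = M * \<mu> * (\<Sum>l=1..n. (v l)\<^sup>2)"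
          by (simp only: mult.assoc[symmetric])
        moreover have "\<mu> * (\<Sum>l=1..n. (v l)\<^sup>2) \<ge> 0" using \<mu> by (intro mult_nonneg_nonneg sum_nonneg) auto
        moreover have "(1 + M) * \<mu> * (\<Sum>l=1..n. (v l)\<^sup>2) =
            \<mu> * (\<Sum>l=1..n. (v l)\<^sup>2) + M * \<mu> * (\<Sum>l=1..n. (v l)\<^sup>2)"
          by (simp only: distrib_right mult_1)
        ultimately show ?thesis by linarith
      qed
      also have "\<dots> \<le> K * E s" using esq_E[of s] K0 by (rule mult_left_mono)
      finally show ?thesis .
    qed
    have "E t * exp (- K * t) \<le> E \<tau> * exp (- K * \<tau>)"
    proof (rule DERIV_nonpos_imp_nonincreasing[OF t])
      fix s assume s: "\<tau> \<le> s" "s \<le> t"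
      have "((\<lambda>s. E s * exp (- K * s)) has_real_derivative
          ((\<Sum>j=1..n. prim (k' j) (1, s)) - K * E s) * exp (- K * s)) (at s)"
        by (rule derivative_eq_intros Ed refl)+ (simp add: algebra_simps)
      moreover have "((\<Sum>j=1..n. prim (k' j) (1, s)) - K * E s) * exp (- K * s) \<le> 0"
        using dle[OF s(1)] by (intro mult_nonpos_nonneg) auto
      ultimately show "\<exists>y. ((\<lambda>s. E s * exp (- K * s)) has_real_derivative y) (at s) \<and> y \<le> 0" by blast
    qed
    hence "E t \<le> exp (K * (t - \<tau>)) * E \<tau>"
      by (simp add: exp_diff right_diff_distrib exp_minus field_simps)
    also have "\<dots> \<le> exp (K * (t - \<tau>)) * ((1 + M) * esq u \<tau>)"
      by (intro mult_left_mono E_esq) auto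
    finally show "esq u t \<le> (1 + M) * exp (K * (t - \<tau>)) * esq u \<tau>"
      using esq_E[of t] by (simp add: mult_ac)
  qed
qed

text \<open>Cauchy-Schwarz on an interval of length 1, obtained by expanding the square of the
  deviation of \<open>\<bar>h\<bar>\<close> from its mean \<open>c\<close>.\<close>

lemma prim_abs_le_sqrt:
  assumes h: "continuous_on strip h"
  shows "prim (\<lambda>z. \<bar>h z\<bar>) (1, s) \<le> sqrt (prim (\<lambda>z. (h z)\<^sup>2) (1, s))"
proof -
  have hc: "continuous_on {0..1} (\<lambda>\<eta>. h (\<eta>, s))" by (rule cont_slice[OF h])
  define c where "c = integral {0..1} (\<lambda>\<eta>. \<bar>h (\<eta>, s)\<bar>)"
  have i1: "(\<lambda>\<eta>. \<bar>h (\<eta>, s)\<bar>) integrable_on {0..1}" "(\<lambda>\<eta>. (h (\<eta>, s))\<^sup>2) integrable_on {0..1}"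
    by (intro integrable_continuous_real continuous_intros hc)+
  have "0 \<le> integral {0..1} (\<lambda>\<eta>. (\<bar>h (\<eta>, s)\<bar> - c)\<^sup>2)"
    by (rule integral_nonneg) (auto intro!: integrable_continuous_real continuous_intros hc)
  also have "\<dots> = integral {0..1} (\<lambda>\<eta>. ((h (\<eta>, s))\<^sup>2 - 2 * c * \<bar>h (\<eta>, s)\<bar>) + c\<^sup>2)"
    by (intro integral_cong) (simp add: power2_diff mult_ac)
  also have "\<dots> = integral {0..1} (\<lambda>\<eta>. (h (\<eta>, s))\<^sup>2 - 2 * c * \<bar>h (\<eta>, s)\<bar>) + integral {0..1} (\<lambda>\<eta>::real. c\<^sup>2)"
    by (intro Henstock_Kurzweil_Integration.integral_add integrable_continuous_real continuous_intros hc)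
  also have "\<dots> = integral {0..1} (\<lambda>\<eta>. (h (\<eta>, s))\<^sup>2) - integral {0..1} (\<lambda>\<eta>. 2 * c * \<bar>h (\<eta>, s)\<bar>) + c\<^sup>2"
    by (subst Henstock_Kurzweil_Integration.integral_diff)
      (auto intro!: integrable_continuous_real continuous_intros hc)
  also have "\<dots> = integral {0..1} (\<lambda>\<eta>. (h (\<eta>, s))\<^sup>2) - c\<^sup>2"
    by (simp add: c_def[symmetric] power2_eq_square)
  finally show ?thesis
    unfolding prim_def case_prod_conv c_def[symmetric] by (intro real_le_rsqrt) linarith
qed

text \<open>The delay comes from the sup estimate alone and is uniform, while the constant may
  depend on both times through the exponential growth of the energy. This is the order of
  quantifiers that smoothing requires.\<close>

lemma classical_smoothing:
  "\<exists>T>0. \<forall>\<tau> t. \<tau> + T \<le> t \<longrightarrow> (\<exists>K\<ge>0. \<forall>u ux ut. sol \<tau> u ux ut \<longrightarrow>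
    (\<forall>j\<in>{1..n}. \<forall>x\<in>{0..1}. \<bar>u j (x, t)\<bar> \<le> K * sqrt (esq u \<tau>) \<and> \<bar>ux j (x, t)\<bar> \<le> K * sqrt (esq u \<tau>)))"
proof -
  obtain K R where K0: "K \<ge> 0" and R: "R > 0" and KR: "\<And>\<tau> u ux ut t\<^sub>0 S. sol \<tau> u ux ut \<Longrightarrow> \<tau> + R \<le> t\<^sub>0 \<Longrightarrow>
    (\<forall>k\<in>{1..n}. \<forall>s. t\<^sub>0 - R \<le> s \<longrightarrow> s \<le> t\<^sub>0 + R \<longrightarrow> prim (\<lambda>z. \<bar>u k z\<bar>) (1, s) \<le> S) \<Longrightarrow>
    (\<forall>j\<in>{1..n}. \<forall>x\<in>{0..1}. \<bar>u j (x, t\<^sub>0)\<bar> \<le> K * S \<and> \<bar>ut j (x, t\<^sub>0)\<bar> \<le> K * S)"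
    using sup_estimate by blast
  obtain G M where G0: "G \<ge> 0" and M0: "M \<ge> 0" and GM: "\<And>\<tau> u ux ut t. sol \<tau> u ux ut \<Longrightarrow> \<tau> \<le> t \<Longrightarrow>
    esq u t \<le> (1 + M) * exp (G * (t - \<tau>)) * esq u \<tau>"
    using energy_estimate by blast
  obtain Bb where Bb0: "Bb \<ge> 0" and Bb: "\<And>j k z. j \<in> {1..n} \<Longrightarrow> k \<in> {1..n} \<Longrightarrow> z \<in> strip \<Longrightarrow> \<bar>b j k z\<bar> \<le> Bb"
    using b_bound by blast
  show ?thesis
  proof (rule exI[of _ R], intro conjI R allI impI)
    fix \<tau> t assume late: "\<tau> + R \<le> t"
    \<comment> \<open>The sup estimate at \<open>t\<close> looks at time slices up to
      \<open>t + R\<close>, so the growth of the energy is evaluated there.\<close>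
    define c where "c = sqrt ((1 + M) * exp (G * (t + R - \<tau>)))"
    have c0: "c \<ge> 0" using M0 by (simp add: c_def)
    define K' where "K' = K * c + (K * c + real n * (Bb * (K * c))) / \<mu>"
    have K'0: "K' \<ge> 0" unfolding K'_def using K0 c0 Bb0 \<mu> by auto
    show "\<exists>K\<ge>0. \<forall>u ux ut. sol \<tau> u ux ut \<longrightarrow>
      (\<forall>j\<in>{1..n}. \<forall>x\<in>{0..1}. \<bar>u j (x, t)\<bar> \<le> K * sqrt (esq u \<tau>) \<and> \<bar>ux j (x, t)\<bar> \<le> K * sqrt (esq u \<tau>))"
    proof (rule exI[of _ K'], intro conjI K'0 allI impI ballI)
      fix u ux ut assume u: "sol \<tau> u ux ut"
      let ?e = "sqrt (esq u \<tau>)"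
      have e0: "esq u \<tau> \<ge> 0" unfolding esq_def by (intro sum_nonneg prim_sq_nonneg sol_cont[OF u])
      have est: "\<forall>j\<in>{1..n}. \<forall>x\<in>{0..1}. \<bar>u j (x, t)\<bar> \<le> K * (c * ?e) \<and> \<bar>ut j (x, t)\<bar> \<le> K * (c * ?e)"
      proof (rule KR[OF u late], intro ballI allI impI)
        fix k s assume k: "k \<in> {1..n}" and s: "t - R \<le> s" "s \<le> t + R"
        have "prim (\<lambda>z. \<bar>u k z\<bar>) (1, s) \<le> sqrt (prim (\<lambda>z. (u k z)\<^sup>2) (1, s))"
          by (rule prim_abs_le_sqrt[OF sol_cont[OF u k]])
        also have "\<dots> \<le> sqrt (esq u s)"
          unfolding esq_def real_sqrt_le_iff
          by (rule member_le_sum[of k "{1..n}" "\<lambda>k. prim (\<lambda>z. (u k z)\<^sup>2) (1, s)"])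
            (use k prim_sq_nonneg sol_cont[OF u] in auto)
        also have "\<dots> \<le> sqrt ((1 + M) * exp (G * (t + R - \<tau>)) * esq u \<tau>)"
        proof -
          have "esq u s \<le> (1 + M) * exp (G * (s - \<tau>)) * esq u \<tau>" by (rule GM[OF u]) (use s late in linarith)
          also have "\<dots> \<le> (1 + M) * exp (G * (t + R - \<tau>)) * esq u \<tau>"
            using s M0 G0 e0 by (intro mult_right_mono mult_left_mono) (auto intro!: mult_left_mono)
          finally show ?thesis by simp
        qed
        also have "\<dots> = c * ?e" by (simp add: c_def real_sqrt_mult)
        finally show "prim (\<lambda>z. \<bar>u k z\<bar>) (1, s) \<le> c * ?e" .
      qed
      fix j x assume j: "j \<in> {1..n}" and x: "x \<in> {0..1::real}"
      have z: "(x, t) \<in> strip" using x by simp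
      have ex: "?e \<ge> 0" using e0 by simp
      have "K * c * ?e \<le> K' * ?e"
        unfolding K'_def using K0 c0 Bb0 \<mu> ex by (intro mult_right_mono) auto
      thus "\<bar>u j (x, t)\<bar> \<le> K' * ?e" using est j x by (force simp: mult.assoc)
      have pde: "a j (x, t) * ux j (x, t) = - (ut j (x, t) + (\<Sum>k=1..n. b j k (x, t) * u k (x, t)))"
        using solD(2)[OF u j x, of t] late R by linarith
      \<comment> \<open>The speed is bounded away from 0, so the equation can be solved for the
        space derivative.\<close>
      have "\<mu> * \<bar>ux j (x, t)\<bar> \<le> \<bar>a j (x, t)\<bar> * \<bar>ux j (x, t)\<bar>"
        by (intro mult_right_mono a_abs j z) auto
      also have "\<dots> = \<bar>ut j (x, t) + (\<Sum>k=1..n. b j k (x, t) * u k (x, t))\<bar>"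
        unfolding abs_mult[symmetric] pde by simp
      also have "\<dots> \<le> K * (c * ?e) + (\<Sum>k=1..n. Bb * (K * (c * ?e)))"
      proof (rule order_trans[OF abs_triangle_ineq add_mono])
        show "\<bar>ut j (x, t)\<bar> \<le> K * (c * ?e)" using est j x by blast
        show "\<bar>\<Sum>k=1..n. b j k (x, t) * u k (x, t)\<bar> \<le> (\<Sum>k=1..n. Bb * (K * (c * ?e)))"
          by (rule order_trans[OF sum_abs], rule sum_mono, unfold abs_mult, intro mult_mono Bb j z)
            (use est x Bb0 in auto)
      qed
      also have "\<dots> = \<mu> * ((K * c + real n * (Bb * (K * c))) / \<mu> * ?e)"
        using \<mu> by (simp add: field_simps)
      finally have "\<bar>ux j (x, t)\<bar> \<le> (K * c + real n * (Bb * (K * c))) / \<mu> * ?e"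
        using \<mu> by (simp only: mult_le_cancel_left_pos)
      also have "\<dots> \<le> K' * ?e"
        unfolding K'_def using K0 c0 ex by (intro mult_right_mono) auto
      finally show "\<bar>ux j (x, t)\<bar> \<le> K' * ?e" .
    qed
  qed
qed

end

section \<open>Extension across the initial time\<close>

text \<open>
  The extension is \<open>v s\<close> for \<open>s \<ge> \<tau>\<close> and \<open>2 v \<tau> - v (2 \<tau> - s)\<close> before.
\<close>
lemma odd_extension_derivative:
  fixes v v' :: "real \<Rightarrow> real"
  assumes v: "\<And>s. s \<ge> \<tau> \<Longrightarrow> (v has_real_derivative v' s) (at s within {\<tau>..})"
  shows "((\<lambda>s. v (max s \<tau>) + v \<tau> - v (max (2 * \<tau> - s) \<tau>)) has_real_derivative v' (\<tau> + \<bar>s - \<tau>\<bar>)) (at s)"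
proof -
  \<comment> \<open>For \<open>s \<ge> \<tau>\<close> the last two terms cancel; for
    \<open>s \<le> \<tau>\<close> the first becomes \<open>v \<tau>\<close>. The maxima ensure that
    \<open>v\<close> is never read before \<open>\<tau>\<close>.\<close>
  let ?V = "\<lambda>s. v (max s \<tau>) + v \<tau> - v (max (2 * \<tau> - s) \<tau>)"
  have up: "(?V has_real_derivative v' s) (at s within {\<tau>..})" if s: "s \<ge> \<tau>" for s
    using v[OF s]
    by (rule has_field_derivative_transform_within[OF _ zero_less_one]) (use s in \<open>auto simp: max_def\<close>)
  have down: "(?V has_real_derivative v' (2 * \<tau> - s)) (at s within {..\<tau>})" if s: "s \<le> \<tau>" for s
  proof -
    have r: "((\<lambda>s. 2 * \<tau> - s) has_real_derivative - 1) (at s within {..\<tau>})"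
      by (auto intro!: derivative_eq_intros)
    have "(v has_real_derivative v' (2 * \<tau> - s)) (at (2 * \<tau> - s) within (\<lambda>s. 2 * \<tau> - s) ` {..\<tau>})"
      by (rule has_field_derivative_subset[OF v]) (use s in auto)
    from DERIV_image_chain[OF this r]
    have "((\<lambda>s. 2 * v \<tau> - v (2 * \<tau> - s)) has_real_derivative v' (2 * \<tau> - s)) (at s within {..\<tau>})"
      by (auto intro!: derivative_eq_intros simp: o_def)
    thus ?thesis
      by (rule has_field_derivative_transform_within[OF _ zero_less_one]) (use s in \<open>auto simp: max_def\<close>)
  qed
  consider "s > \<tau>" | "s < \<tau>" | "s = \<tau>" by linarith
  thus ?thesis
  proof cases
    case 1
    have "at s within {\<tau>..} = at s" using 1 by (intro at_within_interior) auto
    thus ?thesis using up[of s] 1 by simp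
  next
    case 2
    have "at s within {..\<tau>} = at s" using 2 by (intro at_within_interior) auto
    moreover have "\<tau> + \<bar>s - \<tau>\<bar> = 2 * \<tau> - s" using 2 by simp
    ultimately show ?thesis using down[of s] 2 by simp
  next
    case 3
    \<comment> \<open>The odd reflection has the same slope \<open>v' \<tau>\<close> on both sides,
      so the one-sided limits of the difference quotient combine.\<close>
    have "{..\<tau>} \<union> {\<tau>..} = (UNIV :: real set)" by auto
    thus ?thesis
      using up[of \<tau>] down[of \<tau>] 3 Lim_Un[of "\<lambda>y. (?V y - ?V \<tau>) / (y - \<tau>)" "v' \<tau>" \<tau> "{..\<tau>}" "{\<tau>..}"]
      unfolding has_field_derivative_iff by simp
  qed
qed

lemma strip_from_slices:
  "x \<in> {0..1} \<Longrightarrow> {s. (x, s) \<in> strip_from \<tau>} = {\<tau>..}" "t \<ge> \<tau> \<Longrightarrow> {\<xi>. (\<xi>, t) \<in> strip_from \<tau>} = {0..1}"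
  by (auto simp: strip_from_def)

text \<open>Reflection acts on \<open>t\<close> linearly, so the \<open>x\<close>-derivative of the
  extension is the extension of the \<open>x\<close>-derivative, whereas the
  \<open>t\<close>-derivative is reflected evenly. Both are continuous across the initial time,
  which lets the calculus on the full strip be applied.\<close>

lemma C1_extension:
  assumes u: "u \<in> C1_on (strip_from \<tau>)"
  shows "\<exists>U Ux Ut. C1_strip U Ux Ut \<and> (\<forall>x t. x \<in> {0..1} \<longrightarrow> t \<ge> \<tau> \<longrightarrow> U (x, t) = u (x, t) \<and>
    Ux (x, t) = dx (strip_from \<tau>) u (x, t) \<and> Ut (x, t) = dt (strip_from \<tau>) u (x, t))"
proof -
  let ?D = "strip_from \<tau>"
  have c: "continuous_on ?D u" "continuous_on ?D (dx ?D u)" "continuous_on ?D (dt ?D u)"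
    using u by (auto simp: C1_on_def)
  have diff: "(\<lambda>\<xi>. u (\<xi>, t)) differentiable (at x within {0..1})" "(\<lambda>s. u (x, s)) differentiable (at t within {\<tau>..})"
    if "x \<in> {0..1}" "t \<ge> \<tau>" for x t
  proof -
    have "(x, t) \<in> ?D" using that by (simp add: strip_from_def)
    thus "(\<lambda>\<xi>. u (\<xi>, t)) differentiable (at x within {0..1})" "(\<lambda>s. u (x, s)) differentiable (at t within {\<tau>..})"
      using u unfolding C1_on_def strip_from_slices(1)[OF that(1), symmetric] strip_from_slices(2)[OF that(2), symmetric]
      by fastforce+
  qed
  have ux: "((\<lambda>\<xi>. u (\<xi>, t)) has_real_derivative dx ?D u (x, t)) (at x within {0..1})" if "x \<in> {0..1}" "t \<ge> \<tau>" for x t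
    using diff(1)[OF that] strip_from_slices(2)[OF that(2)]
    by (simp add: dx_def vector_derivative_works has_real_derivative_iff_has_vector_derivative)
  have ut: "((\<lambda>s. u (x, s)) has_real_derivative dt ?D u (x, t)) (at t within {\<tau>..})" if "x \<in> {0..1}" "t \<ge> \<tau>" for x t
    using diff(2)[OF that] strip_from_slices(1)[OF that(1)]
    by (simp add: dt_def vector_derivative_works has_real_derivative_iff_has_vector_derivative)
  have cc: "continuous_on strip (\<lambda>z. h (fst z, g z))" if "continuous_on ?D h" "continuous_on strip g" "\<And>z. g z \<ge> \<tau>"
    for h :: "real \<times> real \<Rightarrow> real" and g :: "real \<times> real \<Rightarrow> real"
    by (rule continuous_on_compose2[OF that(1)])
      (use that(2,3) in \<open>auto intro!: continuous_intros simp: strip_from_def strip_def\<close>)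
  define ext where "ext = (\<lambda>(h :: real \<times> real \<Rightarrow> real) (z :: real \<times> real). h (fst z, max (snd z) \<tau>) + h (fst z, \<tau>) - h (fst z, max (2 * \<tau> - snd z) \<tau>))"
  have oddc: "continuous_on strip (ext h)" if "continuous_on ?D h" for h
    unfolding ext_def by (intro continuous_on_add continuous_on_diff cc that continuous_intros) auto
  define Ut where "Ut = (\<lambda>z. dt ?D u (fst z, \<tau> + \<bar>snd z - \<tau>\<bar>))"
  have "has_dx (ext u) (ext (dx ?D u))"
    unfolding has_dx_def ext_def fst_conv snd_conv by (intro ballI allI DERIV_add DERIV_diff ux) auto
  moreover have "has_dt (ext u) Ut"
    unfolding has_dt_def ext_def Ut_def fst_conv snd_conv
    by (intro ballI allI odd_extension_derivative ut)
  moreover have "continuous_on strip Ut"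
    unfolding Ut_def by (intro cc c continuous_intros) auto
  ultimately have "C1_strip (ext u) (ext (dx ?D u)) Ut" using oddc c by (auto simp: C1_strip_def)
  moreover have "ext h (x, t) = h (x, t)" if "t \<ge> \<tau>" for h x t using that by (auto simp: ext_def max_def)
  moreover have "Ut (x, t) = dt ?D u (x, t)" if "t \<ge> \<tau>" for x t using that by (auto simp: Ut_def)
  ultimately show ?thesis by blast
qed

context hyperbolic
begin

text \<open>A classical solution satisfies the equation in the open half strip; continuity of all
  terms carries it to the boundary and to the initial time, as the integration along whole
  characteristics requires.\<close>

lemma classical_imp_sol:
  assumes u: "classical_solution m n a b p \<tau> \<phi> u"
  shows "\<exists>U Ux Ut. sol \<tau> U Ux Ut \<and> (\<forall>j\<in>{1..n}. \<forall>x\<in>{0..1}. \<forall>t\<ge>\<tau>. U j (x, t) = u j (x, t))"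
proof -
  let ?D = "strip_from \<tau>"
  have "\<forall>j\<in>{1..n}. \<exists>U. C1_strip (fst U) (fst (snd U)) (snd (snd U)) \<and> (\<forall>x t. x \<in> {0..1} \<longrightarrow> t \<ge> \<tau> \<longrightarrow> fst U (x, t) = u j (x, t) \<and>
    fst (snd U) (x, t) = dx (strip_from \<tau>) (u j) (x, t) \<and> snd (snd U) (x, t) = dt (strip_from \<tau>) (u j) (x, t))"
    using C1_extension[of "u _" \<tau>] u unfolding classical_solution_def by (simp add: split_paired_Ex)
  then obtain V where V: "\<And>j. j \<in> {1..n} \<Longrightarrow> C1_strip (fst (V j)) (fst (snd (V j))) (snd (snd (V j)))"
    "\<And>j x t. j \<in> {1..n} \<Longrightarrow> x \<in> {0..1} \<Longrightarrow> t \<ge> \<tau> \<Longrightarrow> fst (V j) (x, t) = u j (x, t) \<and>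
    fst (snd (V j)) (x, t) = dx (strip_from \<tau>) (u j) (x, t) \<and> snd (snd (V j)) (x, t) = dt (strip_from \<tau>) (u j) (x, t)"
    by (metis (no_types, lifting) bchoice)
  define U Ux Ut where "U = (\<lambda>j. fst (V j))" and "Ux = (\<lambda>j. fst (snd (V j)))" and "Ut = (\<lambda>j. snd (snd (V j)))"
  have C: "C1_strip (U j) (Ux j) (Ut j)" if "j \<in> {1..n}" for j using V(1)[OF that] by (simp add: U_def Ux_def Ut_def)
  have eq: "U j (x, t) = u j (x, t)" "Ux j (x, t) = dx ?D (u j) (x, t)" "Ut j (x, t) = dt ?D (u j) (x, t)"
    if "j \<in> {1..n}" "x \<in> {0..1}" "t \<ge> \<tau>" for j x t using V(2)[OF that] by (auto simp: U_def Ux_def Ut_def)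
  have "Ut j (x, t) + a j (x, t) * Ux j (x, t) + (\<Sum>k=1..n. b j k (x, t) * U k (x, t)) = 0"
    if j: "j \<in> {1..n}" and x: "x \<in> {0..1}" and t: "t \<ge> \<tau>" for j x t
  proof -
    let ?F = "\<lambda>z. Ut j z + a j z * Ux j z + (\<Sum>k=1..n. b j k z * U k z)"
    let ?S = "{0<..<1::real} \<times> {\<tau><..}"
    have cl: "closure ?S = {0..1} \<times> {\<tau>..}" by (simp add: closure_Times)
    have "continuous_on strip ?F"
      using C C[OF j] aBC[OF j] bBC[OF j] unfolding C1_strip_def BC1_strip_def
      by (intro continuous_on_add continuous_on_mult continuous_on_sum) auto
    hence "continuous_on (closure ?S) ?F"
      by (rule continuous_on_subset) (auto simp: cl strip_def)
    moreover have "?F z = 0" if zS: "z \<in> ?S" for z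
    proof -
      obtain y s where z: "z = (y, s)" "0 < y" "y < 1" "\<tau> < s" using zS by (cases z) auto
      have "dt ?D (u j) (y, s) + a j (y, s) * dx ?D (u j) (y, s) + (\<Sum>k=1..n. b j k (y, s) * u k (y, s)) = 0"
        using u j z unfolding classical_solution_def by blast
      moreover have "(\<Sum>k=1..n. b j k (y, s) * U k (y, s)) = (\<Sum>k=1..n. b j k (y, s) * u k (y, s))"
        using z by (intro sum.cong refl) (simp add: eq)
      ultimately show ?thesis using eq[OF j, of y s] z by simp
    qed
    moreover have "(x, t) \<in> closure ?S" using x t by (simp add: cl)
    ultimately show ?thesis by (rule continuous_constant_on_closure)
  qed
  moreover have "U j (bpt m j, t) = Pop m n p U j t" if j: "j \<in> {1..n}" and t: "t \<ge> \<tau>" for j t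
  proof -
    have "Pop m n p U j t = Pop m n p u j t"
      unfolding Pop_eq by (intro sum.cong refl arg_cong2[where f = "(*)"] eq y01 t) auto
    thus ?thesis using u j t eq(1)[OF j y01(1) t] unfolding classical_solution_def by simp
  qed
  ultimately have "sol \<tau> U Ux Ut" using C by (auto simp: sol_def)
  thus ?thesis using eq by blast
qed

lemma sol_diff:
  assumes u: "sol \<tau> u ux ut" and v: "sol \<tau> v vx vt"
  shows "sol \<tau> (\<lambda>j z. u j z - v j z) (\<lambda>j z. ux j z - vx j z) (\<lambda>j z. ut j z - vt j z)"
  unfolding sol_def
proof (intro ballI conjI allI impI)
  fix j assume j: "j \<in> {1..n}"
  show "C1_strip (\<lambda>z. u j z - v j z) (\<lambda>z. ux j z - vx j z) (\<lambda>z. ut j z - vt j z)"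
    using solD(1)[OF u j] solD(1)[OF v j] unfolding C1_strip_def has_dx_def has_dt_def
    by (auto intro!: continuous_on_diff DERIV_diff)
  fix t assume t: "\<tau> \<le> t"
  show "u j (bpt m j, t) - v j (bpt m j, t) = Pop m n p (\<lambda>j z. u j z - v j z) j t"
    using solD(3)[OF u j t] solD(3)[OF v j t] by (simp add: Pop_eq right_diff_distrib sum_subtractf)
next
  fix j x t assume j: "j \<in> {1..n}" and x: "x \<in> {0..1::real}" and t: "\<tau> \<le> t"
  show "ut j (x, t) - vt j (x, t) + a j (x, t) * (ux j (x, t) - vx j (x, t)) +
      (\<Sum>k = 1..n. b j k (x, t) * (u k (x, t) - v k (x, t))) = 0"
    using solD(2)[OF u j x t] solD(2)[OF v j x t] by (simp add: right_diff_distrib sum_subtractf)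
qed

end

section \<open>Square integrable tuples\<close>

abbreviation "M01 \<equiv> lebesgue_on {0<..<1::real}"

lemma M01_finite: "finite_measure M01"
  by (rule finite_measure_lebesgue_on) simp

lemma continuous_M01:
  assumes f: "continuous_on {0..1} (f :: real \<Rightarrow> real)"
  shows "f \<in> borel_measurable M01" "integrable M01 f" "integral\<^sup>L M01 f = integral {0..1} f"
proof -
  show m: "f \<in> borel_measurable M01"
    by (rule continuous_imp_measurable_on_sets_lebesgue[OF continuous_on_subset[OF f]]) auto
  have "bounded (f ` {0..1})" by (intro compact_imp_bounded compact_continuous_image f) auto
  then obtain B where "\<forall>x\<in>{0..1}. \<bar>f x\<bar> \<le> B" by (auto simp: bounded_iff)
  hence "AE x in M01. norm (f x) \<le> B" by (intro AE_I2) auto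
  thus i: "integrable M01 f" by (rule finite_measure.integrable_const_bound[OF M01_finite _ m])
  show "integral\<^sup>L M01 f = integral {0..1} f"
    using lebesgue_integral_eq_integral[OF i] by (simp add: integral_open_interval_real)
qed

lemma L2_iff:
  "f \<in> pts (L2 n) \<longleftrightarrow> (\<forall>j\<in>{1..n}. f j \<in> borel_measurable M01 \<and> integrable M01 (\<lambda>x. (f j x)\<^sup>2))"
  by (simp add: L2_def)

lemma L2_component_le: "j \<in> {1..n} \<Longrightarrow> sqrt (LINT x|M01. (f j x)\<^sup>2) \<le> nrm (L2 n) f"
  by (simp add: L2_def)

lemma nrm_L2_le:
  assumes "n \<ge> 1" "c \<ge> 0" "\<And>j. j \<in> {1..n} \<Longrightarrow> (LINT x|M01. (f j x)\<^sup>2) \<le> c\<^sup>2"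
  shows "nrm (L2 n) f \<le> c"
  using assms by (auto simp: L2_def intro!: real_le_lsqrt)

lemma nrm_L2_nonneg:
  assumes "n \<ge> 1"
  shows "nrm (L2 n) f \<ge> 0"
  by (rule order_trans[OF _ L2_component_le[of 1]]) (use assms in auto)

lemma L2_square_le:
  assumes "j \<in> {1..n}"
  shows "(LINT x|M01. (f j x)\<^sup>2) \<le> (nrm (L2 n) f)\<^sup>2"
  using L2_component_le[OF assms, of f] by (intro sqrt_le_D) auto

lemma nrm_L2_cong:
  assumes "\<And>j x. j \<in> {1..n} \<Longrightarrow> x \<in> {0<..<1} \<Longrightarrow> f j x = g j x"
  shows "nrm (L2 n) f = nrm (L2 n) g"
proof -
  have "(LINT x|M01. (f j x)\<^sup>2) = (LINT x|M01. (g j x)\<^sup>2)" if "j \<in> {1..n}" for j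
    by (rule Bochner_Integration.integral_cong) (use assms that in auto)
  hence "(\<lambda>j. sqrt (LINT x|M01. (f j x)\<^sup>2)) ` {1..n} = (\<lambda>j. sqrt (LINT x|M01. (g j x)\<^sup>2)) ` {1..n}"
    by (intro image_cong refl arg_cong[where f = sqrt])
  thus ?thesis by (simp only: L2_def nspace.select_convs)
qed

text \<open>The triangle inequality up to a factor 2, from
  \<open>(r + s)^2 \<le> 2 r^2 + 2 s^2\<close>. In this form it also yields membership in the space,
  and the factor is harmless for limits and bounds.\<close>

lemma L2_dominated:
  assumes n: "n \<ge> 1" and f: "f \<in> pts (L2 n)" and g: "g \<in> pts (L2 n)"
    and h: "\<And>j. j \<in> {1..n} \<Longrightarrow> h j \<in> borel_measurable M01"
    and le: "\<And>j x. j \<in> {1..n} \<Longrightarrow> x \<in> {0<..<1} \<Longrightarrow> \<bar>h j x\<bar> \<le> \<bar>f j x\<bar> + \<bar>g j x\<bar>"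
  shows "h \<in> pts (L2 n)" "nrm (L2 n) h \<le> 2 * (nrm (L2 n) f + nrm (L2 n) g)"
proof -
  have sq: "(h j x)\<^sup>2 \<le> 2 * (f j x)\<^sup>2 + 2 * (g j x)\<^sup>2" if "j \<in> {1..n}" "x \<in> {0<..<1}" for j x
  proof -
    have "(h j x)\<^sup>2 \<le> (\<bar>f j x\<bar> + \<bar>g j x\<bar>)\<^sup>2"
      unfolding power2_abs[of "h j x", symmetric] by (intro power_mono le that) auto
    also have "\<dots> \<le> 2 * (f j x)\<^sup>2 + 2 * (g j x)\<^sup>2"
      using sum_squares_bound[of "\<bar>f j x\<bar>" "\<bar>g j x\<bar>"] by (simp add: power2_sum)
    finally show ?thesis .
  qed
  have i: "integrable M01 (\<lambda>x. 2 * (f j x)\<^sup>2 + 2 * (g j x)\<^sup>2)" if "j \<in> {1..n}" for j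
    using f g that by (auto simp: L2_iff)
  have hi: "integrable M01 (\<lambda>x. (h j x)\<^sup>2)" if "j \<in> {1..n}" for j
    by (rule Bochner_Integration.integrable_bound[OF i[OF that]])
      (use h[OF that] sq[OF that] in \<open>auto intro!: AE_I2 borel_measurable_power\<close>)
  thus "h \<in> pts (L2 n)" using h by (simp add: L2_iff)
  let ?F = "nrm (L2 n) f" and ?G = "nrm (L2 n) g"
  note nn = nrm_L2_nonneg[OF n]
  show "nrm (L2 n) h \<le> 2 * (?F + ?G)"
  proof (rule nrm_L2_le[OF n])
    fix j assume j: "j \<in> {1..n}"
    have "(LINT x|M01. (h j x)\<^sup>2) \<le> (LINT x|M01. 2 * (f j x)\<^sup>2 + 2 * (g j x)\<^sup>2)"
      by (rule integral_mono[OF hi[OF j] i[OF j]]) (use sq[OF j] in auto)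
    also have "\<dots> = 2 * (LINT x|M01. (f j x)\<^sup>2) + 2 * (LINT x|M01. (g j x)\<^sup>2)"
      using f g j by (auto simp: L2_iff)
    also have "\<dots> \<le> 2 * ?F\<^sup>2 + 2 * ?G\<^sup>2" using L2_square_le[OF j] by (intro add_mono mult_left_mono) auto
    also have "\<dots> \<le> (2 * (?F + ?G))\<^sup>2"
      using mult_nonneg_nonneg[OF nn nn, of f g] by (simp add: power2_eq_square algebra_simps)
    finally show "(LINT x|M01. (h j x)\<^sup>2) \<le> (2 * (?F + ?G))\<^sup>2" .
  qed (use nn in auto)
qed

lemma L2_add: "n \<ge> 1 \<Longrightarrow> f \<in> pts (L2 n) \<Longrightarrow> g \<in> pts (L2 n) \<Longrightarrow> (\<lambda>j x. f j x + g j x) \<in> pts (L2 n)"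
  by (rule L2_dominated(1)[of n f g]) (auto simp: L2_iff intro: abs_triangle_ineq borel_measurable_add)

lemma L2_diff: "n \<ge> 1 \<Longrightarrow> f \<in> pts (L2 n) \<Longrightarrow> g \<in> pts (L2 n) \<Longrightarrow> (\<lambda>j x. f j x - g j x) \<in> pts (L2 n)"
  by (rule L2_dominated(1)[of n f g]) (auto simp: L2_iff intro: abs_triangle_ineq4 borel_measurable_diff)

lemma L2_scale: "f \<in> pts (L2 n) \<Longrightarrow> (\<lambda>j x. r * f j x) \<in> pts (L2 n)"
  by (auto simp: L2_iff power_mult_distrib)

lemma ndist_L2_commute: "ndist (L2 n) f g = ndist (L2 n) g f"
  by (simp add: ndist_def L2_def power2_commute)

lemma ndist_L2_triangle:
  assumes n: "n \<ge> 1" and f: "f \<in> pts (L2 n)" "g \<in> pts (L2 n)" "h \<in> pts (L2 n)"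
  shows "ndist (L2 n) f h \<le> 2 * (ndist (L2 n) f g + ndist (L2 n) g h)"
  unfolding ndist_def
  by (rule L2_dominated(2)[OF n L2_diff[OF n f(1,2)] L2_diff[OF n f(2,3)]])
    (use f in \<open>auto simp: L2_iff intro!: borel_measurable_add borel_measurable_diff\<close>)

lemma nrm_L2_triangle:
  assumes n: "n \<ge> 1" and f: "f \<in> pts (L2 n)" "g \<in> pts (L2 n)"
  shows "nrm (L2 n) f \<le> 2 * (nrm (L2 n) g + ndist (L2 n) f g)"
  unfolding ndist_def
  by (rule L2_dominated(2)[OF n f(2) L2_diff[OF n f]]) (use f in \<open>auto simp: L2_iff intro!: borel_measurable_add borel_measurable_diff\<close>)

lemma same_L2_sym: "same (L2 n) f g \<Longrightarrow> same (L2 n) g f"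
  by (simp add: same_def ndist_L2_commute)

lemma same_L2_trans:
  assumes n: "n \<ge> 1" and f: "f \<in> pts (L2 n)" "g \<in> pts (L2 n)" "h \<in> pts (L2 n)"
    and s: "same (L2 n) f g" "same (L2 n) g h"
  shows "same (L2 n) f h"
  using ndist_L2_triangle[OF n f] s nrm_L2_nonneg[OF n, of "\<lambda>j x. f j x - h j x"]
  by (simp add: same_def ndist_def)

lemma same_L2_add:
  assumes n: "n \<ge> 1" and f: "f \<in> pts (L2 n)" "f' \<in> pts (L2 n)" "g \<in> pts (L2 n)" "g' \<in> pts (L2 n)"
    and s: "same (L2 n) f f'" "same (L2 n) g g'"
  shows "same (L2 n) (\<lambda>j x. f j x + g j x) (\<lambda>j x. f' j x + g' j x)"
proof -
  have "nrm (L2 n) (\<lambda>j x. (f j x + g j x) - (f' j x + g' j x)) \<le>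
      2 * (nrm (L2 n) (\<lambda>j x. f j x - f' j x) + nrm (L2 n) (\<lambda>j x. g j x - g' j x))"
    by (rule L2_dominated(2)[OF n L2_diff[OF n f(1,2)] L2_diff[OF n f(3,4)]])
      (use f in \<open>auto simp: L2_iff intro!: borel_measurable_add borel_measurable_diff\<close>)
  thus ?thesis
    using s nrm_L2_nonneg[OF n, of "\<lambda>j x. (f j x + g j x) - (f' j x + g' j x)"]
    by (simp add: same_def ndist_def)
qed

lemma same_L2_scale:
  assumes s: "same (L2 n) f g"
  shows "same (L2 n) (\<lambda>j x. r * f j x) (\<lambda>j x. r * g j x)"
proof (cases "n = 0")
  case False
  have "(LINT x|M01. (r * f j x - r * g j x)\<^sup>2) = 0" if j: "j \<in> {1..n}" for j
  proof -
    have "(LINT x|M01. (f j x - g j x)\<^sup>2) \<le> 0"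
      using L2_square_le[OF j, of "\<lambda>j x. f j x - g j x"] s by (simp add: same_def ndist_def)
    hence "(LINT x|M01. (f j x - g j x)\<^sup>2) = 0" by (intro antisym integral_nonneg_AE) auto
    thus ?thesis by (simp add: power_mult_distrib flip: right_diff_distrib)
  qed
  hence "nrm (L2 n) (\<lambda>j x. r * f j x - r * g j x) \<le> 0" using False by (intro nrm_L2_le) auto
  thus ?thesis using nrm_L2_nonneg[of n "\<lambda>j x. r * f j x - r * g j x"] False
    by (simp add: same_def ndist_def)
\<comment> \<open>For \<open>n = 0\<close> the norm is \<open>Max {}\<close> for every argument, so
  the claim coincides with the assumption.\<close>
qed (use s in \<open>simp add: same_def ndist_def L2_def\<close>)

lemma continuous_in_L2:
  assumes "\<And>j. j \<in> {1..n} \<Longrightarrow> continuous_on {0..1} (f j)"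
  shows "f \<in> pts (L2 n)"
  using assms continuous_M01(1) continuous_M01(2)[OF continuous_on_power] by (auto simp: L2_iff)

lemma nrm_L2_le_sup:
  assumes n: "n \<ge> 1" and f: "f \<in> pts (L2 n)" and B: "B \<ge> 0"
    and le: "\<And>j x. j \<in> {1..n} \<Longrightarrow> x \<in> {0<..<1} \<Longrightarrow> \<bar>f j x\<bar> \<le> B"
  shows "nrm (L2 n) f \<le> B"
proof (rule nrm_L2_le[OF n B])
  fix j assume j: "j \<in> {1..n}"
  have "(LINT x|M01. (f j x)\<^sup>2) \<le> (LINT x|M01. B\<^sup>2)"
  proof (rule integral_mono)
    fix x assume "x \<in> space M01"
    hence "\<bar>f j x\<bar> \<le> B" using le[OF j] by simp
    thus "(f j x)\<^sup>2 \<le> B\<^sup>2" by (rule abs_le_square_iff[THEN iffD1, OF order_trans]) simp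
  qed (use f j continuous_M01(2)[OF continuous_on_const] in \<open>auto simp: L2_iff\<close>)
  also have "\<dots> = B\<^sup>2" using continuous_M01(3)[OF continuous_on_const, of "B\<^sup>2"] by simp
  finally show "(LINT x|M01. (f j x)\<^sup>2) \<le> B\<^sup>2" .
qed

text \<open>A continuous nonnegative function with integral 0 vanishes. Each L^2 class thus has at
  most one continuous representative on [0,1], which will make the selected representatives
  linear.\<close>

lemma same_L2_continuous_eq:
  assumes s: "same (L2 n) f g" and j: "j \<in> {1..n}" and x: "x \<in> {0..1}"
    and c: "continuous_on {0..1} (f j)" "continuous_on {0..1} (g j)"
  shows "f j x = g j x"
proof -
  have cc: "continuous_on {0..1} (\<lambda>x. (f j x - g j x)\<^sup>2)" by (intro continuous_intros c)
  have "integral {0..1} (\<lambda>x. (f j x - g j x)\<^sup>2) \<le> 0"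
    using L2_square_le[OF j, of "\<lambda>j x. f j x - g j x"] s continuous_M01(3)[OF cc]
    by (simp add: same_def ndist_def)
  moreover have "integral {0..1} (\<lambda>x. (f j x - g j x)\<^sup>2) \<ge> 0"
    by (rule integral_nonneg) (auto intro!: integrable_continuous_real cc)
  ultimately have "integral {0..1} (\<lambda>x. (f j x - g j x)\<^sup>2) = 0" by linarith
  hence "\<forall>x\<in>{0..1}. (f j x - g j x)\<^sup>2 = 0"
    using integral_eq_0_iff[OF cc] by auto
  thus ?thesis using x by simp
qed

lemma C1_I:
  assumes d: "\<And>j x. j \<in> {1..n} \<Longrightarrow> x \<in> {0..1} \<Longrightarrow> (f j has_real_derivative f' j x) (at x within {0..1})"
    and c: "\<And>j. j \<in> {1..n} \<Longrightarrow> continuous_on {0..1} (f' j)"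
  shows "f \<in> pts (C1 n)"
    and "n \<ge> 1 \<Longrightarrow> (\<And>j x. j \<in> {1..n} \<Longrightarrow> x \<in> {0..1} \<Longrightarrow> \<bar>f j x\<bar> \<le> A) \<Longrightarrow>
      (\<And>j x. j \<in> {1..n} \<Longrightarrow> x \<in> {0..1} \<Longrightarrow> \<bar>f' j x\<bar> \<le> B) \<Longrightarrow> nrm (C1 n) f \<le> A + B"
proof -
  have vd: "vector_derivative (f j) (at x within {0..1}) = f' j x" if "j \<in> {1..n}" "x \<in> {0..1}" for j x
    by (rule vector_derivative_within_closed_interval)
      (use d[OF that] that in \<open>auto simp: has_real_derivative_iff_has_vector_derivative\<close>)
  have "continuous_on {0..1} (\<lambda>x. vector_derivative (f j) (at x within {0..1}))" if "j \<in> {1..n}" for j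
    using c[OF that] by (rule continuous_on_eq) (use vd that in auto)
  moreover have "f j differentiable_on {0..1}" if "j \<in> {1..n}" for j
    unfolding differentiable_on_def real_differentiable_def using d[OF that] by blast
  ultimately show "f \<in> pts (C1 n)" by (simp add: C1_def)
  assume n: "n \<ge> 1" and A: "\<And>j x. j \<in> {1..n} \<Longrightarrow> x \<in> {0..1} \<Longrightarrow> \<bar>f j x\<bar> \<le> A"
    and B: "\<And>j x. j \<in> {1..n} \<Longrightarrow> x \<in> {0..1} \<Longrightarrow> \<bar>f' j x\<bar> \<le> B"
  have "(SUP x\<in>{0..1}. \<bar>f j x\<bar>) + (SUP x\<in>{0..1}. \<bar>vector_derivative (f j) (at x within {0..1})\<bar>) \<le> A + B"
    if j: "j \<in> {1..n}" for j
    by (intro add_mono cSUP_least) (use A[OF j] B[OF j] vd[OF j] in auto)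
  thus "nrm (C1 n) f \<le> A + B" using n by (simp add: C1_def)
qed

lemma C1_nrm_zero:
  assumes n: "n \<ge> 1" and z: "\<And>j x. j \<in> {1..n} \<Longrightarrow> x \<in> {0..1} \<Longrightarrow> f j x = 0"
  shows "nrm (C1 n) f = 0"
proof -
  have "(f j has_real_derivative 0) (at x within {0..1})" if "j \<in> {1..n}" "x \<in> {0..1}" for j x
    by (rule has_field_derivative_transform_within[OF DERIV_const zero_less_one that(2), of 0]) (use z that in auto)
  hence vd: "vector_derivative (f j) (at x within {0..1}) = 0" if "j \<in> {1..n}" "x \<in> {0..1}" for j x
    by (intro vector_derivative_within_closed_interval)
      (use that in \<open>auto simp: has_real_derivative_iff_has_vector_derivative\<close>)
  have "(SUP x\<in>{0..1}. \<bar>f j x\<bar>) + (SUP x\<in>{0..1}. \<bar>vector_derivative (f j) (at x within {0..1})\<bar>) = 0"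
    if j: "j \<in> {1..n}" for j
  proof -
    have "(SUP x\<in>{0..1}. \<bar>f j x\<bar>) = (SUP x\<in>{0..1::real}. 0)" by (rule SUP_cong) (use z j in auto)
    moreover have "(SUP x\<in>{0..1}. \<bar>vector_derivative (f j) (at x within {0..1})\<bar>) = (SUP x\<in>{0..1::real}. 0)"
      by (rule SUP_cong) (use vd j in auto)
    ultimately show ?thesis by simp
  qed
  hence "(\<lambda>j. (SUP x\<in>{0..1}. \<bar>f j x\<bar>) + (SUP x\<in>{0..1}. \<bar>vector_derivative (f j) (at x within {0..1})\<bar>)) ` {1..n} = {0}"
    using n by (auto simp: image_iff intro!: bexI[of _ 1])
  thus ?thesis by (simp add: C1_def)
qed

lemma C1_continuous: "f \<in> pts (C1 n) \<Longrightarrow> j \<in> {1..n} \<Longrightarrow> continuous_on {0..1} (f j)"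
  by (auto simp: C1_def intro: differentiable_imp_continuous_on)

lemma embedded_C1_L2:
  assumes n: "n \<ge> 1"
  shows "embedded (C1 n) (L2 n)"
  unfolding embedded_def
proof (intro conjI exI[of _ 1] ballI subsetI)
  fix f assume f: "f \<in> pts (C1 n)"
  show fL: "f \<in> pts (L2 n)" using C1_continuous[OF f] by (rule continuous_in_L2)
  have bdd: "bdd_above ((\<lambda>x. \<bar>g x\<bar>) ` {0..1})" if "continuous_on {0..1} g" for g :: "real \<Rightarrow> real"
    by (intro bounded_imp_bdd_above compact_imp_bounded compact_continuous_image continuous_intros that) auto
  have fj: "\<bar>f j x\<bar> \<le> nrm (C1 n) f" if j: "j \<in> {1..n}" and x: "x \<in> {0..1}" for j x
  proof -
    let ?d = "\<lambda>x. vector_derivative (f j) (at x within {0..1})"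
    have "\<bar>f j x\<bar> \<le> (SUP x\<in>{0..1}. \<bar>f j x\<bar>)"
      by (rule cSUP_upper[OF x bdd[OF C1_continuous[OF f j]]])
    moreover have "0 \<le> (SUP x\<in>{0..1}. \<bar>?d x\<bar>)"
      by (rule order_trans[OF abs_ge_zero cSUP_upper[of 0]]) (use f j in \<open>auto simp: C1_def intro!: bdd\<close>)
    moreover have "(SUP x\<in>{0..1}. \<bar>f j x\<bar>) + (SUP x\<in>{0..1}. \<bar>?d x\<bar>) \<le> nrm (C1 n) f"
      using j by (simp add: C1_def)
    ultimately show ?thesis by linarith
  qed
  show "nrm (L2 n) f \<le> 1 * nrm (C1 n) f"
    unfolding mult_1
    by (rule nrm_L2_le_sup[OF n fL]) (use order_trans[OF abs_ge_zero fj[of 1 0]] fj n in auto)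
qed

text \<open>Letting the second index tend to infinity in the Cauchy estimate keeps the rate
  \<open>c * d l\<close>, which is the same for all \<open>x\<close>; pointwise limits therefore
  come with uniform convergence.\<close>

lemma limit_with_rate:
  fixes F :: "nat \<Rightarrow> 'a \<Rightarrow> real"
  assumes le: "\<And>l l' x. x \<in> S \<Longrightarrow> \<bar>F l x - F l' x\<bar> \<le> c * (d l + d l')"
    and d: "d \<longlonglongrightarrow> 0"
  shows "\<exists>G. \<forall>x\<in>S. (\<lambda>l. F l x) \<longlonglongrightarrow> G x \<and> (\<forall>l. \<bar>F l x - G x\<bar> \<le> c * d l)"
proof -
  have "\<exists>y. (\<lambda>l. F l x) \<longlonglongrightarrow> y \<and> (\<forall>l. \<bar>F l x - y\<bar> \<le> c * d l)" if x: "x \<in> S" for x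
  proof -
    have "Cauchy (\<lambda>l. F l x)"
    proof (rule CauchyI)
      fix e :: real assume e: "e > 0"
      have "(\<lambda>l. c * d l) \<longlonglongrightarrow> c * 0" by (intro tendsto_intros d)
      from tendstoD[OF this, of "e / 2"] e have "eventually (\<lambda>l. \<bar>c * d l\<bar> < e / 2) sequentially"
        by (simp add: dist_real_def)
      then obtain M where M: "\<And>l. l \<ge> M \<Longrightarrow> \<bar>c * d l\<bar> < e / 2" by (auto simp: eventually_sequentially)
      have "norm (F l x - F l' x) < e" if "l \<ge> M" "l' \<ge> M" for l l'
        using le[OF x, of l l'] M[OF that(1)] M[OF that(2)] by (simp add: distrib_left)
      thus "\<exists>M. \<forall>m\<ge>M. \<forall>n\<ge>M. norm (F m x - F n x) < e" by blast
    qed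
    then obtain y where y: "(\<lambda>l. F l x) \<longlonglongrightarrow> y" using Cauchy_convergent convergent_def by blast
    have "\<bar>F l x - y\<bar> \<le> c * (d l + 0)" for l
    proof (rule LIMSEQ_le)
      show "(\<lambda>l'. \<bar>F l x - F l' x\<bar>) \<longlonglongrightarrow> \<bar>F l x - y\<bar>" by (intro tendsto_intros y)
      show "(\<lambda>l'. c * (d l + d l')) \<longlonglongrightarrow> c * (d l + 0)" by (intro tendsto_intros d)
    qed (use le[OF x] in auto)
    thus ?thesis using y by auto
  qed
  thus ?thesis by metis
qed

lemma generated_family_bounded:
  assumes "generated_family m n a b p U" "\<tau> \<le> t"
  shows "bounded_op (L2 n) (L2 n) (U t \<tau>)"
proof -
  have "evolution_family (L2 n) U"
    using assms(1) unfolding generated_family_def by (rule conjunct1)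
  hence "\<forall>\<tau> t. \<tau> \<le> t \<longrightarrow> bounded_op (L2 n) (L2 n) (U t \<tau>)"
    unfolding evolution_family_def by (rule conjunct1)
  thus ?thesis using assms(2) by simp
qed

lemma generated_family_approx:
  assumes "generated_family m n a b p U" "f \<in> pts (L2 n)"
  shows "\<exists>\<phi>s us. (\<forall>l. (\<forall>j\<in>{1..n}. test_fun (\<phi>s l j)) \<and> classical_solution m n a b p \<tau> (\<phi>s l) (us l)) \<and>
    (\<lambda>l. ndist (L2 n) (\<phi>s l) f) \<longlonglongrightarrow> 0 \<and>
    (\<forall>t\<^sub>1\<ge>\<tau>. uniform_limit {\<tau>..t\<^sub>1}
      (\<lambda>l t. ndist (L2 n) (\<lambda>j x. us l j (x, t)) (U t \<tau> f)) (\<lambda>t. 0) sequentially)"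
  using assms(1)[unfolded generated_family_def, THEN conjunct2, THEN conjunct2] assms(2) by simp

section \<open>Passage to square integrable initial data\<close>

context hyperbolic
begin

text \<open>The energy is a sum over components and the norm a maximum; the factor
  \<open>real n\<close> compensates.\<close>

lemma esq_le:
  assumes u: "sol \<tau> u ux ut"
  shows "esq u \<tau> \<le> real n * (nrm (L2 n) (\<lambda>j x. u j (x, \<tau>)))\<^sup>2"
proof -
  have "prim (\<lambda>z. (u j z)\<^sup>2) (1, \<tau>) \<le> (nrm (L2 n) (\<lambda>j x. u j (x, \<tau>)))\<^sup>2" if j: "j \<in> {1..n}" for j
    using L2_square_le[OF j, of "\<lambda>j x. u j (x, \<tau>)"]
      continuous_M01(3)[OF continuous_on_power[OF cont_slice[OF sol_cont[OF u j]]]]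
    by (simp add: prim_def)
  hence "esq u \<tau> \<le> (\<Sum>j=1..n. (nrm (L2 n) (\<lambda>j x. u j (x, \<tau>)))\<^sup>2)"
    unfolding esq_def by (intro sum_mono) auto
  thus ?thesis by simp
qed

text \<open>Differences of solutions are solutions, so the estimate applied to them shows that the
  approximating solutions and their \<open>x\<close>-derivatives converge uniformly at time
  \<open>t\<close>. The limit is a C^1 function; uniform convergence implies convergence in L^2,
  which identifies it with \<open>U t \<tau> f\<close>.\<close>

lemma smoothing_limit:
  assumes gen: "generated_family m n a b p U" and f: "f \<in> pts (L2 n)" and le: "\<tau> \<le> t" and K0: "K \<ge> 0"
    and K: "\<And>u ux ut j x. sol \<tau> u ux ut \<Longrightarrow> j \<in> {1..n} \<Longrightarrow> x \<in> {0..1} \<Longrightarrow>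
      \<bar>u j (x, t)\<bar> \<le> K * sqrt (esq u \<tau>) \<and> \<bar>ux j (x, t)\<bar> \<le> K * sqrt (esq u \<tau>)"
  shows "\<exists>w. w \<in> pts (C1 n) \<and> same (L2 n) w (U t \<tau> f) \<and>
    nrm (C1 n) w \<le> (4 * (K * sqrt (real n))) * nrm (L2 n) f"
proof -
  have n1: "n \<ge> 1" using n by simp
  \<comment> \<open>\<open>sqrt (real n)\<close> is the price for comparing the energy with the
    maximum norm, and 2 that of the weak triangle inequality.\<close>
  define c where "c = 2 * (K * sqrt (real n))"
  have c0: "c \<ge> 0" using K0 by (simp add: c_def)
  have Uf: "U t \<tau> f \<in> pts (L2 n)"
    using generated_family_bounded[OF gen le] f by (simp add: bounded_op_def)
  obtain \<phi>s us where cl: "\<And>l. classical_solution m n a b p \<tau> (\<phi>s l) (us l)"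
    and lim: "(\<lambda>l. ndist (L2 n) (\<phi>s l) f) \<longlonglongrightarrow> 0"
    and ul: "\<And>t\<^sub>1. t\<^sub>1 \<ge> \<tau> \<Longrightarrow> uniform_limit {\<tau>..t\<^sub>1}
          (\<lambda>l t. ndist (L2 n) (\<lambda>j x. us l j (x, t)) (U t \<tau> f)) (\<lambda>t. 0) sequentially"
    using generated_family_approx[OF gen f, of \<tau>] by auto
  have "\<exists>V Vx Vt. sol \<tau> V Vx Vt \<and> (\<forall>j\<in>{1..n}. \<forall>x\<in>{0..1}. \<forall>t\<ge>\<tau>. V j (x, t) = us l j (x, t))" for l
    by (rule classical_imp_sol[OF cl])
  then obtain V Vx Vt where V: "\<And>l. sol \<tau> (V l) (Vx l) (Vt l)"
    and Veq: "\<And>l j x t. j \<in> {1..n} \<Longrightarrow> x \<in> {0..1} \<Longrightarrow> t \<ge> \<tau> \<Longrightarrow> V l j (x, t) = us l j (x, t)"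
    by metis
  have Vc: "continuous_on {0..1} (\<lambda>x. V l j (x, s))" if "j \<in> {1..n}" for l j s
    by (rule cont_slice[OF sol_cont[OF V that]])
  have VL: "(\<lambda>j x. V l j (x, s)) \<in> pts (L2 n)" for l s by (rule continuous_in_L2[OF Vc])
  define d where "d = (\<lambda>l. ndist (L2 n) (\<lambda>j x. V l j (x, \<tau>)) f)"
  have deq: "d l = ndist (L2 n) (\<phi>s l) f" for l
    unfolding d_def ndist_def
    by (rule nrm_L2_cong) (use Veq cl[of l] in \<open>auto simp: classical_solution_def\<close>)
  have dlim: "d \<longlonglongrightarrow> 0" using lim by (simp add: deq[abs_def])
  have d0: "d l \<ge> 0" for l unfolding d_def ndist_def by (rule nrm_L2_nonneg[OF n1])
  have est: "\<bar>u j (x, t)\<bar> \<le> c * r \<and> \<bar>ux j (x, t)\<bar> \<le> c * r"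
    if u: "sol \<tau> u ux ut" and j: "j \<in> {1..n}" and x: "x \<in> {0..1}"
      and r: "nrm (L2 n) (\<lambda>j x. u j (x, \<tau>)) \<le> 2 * r" for u ux ut j x r
  proof -
    have "sqrt (esq u \<tau>) \<le> sqrt (real n * (nrm (L2 n) (\<lambda>j x. u j (x, \<tau>)))\<^sup>2)"
      using esq_le[OF u] by simp
    also have "\<dots> = sqrt (real n) * nrm (L2 n) (\<lambda>j x. u j (x, \<tau>))"
      using nrm_L2_nonneg[OF n1] by (simp add: real_sqrt_mult)
    also have "\<dots> \<le> sqrt (real n) * (2 * r)" by (intro mult_left_mono r) simp
    finally have "K * sqrt (esq u \<tau>) \<le> K * (sqrt (real n) * (2 * r))" using K0 by (rule mult_left_mono)
    also have "\<dots> = c * r" by (simp add: c_def)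
    finally show ?thesis using K[OF u j x] by auto
  qed
  have diff: "\<bar>V l j (x, t) - V l' j (x, t)\<bar> \<le> c * (d l + d l') \<and>
      \<bar>Vx l j (x, t) - Vx l' j (x, t)\<bar> \<le> c * (d l + d l')" if "j \<in> {1..n}" "x \<in> {0..1}" for l l' j x
    by (rule est[OF sol_diff[OF V V] that])
      (use ndist_L2_triangle[OF n1 VL f VL, of l \<tau> l' \<tau>] in
        \<open>simp add: d_def ndist_def[symmetric] ndist_L2_commute[of n f]\<close>)
  have bd: "\<bar>V l j (x, t)\<bar> \<le> c * (nrm (L2 n) f + d l) \<and> \<bar>Vx l j (x, t)\<bar> \<le> c * (nrm (L2 n) f + d l)"
    if "j \<in> {1..n}" "x \<in> {0..1}" for l j x
    by (rule est[OF V that]) (use nrm_L2_triangle[OF n1 VL f, of l \<tau>] in \<open>simp add: d_def\<close>)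
  obtain w where w: "\<forall>jx\<in>{1..n} \<times> {0..1}. (\<lambda>l. V l (fst jx) (snd jx, t)) \<longlonglongrightarrow> w jx \<and>
      (\<forall>l. \<bar>V l (fst jx) (snd jx, t) - w jx\<bar> \<le> c * d l)"
    using limit_with_rate[of "{1..n} \<times> {0..1}" "\<lambda>l jx. V l (fst jx) (snd jx, t)" c d, OF _ dlim] diff by force
  obtain w' where w': "\<forall>jx\<in>{1..n} \<times> {0..1}. (\<lambda>l. Vx l (fst jx) (snd jx, t)) \<longlonglongrightarrow> w' jx \<and>
      (\<forall>l. \<bar>Vx l (fst jx) (snd jx, t) - w' jx\<bar> \<le> c * d l)"
    using limit_with_rate[of "{1..n} \<times> {0..1}" "\<lambda>l jx. Vx l (fst jx) (snd jx, t)" c d, OF _ dlim] diff by force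
  define W W' where "W = (\<lambda>j x. w (j, x))" and "W' = (\<lambda>j x. w' (j, x))"
  have W: "(\<lambda>l. V l j (x, t)) \<longlonglongrightarrow> W j x" "\<bar>V l j (x, t) - W j x\<bar> \<le> c * d l"
    "(\<lambda>l. Vx l j (x, t)) \<longlonglongrightarrow> W' j x" "\<bar>Vx l j (x, t) - W' j x\<bar> \<le> c * d l"
    if "j \<in> {1..n}" "x \<in> {0..1}" for j x l
    using w[rule_format, of "(j, x)"] w'[rule_format, of "(j, x)"] that by (auto simp: W_def W'_def)
  have cd: "(\<lambda>l. c * d l) \<longlonglongrightarrow> 0" using tendsto_mult[OF tendsto_const dlim, of c] by simp
  have ev: "eventually (\<lambda>l. c * d l < e) sequentially" if "e > 0" for e
    using order_tendstoD(2)[OF cd that] .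
  have W'c: "continuous_on {0..1} (W' j)" if j: "j \<in> {1..n}" for j
  proof (rule uniform_limit_theorem)
    show "uniform_limit {0..1} (\<lambda>l x. Vx l j (x, t)) (W' j) sequentially"
    proof (rule uniform_limitI)
      fix e :: real assume "e > 0"
      from ev[OF this] show "\<forall>\<^sub>F l in sequentially. \<forall>x\<in>{0..1}. dist (Vx l j (x, t)) (W' j x) < e"
        by (rule eventually_mono) (use le_less_trans[OF W(4)[OF j]] in \<open>auto simp: dist_real_def\<close>)
    qed
    show "\<forall>\<^sub>F l in sequentially. continuous_on {0..1} (\<lambda>x. Vx l j (x, t))"
      using solD(1)[OF V j] by (intro always_eventually allI cont_slice) (auto simp: C1_strip_def)
  qed simp
  have Wd: "(W j has_real_derivative W' j x) (at x within {0..1})" if j: "j \<in> {1..n}" and x: "x \<in> {0..1}" for j x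
  proof -
    have "\<exists>g. \<forall>x\<in>{0..1}. (\<lambda>l. V l j (x, t)) \<longlonglongrightarrow> g x \<and> (g has_derivative (\<lambda>h. W' j x * h)) (at x within {0..1})"
    proof (rule has_derivative_sequence[where f = "\<lambda>l x. V l j (x, t)" and f' = "\<lambda>l x h. Vx l j (x, t) * h"
        and g' = "\<lambda>x h. W' j x * h" and ?x0.0 = x and l = "W j x"])
      show "((\<lambda>x. V l j (x, t)) has_derivative (\<lambda>h. Vx l j (x, t) * h)) (at x within {0..1})"
        if "x \<in> {0..1}" for l x
        using has_dxD[OF C1_stripD(4)[OF solD(1)[OF V j]] that] by (simp add: has_field_derivative_def)
      fix e :: real assume "e > 0"
      from ev[OF this] show "\<forall>\<^sub>F l in sequentially. \<forall>x\<in>{0..1}. \<forall>h. norm (Vx l j (x, t) * h - W' j x * h) \<le> e * norm h"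
      proof (rule eventually_mono)
        fix l assume l: "c * d l < e"
        show "\<forall>x\<in>{0..1}. \<forall>h. norm (Vx l j (x, t) * h - W' j x * h) \<le> e * norm h"
        proof (intro ballI allI)
          fix x h :: real assume x: "x \<in> {0..1}"
          have "\<bar>Vx l j (x, t) - W' j x\<bar> * \<bar>h\<bar> \<le> e * \<bar>h\<bar>"
            using W(4)[OF j x, of l] l by (intro mult_right_mono) auto
          thus "norm (Vx l j (x, t) * h - W' j x * h) \<le> e * norm h"
            by (simp add: abs_mult flip: left_diff_distrib)
        qed
      qed
    next
      show "(\<lambda>l. V l j (x, t)) \<longlonglongrightarrow> W j x" by (rule W(1)[OF j x])
    qed (use x in auto)
    then obtain g where g: "\<And>x. x \<in> {0..1} \<Longrightarrow> (\<lambda>l. V l j (x, t)) \<longlonglongrightarrow> g x"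
      "\<And>x. x \<in> {0..1} \<Longrightarrow> (g has_real_derivative W' j x) (at x within {0..1})"
      unfolding has_field_derivative_def by blast
    have "g y = W j y" if "y \<in> {0..1}" for y using LIMSEQ_unique[OF g(1)[OF that] W(1)[OF j that]] .
    thus ?thesis by (rule has_field_derivative_transform_within[OF g(2)[OF x] zero_less_one x])
  qed
  have WC: "W \<in> pts (C1 n)" by (rule C1_I(1)[OF Wd W'c])
  have WL: "W \<in> pts (L2 n)" using C1_continuous[OF WC] by (rule continuous_in_L2)
  have lim2: "(\<lambda>l. c * (nrm (L2 n) f + d l)) \<longlonglongrightarrow> c * (nrm (L2 n) f + 0)"
    by (intro tendsto_intros dlim)
  \<comment> \<open>One term bounds the function and the other its derivative; with
    \<open>c = 2 * (K * sqrt (real n))\<close> this is the factor 4 of the claim.\<close>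
  have "nrm (C1 n) W \<le> c * nrm (L2 n) f + c * nrm (L2 n) f"
  proof (rule C1_I(2)[OF Wd W'c n1])
    fix j x assume j: "j \<in> {1..n}" and x: "x \<in> {0..1::real}"
    show "\<bar>W j x\<bar> \<le> c * nrm (L2 n) f"
      using LIMSEQ_le[OF tendsto_rabs[OF W(1)[OF j x]] lim2] bd[OF j x] by auto
    show "\<bar>W' j x\<bar> \<le> c * nrm (L2 n) f"
      using LIMSEQ_le[OF tendsto_rabs[OF W(3)[OF j x]] lim2] bd[OF j x] by auto
  qed
  hence nW: "nrm (C1 n) W \<le> (4 * (K * sqrt (real n))) * nrm (L2 n) f" by (simp add: c_def)
  have VU: "(\<lambda>l. ndist (L2 n) (\<lambda>j x. V l j (x, t)) (U t \<tau> f)) \<longlonglongrightarrow> 0"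
  proof -
    have "ndist (L2 n) (\<lambda>j x. V l j (x, t)) (U t \<tau> f) = ndist (L2 n) (\<lambda>j x. us l j (x, t)) (U t \<tau> f)" for l
      unfolding ndist_def by (rule nrm_L2_cong) (use Veq le in auto)
    thus ?thesis using tendsto_uniform_limitI[OF ul[OF le], of t] le by simp
  qed
  have "ndist (L2 n) W (U t \<tau> f) \<le> 2 * (c * d l + ndist (L2 n) (\<lambda>j x. V l j (x, t)) (U t \<tau> f))" for l
  proof -
    have "ndist (L2 n) W (\<lambda>j x. V l j (x, t)) \<le> c * d l"
      unfolding ndist_def
      by (rule nrm_L2_le_sup[OF n1 L2_diff[OF n1 WL VL]])
        (use W(2) c0 d0 in \<open>auto simp: abs_minus_commute\<close>)
    hence "2 * (ndist (L2 n) W (\<lambda>j x. V l j (x, t)) + ndist (L2 n) (\<lambda>j x. V l j (x, t)) (U t \<tau> f)) \<le>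
        2 * (c * d l + ndist (L2 n) (\<lambda>j x. V l j (x, t)) (U t \<tau> f))"
      by (intro mult_left_mono add_right_mono) auto
    thus ?thesis by (rule order_trans[OF ndist_L2_triangle[OF n1 WL VL Uf]])
  qed
  moreover have "(\<lambda>l. 2 * (c * d l + ndist (L2 n) (\<lambda>j x. V l j (x, t)) (U t \<tau> f))) \<longlonglongrightarrow> 2 * (0 + 0)"
    by (intro tendsto_intros cd VU)
  ultimately have "ndist (L2 n) W (U t \<tau> f) \<le> 2 * (0 + 0)"
    by (intro LIMSEQ_le_const) auto
  hence "same (L2 n) W (U t \<tau> f)"
    using nrm_L2_nonneg[OF n1, of "\<lambda>j x. W j x - U t \<tau> f j x"] by (simp add: same_def ndist_def)
  thus ?thesis using WC nW by blast
qed

text \<open>The regular representatives are chosen separately for each \<open>f\<close>, so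
  linearity of the resulting map is not automatic. It follows from uniqueness of continuous
  representatives.\<close>

lemma smoothing_of_generated_family:
  assumes gen: "generated_family m n a b p U"
  shows "smoothing (L2 n) (C1 n) U"
proof -
  have n1: "n \<ge> 1" using n by simp
  note ev = generated_family_bounded[OF gen]
  obtain T where T: "T > 0" and TK: "\<And>\<tau> t. \<tau> + T \<le> t \<Longrightarrow> (\<exists>K\<ge>0. \<forall>u ux ut. sol \<tau> u ux ut \<longrightarrow>
    (\<forall>j\<in>{1..n}. \<forall>x\<in>{0..1}. \<bar>u j (x, t)\<bar> \<le> K * sqrt (esq u \<tau>) \<and> \<bar>ux j (x, t)\<bar> \<le> K * sqrt (esq u \<tau>)))"
    using classical_smoothing by blast
  have "\<exists>W. bounded_op (L2 n) (C1 n) W \<and> (\<forall>f\<in>pts (L2 n). same (L2 n) (W f) (U t \<tau> f))" if t: "\<tau> + T \<le> t" for \<tau> t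
  proof -
    have le: "\<tau> \<le> t" using t T by linarith
    obtain K where K0: "K \<ge> 0" and K: "\<And>u ux ut j x. sol \<tau> u ux ut \<Longrightarrow> j \<in> {1..n} \<Longrightarrow> x \<in> {0..1} \<Longrightarrow>
      \<bar>u j (x, t)\<bar> \<le> K * sqrt (esq u \<tau>) \<and> \<bar>ux j (x, t)\<bar> \<le> K * sqrt (esq u \<tau>)"
      using TK[OF t] by blast
    have "\<forall>f\<in>pts (L2 n). \<exists>w. w \<in> pts (C1 n) \<and> same (L2 n) w (U t \<tau> f) \<and>
      nrm (C1 n) w \<le> (4 * (K * sqrt (real n))) * nrm (L2 n) f"
      by (intro ballI smoothing_limit[OF gen _ le K0] K)
    then obtain W where W: "\<And>f. f \<in> pts (L2 n) \<Longrightarrow> W f \<in> pts (C1 n)"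
      "\<And>f. f \<in> pts (L2 n) \<Longrightarrow> same (L2 n) (W f) (U t \<tau> f)"
      "\<And>f. f \<in> pts (L2 n) \<Longrightarrow> nrm (C1 n) (W f) \<le> (4 * (K * sqrt (real n))) * nrm (L2 n) f"
      by (metis bchoice)
    have Wc: "continuous_on {0..1} (W f j)" if "f \<in> pts (L2 n)" "j \<in> {1..n}" for f j
      by (rule C1_continuous[OF W(1)[OF that(1)] that(2)])
    have WL: "W f \<in> pts (L2 n)" if "f \<in> pts (L2 n)" for f by (rule continuous_in_L2[OF Wc[OF that]])
    have UL: "U t \<tau> f \<in> pts (L2 n)" if "f \<in> pts (L2 n)" for f
      using ev[OF le] that by (simp add: bounded_op_def)
    \<comment> \<open>It suffices to compare with a continuous \<open>w\<close> in the L^2 class of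
      \<open>U t \<tau> h\<close>: agreement in L^2 then improves to agreement at every point, and
      the C^1 seminorm of the difference is 0.\<close>
    have lin: "same (C1 n) (W h) w" if h: "h \<in> pts (L2 n)" and w: "\<And>j. j \<in> {1..n} \<Longrightarrow> continuous_on {0..1} (w j)"
      and s: "same (L2 n) (U t \<tau> h) w" for h w
    proof -
      have "same (L2 n) (W h) w"
        by (rule same_L2_trans[OF n1 WL[OF h] UL[OF h] continuous_in_L2[OF w] W(2)[OF h] s])
      hence "W h j x = w j x" if "j \<in> {1..n}" "x \<in> {0..1}" for j x
        by (rule same_L2_continuous_eq) (use that Wc[OF h that(1)] w[OF that(1)] in auto)
      thus ?thesis unfolding same_def ndist_def by (intro C1_nrm_zero[OF n1]) auto
    qed
    have "bounded_op (L2 n) (C1 n) W"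
      unfolding bounded_op_def
    proof (intro conjI ballI allI)
      fix f g assume f: "f \<in> pts (L2 n)" and g: "g \<in> pts (L2 n)"
      let ?h = "\<lambda>j x. f j x + g j x"
      have h: "?h \<in> pts (L2 n)" by (rule L2_add[OF n1 f g])
      show "same (C1 n) (W ?h) (\<lambda>j x. W f j x + W g j x)"
      proof (rule lin[OF h])
        have "same (L2 n) (U t \<tau> ?h) (\<lambda>j x. U t \<tau> f j x + U t \<tau> g j x)"
          using ev[OF le] f g unfolding bounded_op_def by blast
        moreover have "same (L2 n) (\<lambda>j x. U t \<tau> f j x + U t \<tau> g j x) (\<lambda>j x. W f j x + W g j x)"
          by (intro same_L2_add n1 UL WL f g same_L2_sym[OF W(2)])
        ultimately show "same (L2 n) (U t \<tau> ?h) (\<lambda>j x. W f j x + W g j x)"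
          by (rule same_L2_trans[OF n1 UL[OF h] L2_add[OF n1 UL[OF f] UL[OF g]] L2_add[OF n1 WL[OF f] WL[OF g]]])
      qed (intro continuous_on_add Wc f g)
    next
      fix f and r :: real assume f: "f \<in> pts (L2 n)"
      let ?h = "\<lambda>j x. r * f j x"
      have h: "?h \<in> pts (L2 n)" by (rule L2_scale[OF f])
      show "same (C1 n) (W ?h) (\<lambda>j x. r * W f j x)"
      proof (rule lin[OF h])
        have "same (L2 n) (U t \<tau> ?h) (\<lambda>j x. r * U t \<tau> f j x)"
          using ev[OF le] f unfolding bounded_op_def by blast
        moreover have "same (L2 n) (\<lambda>j x. r * U t \<tau> f j x) (\<lambda>j x. r * W f j x)"
          by (intro same_L2_scale same_L2_sym[OF W(2)] f)
        ultimately show "same (L2 n) (U t \<tau> ?h) (\<lambda>j x. r * W f j x)"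
          by (rule same_L2_trans[OF n1 UL[OF h] L2_scale[OF UL[OF f]] L2_scale[OF WL[OF f]]])
      qed (intro continuous_on_mult_left Wc f)
    qed (use W in auto)
    thus ?thesis using W(2) by blast
  qed
  thus ?thesis
    unfolding smoothing_def using embedded_C1_L2[OF n1] ev T by blast
qed

end

section \<open>From the stated hypotheses to the estimates\<close>

theorem theorem2p5:
  fixes n m :: nat
    and p :: "nat \<Rightarrow> nat \<Rightarrow> real"
    and a :: "nat \<Rightarrow> real \<times> real \<Rightarrow> real"
    and b :: "nat \<Rightarrow> nat \<Rightarrow> real \<times> real \<Rightarrow> real"
    and \<Lambda>\<^sub>0 :: real
    and U :: "real \<Rightarrow> real \<Rightarrow> (nat \<Rightarrow> real \<Rightarrow> real) \<Rightarrow> (nat \<Rightarrow> real \<Rightarrow> real)"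
  assumes "n \<ge> 2" and "m \<le> n"
    and "\<forall>j\<in>{1..n}. a j \<in> BC1"
    and "\<forall>j\<in>{1..n}. \<forall>k\<in>{1..n}. b j k \<in> BC1"
    and "\<Lambda>\<^sub>0 > 0"
    and "\<forall>j\<in>{1..m}. (INF z\<in>strip. a j z) \<ge> \<Lambda>\<^sub>0"
    and "\<forall>j\<in>{m+1..n}. (SUP z\<in>strip. a j z) \<le> - \<Lambda>\<^sub>0"
    and "\<exists>k::nat. \<forall>u. (\<forall>j\<in>{1..n}. continuous_on strip (u j)) \<longrightarrow>
           (\<forall>j\<in>{1..n}. \<forall>z\<in>strip. ((\<lambda>v. Cop m a b (Pop m n p v)) ^^ k) u j z = 0)"
    and "\<forall>j\<in>{1..n}. \<forall>k\<in>{1..n}. j \<noteq> k \<longrightarrow>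
           (\<exists>\<beta>\<in>BC1. \<forall>z\<in>strip. b j k z = \<beta> z * (a k z - a j z))"
    and "generated_family m n a b p U"
  shows "smoothing (L2 n) (C1 n) U"
proof -
  have aBC: "BC1_strip (a j) (dx strip (a j)) (dt strip (a j))" if "j \<in> {1..n}" for j
    using assms(3) that by (intro BC1_imp_BC1_strip) auto
  \<comment> \<open>Boundedness of \<open>a_j\<close> is what allows the infimum and the supremum in
    the hypotheses to be read as bounds at every point.\<close>
  have bdd: "bdd_below (a j ` strip)" "bdd_above (a j ` strip)" if "j \<in> {1..n}" for j
    using assms(3) that by (auto simp: BC1_def intro: bounded_imp_bdd_below bounded_imp_bdd_above)
  have pos: "\<Lambda>\<^sub>0 \<le> a j z" if "j \<in> {1..n}" "j \<le> m" "z \<in> strip" for j z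
    using order_trans[OF _ cINF_lower[OF bdd(1)[OF that(1)] that(3)], of \<Lambda>\<^sub>0] assms(6) that by auto
  have neg: "a j z \<le> - \<Lambda>\<^sub>0" if "j \<in> {1..n}" "m < j" "z \<in> strip" for j z
    using order_trans[OF cSUP_upper[OF that(3) bdd(2)[OF that(1)]], of "- \<Lambda>\<^sub>0"] assms(7) that by auto
  have abs: "\<Lambda>\<^sub>0 \<le> \<bar>a j z\<bar>" if "j \<in> {1..n}" "z \<in> strip" for j z
    using pos[of j z] neg[of j z] that by (cases "j \<le> m") auto
  obtain N where N: "\<And>u j z. (\<forall>j\<in>{1..n}. continuous_on strip (u j)) \<Longrightarrow> j \<in> {1..n} \<Longrightarrow> z \<in> strip \<Longrightarrow>
      ((\<lambda>v. Cop m a b (Pop m n p v)) ^^ N) u j z = 0"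
    using assms(8) by blast
  \<comment> \<open>The pairs are packed into one index so that a single choice provides all factors
    \<open>\<beta>\<close> at once.\<close>
  have "\<forall>jk\<in>{jk. fst jk \<in> {1..n} \<and> snd jk \<in> {1..n} \<and> fst jk \<noteq> snd jk}. \<exists>\<beta>. \<beta> \<in> BC1 \<and>
      (\<forall>z\<in>strip. b (fst jk) (snd jk) z = \<beta> z * (a (snd jk) z - a (fst jk) z))"
    using assms(9) by (auto simp: Bex_def)
  then obtain \<beta> where "\<forall>jk\<in>{jk. fst jk \<in> {1..n} \<and> snd jk \<in> {1..n} \<and> fst jk \<noteq> snd jk}. \<beta> jk \<in> BC1 \<and>
      (\<forall>z\<in>strip. b (fst jk) (snd jk) z = \<beta> jk z * (a (snd jk) z - a (fst jk) z))"
    by (rule bchoice[elim_format]) blast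
  hence \<beta>: "\<beta> (j, k) \<in> BC1" "z \<in> strip \<Longrightarrow> b j k z = \<beta> (j, k) z * (a k z - a j z)"
    if "j \<in> {1..n}" "k \<in> {1..n}" "j \<noteq> k" for j k z
    using that by auto
  define fx ft where "fx = (\<lambda>j z. - dx strip (a j) z * ((1 / a j z) * (1 / a j z)))"
    and "ft = (\<lambda>j z. - dt strip (a j) z * ((1 / a j z) * (1 / a j z)))"
  have f: "BC1_strip (\<lambda>z. 1 / a j z) (fx j) (ft j)" if "j \<in> {1..n}" for j
    unfolding fx_def ft_def by (rule BC1_strip_inverse[OF aBC[OF that] assms(5) abs[OF that]])
  have "\<exists>L>0. \<forall>z\<in>strip. \<bar>1 / a j z\<bar> \<le> L \<and> \<bar>ft j z\<bar> \<le> L" if j: "j \<in> {1..n}" for j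
  proof -
    obtain A where A: "A > 0" "\<And>z. z \<in> strip \<Longrightarrow> \<bar>1 / a j z\<bar> \<le> A"
      using bounded_stripE f[OF j] unfolding BC1_strip_def by metis
    obtain B where B: "B > 0" "\<And>z. z \<in> strip \<Longrightarrow> \<bar>ft j z\<bar> \<le> B"
      using bounded_stripE f[OF j] unfolding BC1_strip_def by metis
    have "\<bar>1 / a j z\<bar> \<le> A + B \<and> \<bar>ft j z\<bar> \<le> A + B" if "z \<in> strip" for z
      using A(1) A(2)[OF that] B(1) B(2)[OF that] by linarith
    thus ?thesis using A(1) B(1) by (intro exI[of _ "A + B"]) auto
  qed
  then obtain Lf where Lf: "\<And>j. j \<in> {1..n} \<Longrightarrow> Lf j > 0"
    "\<And>j z. j \<in> {1..n} \<Longrightarrow> z \<in> strip \<Longrightarrow> \<bar>1 / a j z\<bar> \<le> Lf j \<and> \<bar>ft j z\<bar> \<le> Lf j" by metis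
  \<comment> \<open>The sum of finitely many positive constants dominates each, which gives all
    characteristic flows the same \<open>L\<close>.\<close>
  define L where "L = (\<Sum>j=1..n. Lf j)"
  have LfL: "Lf j \<le> L" if "j \<in> {1..n}" for j
    unfolding L_def by (rule member_le_sum) (use that Lf(1) in \<open>auto intro: less_imp_le\<close>)
  have fl: "flow (a j) (fx j) (ft j) L" if j: "j \<in> {1..n}" for j
  proof
    show "C1_strip (\<lambda>z. 1 / a j z) (fx j) (ft j)" using f[OF j] by (simp add: BC1_strip_def)
    show "L > 0" using Lf(1)[OF j] LfL[OF j] by linarith
    show "\<bar>1 / a j z\<bar> \<le> L" "\<bar>ft j z\<bar> \<le> L" if "z \<in> strip" for z
      using Lf(2)[OF j that] LfL[OF j] by linarith+
  qed
  interpret hyperbolic n m N p a b "\<lambda>j k. \<beta> (j, k)" \<Lambda>\<^sub>0 L fx ft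
    by (rule hyperbolic.intro)
      (use assms(1,2,4,5) aBC pos neg fl N \<beta> in \<open>auto intro: BC1_imp_BC1_strip\<close>)
  show ?thesis by (rule smoothing_of_generated_family[OF assms(10)])
qed

end
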